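(* Let $v\in\mathbb{N}^{\ell+t+1}$. There exists $D_{v,n}\in\mathbb{N}$ such that for any ideal $I\subseteq R$ of type $v$ with $\alpha(I)\ge D_{v,n}$, for all $k\in\{0,1,\dots,t\}$, all $r\in\{3,4,\dots,n\}$, and all $e=(e_3,e_4,\dots,e_r)\in\mathbb{N}^{r-2}$ with $E=e_3+\cdots+e_r\le k$, we have $$\operatorname{ubl}_I^{(r,e)}(\alpha(I)+k)\ \ge\ \gamma_I(\alpha(I)+k-E)-1.$$
   Context: $\mathbb{N}=\{0,1,2,\dots\}$. $K$ is a field of characteristic $0$, $n\ge 3$, $R=K[x_1,\dots,x_n]$ is standard graded, and all ideals are homogeneous. $\alpha(I)$ is the smallest degree of a minimal generator of $I$, and $I_d$ is the degree-$d$ component. Type: let $\ell\ge1$, $t\ge 0$ be integers. An ideal $I$ is of type $v=(a_1,\dots,a_\ell,b_0,\dots,b_t)\in\mathbb{N}^{\ell+t+1}$ if there is a regular sequence of forms $f_1,\dots,f_\ell\in I$ with $\deg f_i=\alpha(I)+a_i$ and $\deg f_i\le\deg f_{i+1}$, and for all $j\in\{0,\dots,t\}$, $I$ has exactly $b_j$ minimal generators in degree $\alpha(I)+j$. For $d\in\mathbb{N}$, $\gamma_I(d)=\gamma_{v,I}(d)$ is the largest $i\in\{1,\dots,\ell\}$ with $\alpha(I)+a_i\le d$, and $\gamma_I(d)=0$ if $d<\alpha(I)+a_1$ (here $\alpha(I)+a_1\ge 2$ is assumed). Revlex order: for monomials of the same degree, $x^p>x^q$ if the last nonzero entry of $p-q$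 is negative. $\operatorname{gin}(I)$ is the generic initial ideal with respect to revlex, i.e. the common value of $\operatorname{in}(\sigma(I))$ for $\sigma$ in a nonempty Zariski open set of linear changes of coordinates. Let $3\le r\le n$, $e=(e_3,\dots,e_r)\in\mathbb{N}^{r-2}$, $E=e_3+\cdots+e_r$, with $d-E\ge1$. A monomial $x_1^{d-j-E}x_2^jx_3^{e_3}\cdots x_r^{e_r}\in\operatorname{gin}(I)_d$ with $j\ge1$ is $(r,e)$-uncovered if $x_1^{d-j-E}x_2^{j-1}x_3^{e_3}\cdots x_{r-1}^{e_{r-1}}x_r^{e_r+1}\notin\operatorname{gin}(I)_d$. $\operatorname{ubl}_I^{(r,e)}(d)$ is the number of $(r,e)$-uncovered monomials $x_1^{d-j-E}x_2^jx_3^{e_3}\cdots x_r^{e_r}\in\operatorname{gin}(I)_d$ with $j\in\{1,\dots,d-E\}$. *)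

theory Defs
  imports
    "HOL-Library.Poly_Mapping"
    "HOL-Algebra.Ideal"
    "Jordan_Normal_Form.Matrix"
begin

section \<open>The polynomial ring\<close>

type_synonym ('i, 'k) mpoly = "('i \<Rightarrow>\<^sub>0 nat) \<Rightarrow>\<^sub>0 'k"

definition polys_in :: "'i set \<Rightarrow> ('i, 'k::zero) mpoly set"
  where "polys_in V = {p. \<forall>m\<in>Poly_Mapping.keys p. Poly_Mapping.keys m \<subseteq> V}"

text \<open>The ring in the variables with indices \<open>1, \<dots>, n\<close>, as a structure of HOL-Algebra, so that
  the library notions \<^const>\<open>ideal\<close> and \<^const>\<open>genideal\<close> apply.\<close>

definition poly_ring :: "nat \<Rightarrow> (nat, 'k::field_char_0) mpoly ring"
  where "poly_ring n =
    \<lparr>carrier = polys_in {1..n}, monoid.mult = (*), one = 1, zero = 0, add = (+)\<rparr>"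

definition monomial :: "('i \<Rightarrow>\<^sub>0 nat) \<Rightarrow> ('i, 'k::field_char_0) mpoly"
  where "monomial m = Poly_Mapping.single m 1"

definition mon_deg :: "('i \<Rightarrow>\<^sub>0 nat) \<Rightarrow> nat"
  where "mon_deg m = (\<Sum>i\<in>Poly_Mapping.keys m. Poly_Mapping.lookup m i)"

text \<open>Forms are nonzero by convention, so that their degree is determined.\<close>

definition is_form :: "nat \<Rightarrow> nat \<Rightarrow> (nat, 'k::field_char_0) mpoly \<Rightarrow> bool"
  where "is_form n d f \<longleftrightarrow>
    f \<in> carrier (poly_ring n) \<and> f \<noteq> 0 \<and> (\<forall>m\<in>Poly_Mapping.keys f. mon_deg m = d)"

text \<open>Evaluation at the point \<open>x\<close>, the coefficients being mapped by \<open>h\<close>.\<close>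

definition poly_subst ::
    "('k::zero \<Rightarrow> 'r::comm_semiring_1) \<Rightarrow> ('i \<Rightarrow> 'r) \<Rightarrow> ('i, 'k) mpoly \<Rightarrow> 'r"
  where "poly_subst h x p =
    (\<Sum>m\<in>Poly_Mapping.keys p. h (Poly_Mapping.lookup p m) *
      (\<Prod>i\<in>Poly_Mapping.keys m. x i ^ Poly_Mapping.lookup m i))"

section \<open>Homogeneous ideals, minimal generators, type\<close>

definition homogeneous_ideal :: "nat \<Rightarrow> (nat, 'k::field_char_0) mpoly set \<Rightarrow> bool"
  where "homogeneous_ideal n I \<longleftrightarrow>
    ideal I (poly_ring n) \<and>
    (\<exists>S. (\<forall>f\<in>S. \<exists>d. is_form n d f) \<and> I = genideal (poly_ring n) S)"

definition minimal_generators ::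
    "nat \<Rightarrow> (nat, 'k::field_char_0) mpoly set \<Rightarrow> (nat, 'k) mpoly set \<Rightarrow> bool"
  where "minimal_generators n I G \<longleftrightarrow>
    finite G \<and> (\<forall>g\<in>G. \<exists>d. is_form n d g) \<and> genideal (poly_ring n) G = I \<and>
    (\<forall>G'. G' \<subset> G \<longrightarrow> genideal (poly_ring n) G' \<noteq> I)"

definition alpha :: "nat \<Rightarrow> (nat, 'k::field_char_0) mpoly set \<Rightarrow> nat"
  where "alpha n I = (LEAST d. \<exists>G. minimal_generators n I G \<and> (\<exists>g\<in>G. is_form n d g))"

text \<open>\<open>f 1, \<dots>, f l\<close> is a regular sequence: each \<open>f i\<close> is a nonzerodivisor modulo
  \<open>f 1, \<dots>, f (i - 1)\<close>, and the quotient by the whole sequence is nonzero.\<close>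

definition regular_sequence :: "('a, 'b) ring_scheme \<Rightarrow> nat \<Rightarrow> (nat \<Rightarrow> 'a) \<Rightarrow> bool"
  where "regular_sequence R l f \<longleftrightarrow>
    (\<forall>i\<in>{1..l}. f i \<in> carrier R) \<and>
    (\<forall>i\<in>{1..l}. \<forall>h\<in>carrier R.
      f i \<otimes>\<^bsub>R\<^esub> h \<in> genideal R (f ` {1..<i}) \<longrightarrow> h \<in> genideal R (f ` {1..<i})) \<and>
    genideal R (f ` {1..l}) \<noteq> carrier R"

text \<open>The vector \<open>v = (a\<^sub>1, \<dots>, a\<^sub>l, b\<^sub>0, \<dots>, b\<^sub>t)\<close> is given by \<open>l\<close>, \<open>t\<close> and two functions, of
  which only the values \<open>a 1, \<dots>, a l\<close> and \<open>b 0, \<dots>, b t\<close> are used. The number of minimal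
  generators in a given degree does not depend on the choice of \<open>G\<close>.\<close>

definition of_type ::
    "nat \<Rightarrow> nat \<Rightarrow> nat \<Rightarrow> (nat \<Rightarrow> nat) \<Rightarrow> (nat \<Rightarrow> nat) \<Rightarrow> (nat, 'k::field_char_0) mpoly set \<Rightarrow> bool"
  where "of_type n l t a b I \<longleftrightarrow>
    (\<exists>f. regular_sequence (poly_ring n) l f \<and>
      (\<forall>i\<in>{1..l}. f i \<in> I \<and> is_form n (alpha n I + a i) (f i)) \<and>
      (\<forall>i\<in>{1..<l}. alpha n I + a i \<le> alpha n I + a (i + 1))) \<and>
    (\<exists>G. minimal_generators n I G \<and>
      (\<forall>j\<in>{0..t}. card {g\<in>G. is_form n (alpha n I + j) g} = b j))"

definition gamma ::
    "nat \<Rightarrow> nat \<Rightarrow> (nat \<Rightarrow> nat) \<Rightarrow> (nat, 'k::field_char_0) mpoly set \<Rightarrow> nat \<Rightarrow> nat"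
  where "gamma n l a I d =
    (if d < alpha n I + a 1 then 0 else Max {i\<in>{1..l}. alpha n I + a i \<le> d})"

section \<open>Generic initial ideals\<close>

definition revlex_greater :: "(nat \<Rightarrow>\<^sub>0 nat) \<Rightarrow> (nat \<Rightarrow>\<^sub>0 nat) \<Rightarrow> bool"
  where "revlex_greater p q \<longleftrightarrow>
    mon_deg p = mon_deg q \<and>
    (\<exists>i. Poly_Mapping.lookup p i < Poly_Mapping.lookup q i \<and>
      (\<forall>j>i. Poly_Mapping.lookup p j = Poly_Mapping.lookup q j))"

definition is_leading_monomial :: "(nat, 'k::field_char_0) mpoly \<Rightarrow> (nat \<Rightarrow>\<^sub>0 nat) \<Rightarrow> bool"
  where "is_leading_monomial f m \<longleftrightarrow>
    m \<in> Poly_Mapping.keys f \<and> (\<forall>m'\<in>Poly_Mapping.keys f. m' \<noteq> m \<longrightarrow> revlex_greater m m')"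

text \<open>Only used for homogeneous \<open>J\<close>, hence only leading monomials of forms are needed.\<close>

definition initial_ideal ::
    "nat \<Rightarrow> (nat, 'k::field_char_0) mpoly set \<Rightarrow> (nat, 'k) mpoly set"
  where "initial_ideal n J =
    genideal (poly_ring n)
      {monomial m | m. \<exists>f\<in>J. (\<exists>d. is_form n d f) \<and> is_leading_monomial f m}"

definition GL :: "nat \<Rightarrow> 'k::field_char_0 mat set"
  where "GL n = {A \<in> carrier_mat n n. invertible_mat A}"

text \<open>The change of coordinates sending the \<open>j\<close>-th variable to the linear form whose coefficients
  are the \<open>j\<close>-th column of \<open>A\<close>. Matrix indices start at \<open>0\<close>, variable indices at \<open>1\<close>.\<close>

definition coord_change :: "nat \<Rightarrow> 'k::field_char_0 mat \<Rightarrow> (nat, 'k) mpoly \<Rightarrow> (nat, 'k) mpoly"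
  where "coord_change n A =
    poly_subst (Poly_Mapping.single 0)
      (\<lambda>j. \<Sum>i\<in>{1..n}. Poly_Mapping.single (Poly_Mapping.single i 1) (A $$ (i - 1, j - 1)))"

text \<open>Zariski open subsets of \<^const>\<open>GL\<close>: complements of the common zero sets of families of
  polynomials in the matrix entries.\<close>

definition zariski_open :: "nat \<Rightarrow> 'k::field_char_0 mat set \<Rightarrow> bool"
  where "zariski_open n U \<longleftrightarrow>
    (\<exists>F \<subseteq> polys_in ({0..<n} \<times> {0..<n}).
      U = {A \<in> GL n. \<exists>P\<in>F. poly_subst id (\<lambda>ij. A $$ ij) P \<noteq> 0})"

definition gin :: "nat \<Rightarrow> (nat, 'k::field_char_0) mpoly set \<Rightarrow> (nat, 'k) mpoly set"
  where "gin n I =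
    (THE J. \<exists>U. zariski_open n U \<and> U \<noteq> {} \<and>
      (\<forall>A\<in>U. initial_ideal n (coord_change n A ` I) = J))"

section \<open>Uncovered monomials\<close>

text \<open>The exponent of \<open>x\<^sub>1^p * x\<^sub>2^q * x\<^sub>3^(e 3) * \<dots> * x\<^sub>r^(e r)\<close>. Only the values \<open>e 3, \<dots>, e r\<close> matter.\<close>

definition mon :: "nat \<Rightarrow> (nat \<Rightarrow> nat) \<Rightarrow> nat \<Rightarrow> nat \<Rightarrow> (nat \<Rightarrow>\<^sub>0 nat)"
  where "mon r e p q =
    Poly_Mapping.single 1 p + Poly_Mapping.single 2 q + (\<Sum>i\<in>{3..r}. Poly_Mapping.single i (e i))"

definition uncovered ::
    "nat \<Rightarrow> (nat, 'k::field_char_0) mpoly set \<Rightarrow> nat \<Rightarrow> (nat \<Rightarrow> nat) \<Rightarrow> nat \<Rightarrow> nat \<Rightarrow> bool"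
  where "uncovered n I r e d j \<longleftrightarrow>
    j \<ge> 1 \<and>
    monomial (mon r e (d - j - (\<Sum>i\<in>{3..r}. e i)) j) \<in> gin n I \<and>
    monomial (mon r (e(r := e r + 1)) (d - j - (\<Sum>i\<in>{3..r}. e i)) (j - 1)) \<notin> gin n I"

definition ubl ::
    "nat \<Rightarrow> (nat, 'k::field_char_0) mpoly set \<Rightarrow> nat \<Rightarrow> (nat \<Rightarrow> nat) \<Rightarrow> nat \<Rightarrow> nat"
  where "ubl n I r e d =
    card {mon r e (d - j - (\<Sum>i\<in>{3..r}. e i)) j | j.
      j \<in> {1..d - (\<Sum>i\<in>{3..r}. e i)} \<and> uncovered n I r e d j}"

section \<open>The structure is a commutative ring\<close>

lemma polys_in_add: "p \<in> polys_in V \<Longrightarrow> q \<in> polys_in V \<Longrightarrow> p + q \<in> polys_in V"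
  using Poly_Mapping.keys_add[of p q] by (auto simp: polys_in_def)

lemma polys_in_mult:
  fixes p q :: "('i, 'k::comm_ring_1) mpoly"
  assumes "p \<in> polys_in V" "q \<in> polys_in V"
  shows "p * q \<in> polys_in V"
proof -
  have "Poly_Mapping.keys m \<subseteq> V" if m: "m \<in> Poly_Mapping.keys (p * q)" for m
  proof -
    obtain u w where uw: "u \<in> Poly_Mapping.keys p" "w \<in> Poly_Mapping.keys q" "m = u + w"
      using m keys_mult[of p q] by blast
    then have "Poly_Mapping.keys u \<subseteq> V" "Poly_Mapping.keys w \<subseteq> V"
      using assms by (auto simp: polys_in_def)
    then show ?thesis using Poly_Mapping.keys_add[of u w] uw by blast
  qed
  then show ?thesis by (auto simp: polys_in_def)
qed

lemma cring_poly_ring: "cring (poly_ring n :: (nat, 'k::field_char_0) mpoly ring)"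
proof (rule cringI)
  let ?R = "poly_ring n :: (nat, 'k) mpoly ring"
  have "p \<in> carrier ?R \<Longrightarrow> \<exists>q\<in>carrier ?R. q \<oplus>\<^bsub>?R\<^esub> p = \<zero>\<^bsub>?R\<^esub>" for p
    by (intro bexI[of _ "- p"]) (auto simp: poly_ring_def polys_in_def)
  moreover have "\<zero>\<^bsub>?R\<^esub> \<in> carrier ?R"
    by (simp add: poly_ring_def polys_in_def)
  ultimately show "abelian_group ?R"
    by (intro abelian_groupI) (simp_all add: poly_ring_def polys_in_add ac_simps)
  have "\<one>\<^bsub>?R\<^esub> \<in> carrier ?R"
    by (simp add: poly_ring_def polys_in_def)
  then show "comm_monoid ?R"
    by (intro comm_monoidI) (simp_all add: poly_ring_def polys_in_mult ac_simps)
qed (simp add: poly_ring_def algebra_simps)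

end

theory Submission
  imports Defs "Jordan_Normal_Form.Determinant"
begin

text \<open>Let \<open>d = \<alpha>(I) + k\<close>, let \<open>c\<close> be the vector of exponents \<open>(e\<^sub>3, \<dots>, e\<^sub>r)\<close>, and put \<open>E = |c|\<close>. In
  generic coordinates the monomials of \<open>gin(I)\<close> of degree \<open>d\<close> are the leading monomials of \<open>I\<^sub>d\<close>. Revlex
  compares the exponents of the last variables first, so the leading monomials with exponents \<open>c\<close> after
  the second variable are those of a space \<open>V\<close> of binary forms of degree \<open>d - E\<close>, the slice at \<open>c\<close>: all
  \<open>g\<close> such that \<open>I\<^sub>d\<close> contains \<open>x\<^sup>c g\<close> plus terms that revlex places below because of their exponents after
  the second variable (\<open>leading_slice\<close>). Let \<open>W\<close> be the slice at the vector in which the exponent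
  of \<open>x\<^sub>r\<close> is one larger. A monomial of \<open>V\<close> can be covered only by a monomial of \<open>W\<close>, so the number of uncovered monomials is at least \<open>dim V - dim W - 1\<close>
  (\<open>ubl_ge_slices\<close>), and the task is to show \<open>dim V - dim W \<ge> \<gamma>\<close>. Three facts carry the proof.

  First, \<open>x\<^sub>1 W\<close> and \<open>x\<^sub>2 W\<close> lie in \<open>V\<close> (\<open>slice_mult_var\<close>). In generic coordinates a small deformation
  \<open>x\<^sub>r \<mapsto> x\<^sub>r + s x\<^sub>1\<close> does not change the dimensions involved, so one can differentiate with respect to
  \<open>s\<close>; the derivation \<open>x\<^sub>1 \<partial>/\<partial>x\<^sub>r\<close> then maps \<open>W\<close> to \<open>V\<close>, and there it is multiplication by \<open>x\<^sub>1\<close> and a positive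
  integer.

  Second, write \<open>S\<^sub>j V\<close> for the multiples of \<open>V\<close> by binary forms of degree \<open>j\<close>. Whenever \<open>x\<^sub>1 W\<close> and
  \<open>x\<^sub>2 W\<close> lie in \<open>V\<close>, \<open>dim S\<^sub>1 V - dim V \<le> dim V - dim W\<close> (\<open>dim_shift_le\<close>). Hence the increments of
  \<open>dim S\<^sub>j V\<close> never grow, and if \<open>dim V - dim W < \<gamma>\<close>, they all stay below \<open>\<gamma>\<close>. The dimension of \<open>V\<close> is
  bounded by a constant that depends only on the type and on \<open>n\<close> (\<open>dim_degree_part_le\<close>), so \<open>dim S\<^sub>j V < \<gamma> j\<close>
  as soon as \<open>j\<close> exceeds this constant.

  Third, \<open>V\<close> contains the restrictions \<open>G\<close> to the line \<open>x\<^sub>3 = \<dots> = x\<^sub>n = 0\<close> of \<open>\<gamma>\<close> forms of the regular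
  sequence, raised to the common degree \<open>d - E\<close>, and \<open>dim S\<^sub>j G \<ge> \<gamma> j\<close> if \<open>\<alpha>(I)\<close> is large compared with
  \<open>j\<close> (\<open>growth_of_restriction\<close>). Together with the second fact this is a contradiction (\<open>slices_gap\<close>).

  The third fact is where the regular sequence enters: its members have no relations with coefficients of
  degree less than \<open>\<alpha>(I)\<close>, so in \<open>n\<close> variables their multiples by forms of degree \<open>M\<close> span \<open>\<gamma>\<close> times as
  many dimensions as there are monomials of degree \<open>M\<close> (\<open>regular_sequence_free\<close>). Suppose that an increment
  of \<open>dim S\<^sub>j G\<close> is below \<open>\<gamma>\<close>. Increments can drop at most \<open>\<gamma>\<close> times, so they equal some \<open>\<rho> < \<gamma>\<close> on a
  long interval. There the first two facts, now applied to the space of multiples itself, show that its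
  slice at a vector \<open>c\<close> lies in \<open>S\<^bsub>M - |c|\<^esub> G\<close> (\<open>dim_slices_bound\<close>). Summing over \<open>c\<close> bounds the space of
  multiples by \<open>\<rho>\<close> times the number of monomials plus lower order terms
  (\<open>no_long_constant_increment\<close>), which is too small.

  That \<open>gin(I)\<close> is well defined (\<open>generically_gin\<close>) belongs to the proof. In each degree the leading
  monomials are determined by the dimensions of coefficient projections, which take their largest values on
  a Zariski open set, and Dickson's lemma reduces to finitely many degrees.\<close>

abbreviation "lookup \<equiv> Poly_Mapping.lookup"
abbreviation "keys \<equiv> Poly_Mapping.keys"
abbreviation "single \<equiv> Poly_Mapping.single"

section \<open>Finite-dimensional subspaces of an arbitrary vector space\<close>

text \<open>Subspaces here lie in spaces of infinite dimension, so the statements on dimension are relative to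
  a finite spanning set.\<close>

locale scalar_space = vector_space scale
  for scale :: "'a::field \<Rightarrow> 'b::ab_group_add \<Rightarrow> 'b"
begin

definition fin_span :: "'b set \<Rightarrow> bool"
  where "fin_span V \<longleftrightarrow> (\<exists>B. finite B \<and> V \<subseteq> span B)"

lemma fin_span_subset: "fin_span V \<Longrightarrow> W \<subseteq> V \<Longrightarrow> fin_span W"
  unfolding fin_span_def by blast

lemma fin_span_span: "finite B \<Longrightarrow> fin_span (span B)"
  unfolding fin_span_def by blast

lemma fin_span_independent:
  assumes "fin_span V" "B \<subseteq> V" "independent B"
  shows "finite B"
  using assms independent_span_bound unfolding fin_span_def by (meson subset_trans)

lemma fin_span_basis:
  assumes "fin_span V"
  obtains B where "finite B" "B \<subseteq> V" "independent B" "V \<subseteq> span B" "card B = dim V"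
  using basis_exists[of V] fin_span_independent[OF assms] by metis

lemma independent_card_le_dim:
  assumes "fin_span V" "B \<subseteq> V" "independent B"
  shows "card B \<le> dim V"
proof -
  obtain C where "finite C" "V \<subseteq> span C" "card C = dim V"
    using fin_span_basis[OF assms(1)] by metis
  then show ?thesis
    using independent_span_bound[of C B] assms by (metis subset_trans)
qed

lemma dim_mono_finite:
  assumes "fin_span V" "W \<subseteq> V"
  shows "dim W \<le> dim V"
  using fin_span_basis[OF fin_span_subset[OF assms]] independent_card_le_dim[OF assms(1)] assms(2)
  by (metis subset_trans)

lemma subspace_eq_of_dim_le:
  assumes "fin_span V" "subspace W" "W \<subseteq> V" "dim V \<le> dim W"
  shows "W = V"
proof (rule ccontr)
  assume "W \<noteq> V"
  then obtain v where v: "v \<in> V" "v \<notin> W" using assms by blast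
  obtain B where B: "finite B" "B \<subseteq> W" "independent B" "W \<subseteq> span B" "card B = dim W"
    using fin_span_basis[OF fin_span_subset[OF assms(1,3)]] .
  have "v \<notin> span B" using v B(2) assms(2) span_minimal by blast
  then have "independent (insert v B)" "v \<notin> B"
    using B(3) independent_insertI span_base by blast+
  then have "card (insert v B) \<le> dim V"
    using independent_card_le_dim[OF assms(1), of "insert v B"] B(2) assms(3) v by blast
  then show False using B \<open>v \<notin> B\<close> assms(4) by simp
qed

lemma subspace_complement:
  assumes "fin_span V" "subspace W" "W \<subseteq> V"
  obtains C where "finite C" "C \<subseteq> V" "V \<subseteq> span (W \<union> C)" "card C + dim W = dim V"
proof -
  obtain B where B: "finite B" "B \<subseteq> W" "independent B" "W \<subseteq> span B" "card B = dim W"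
    using fin_span_basis[OF fin_span_subset[OF assms(1,3)]] .
  obtain B' where B': "B \<subseteq> B'" "B' \<subseteq> V" "independent B'" "V \<subseteq> span B'"
    using maximal_independent_subset_extend[of B V] B assms(3) by (metis subset_trans)
  have fin: "finite B'" using fin_span_independent[OF assms(1)] B' by blast
  have "card B' = dim V" using basis_card_eq_dim B' by blast
  moreover have "card (B' - B) = card B' - card B" "card B \<le> card B'"
    using card_Diff_subset[OF B(1) B'(1)] card_mono[OF fin B'(1)] by auto
  ultimately have "card (B' - B) + dim W = dim V" using B(5) by simp
  moreover have "V \<subseteq> span (W \<union> (B' - B))"
    using B'(4) span_mono[of B' "W \<union> (B' - B)"] B(2) by blast
  ultimately show ?thesis using that[of "B' - B"] fin B' by blast
qed

end

locale scalar_space_pair = vs1: scalar_space s1 + vs2: scalar_space s2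
  for s1 :: "'a::field \<Rightarrow> 'b::ab_group_add \<Rightarrow> 'b" and s2 :: "'a \<Rightarrow> 'c::ab_group_add \<Rightarrow> 'c"
begin

sublocale vector_space_pair s1 s2 ..

lemma dim_image_le_finite:
  assumes "Vector_Spaces.linear s1 s2 f" "vs1.fin_span V"
  shows "vs2.fin_span (f ` V) \<and> vs2.dim (f ` V) \<le> vs1.dim V"
proof -
  obtain B where B: "finite B" "B \<subseteq> V" "vs1.independent B" "V \<subseteq> vs1.span B" "card B = vs1.dim V"
    using vs1.fin_span_basis[OF assms(2)] .
  have "f ` V \<subseteq> vs2.span (f ` B)"
    using B(4) linear_span_image[OF assms(1)] by (metis image_mono)
  then show ?thesis
    using B vs2.dim_le_card[of "f ` V" "f ` B"] card_image_le[of B f]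
    unfolding vs2.fin_span_def by (metis finite_imageI order.trans)
qed

lemma dim_image_inj:
  assumes "Vector_Spaces.linear s1 s2 f" "vs1.subspace V" "inj_on f V"
  shows "vs2.dim (f ` V) = vs1.dim V"
proof -
  obtain B where B: "B \<subseteq> V" "vs1.independent B" "V \<subseteq> vs1.span B" "card B = vs1.dim V"
    using vs1.basis_exists .
  have sp: "vs1.span B = V" using B vs1.span_minimal[OF B(1) assms(2)] by blast
  have "vs2.independent (f ` B)"
    using linear_independent_injective_image[OF assms(1) B(2)] assms(3) sp by simp
  moreover have "f ` V = vs2.span (f ` B)" using linear_span_image[OF assms(1)] sp by metis
  ultimately have "vs2.dim (f ` V) = card (f ` B)"
    using vs2.dim_span_eq_card_independent by metis
  then show ?thesis using B card_image[of f B] assms(3) inj_on_subset by metis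
qed

end

section \<open>Polynomials as a vector space\<close>

definition scale :: "'k::field \<Rightarrow> ('i \<Rightarrow>\<^sub>0 'k) \<Rightarrow> 'i \<Rightarrow>\<^sub>0 'k"
  where "scale c p = Poly_Mapping.map ((*) c) p"

lemma lookup_scale [simp]: "lookup (scale c p) m = c * lookup p m"
  unfolding scale_def by (simp add: map.rep_eq when_def)

interpretation vs: scalar_space "scale :: 'k::field \<Rightarrow> ('i \<Rightarrow>\<^sub>0 'k) \<Rightarrow> _"
  by unfold_locales (auto intro!: poly_mapping_eqI simp: lookup_add algebra_simps)

interpretation vsp: scalar_space_pair "scale :: 'k::field \<Rightarrow> ('i \<Rightarrow>\<^sub>0 'k) \<Rightarrow> _"
    "scale :: 'k::field \<Rightarrow> ('j \<Rightarrow>\<^sub>0 'k) \<Rightarrow> _" ..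

interpretation fld: vector_space "(*) :: 'k::field \<Rightarrow> 'k \<Rightarrow> 'k"
  by unfold_locales (auto simp: algebra_simps)

interpretation vsf: vector_space_pair "scale :: 'k::field \<Rightarrow> ('i \<Rightarrow>\<^sub>0 'k) \<Rightarrow> _"
    "(*) :: 'k::field \<Rightarrow> 'k \<Rightarrow> 'k" ..

abbreviation linear_map :: "(('i \<Rightarrow>\<^sub>0 'k::field) \<Rightarrow> ('j \<Rightarrow>\<^sub>0 'k)) \<Rightarrow> bool"
  where "linear_map \<equiv> Vector_Spaces.linear scale scale"

lemma scale_conv_mult:
  "scale c p = single 0 c * (p :: ('i, 'k::field) mpoly)"
proof (rule poly_mapping_eqI)
  fix m
  have "lookup (single 0 c * p) m
      = (\<Sum>l. (c * (\<Sum>q. lookup p q when m = l + q)) when l = 0)"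
    unfolding lookup_mult by (rule arg_cong[of _ _ Sum_any]) (auto simp: lookup_single when_def)
  then show "lookup (scale c p) m = lookup (single 0 c * p) m"
    by simp
qed

lemma linear_mult_left: "linear_map ((*) (q :: ('i, 'k::field) mpoly))"
  by (simp add: Vector_Spaces.linear_iff vs.vector_space_axioms scale_conv_mult algebra_simps)


section \<open>Linear independence is an open condition\<close>

text \<open>Instances are the polynomial functions of the entries of a matrix and the polynomial functions on
  a line; one argument about determinants serves both.\<close>

definition function_algebra :: "('x \<Rightarrow> 'k::comm_ring_1) set \<Rightarrow> bool"
  where "function_algebra P \<longleftrightarrow> (\<forall>c. (\<lambda>x. c) \<in> P) \<and>
    (\<forall>f\<in>P. \<forall>g\<in>P. (\<lambda>x. f x + g x) \<in> P \<and> (\<lambda>x. f x * g x) \<in> P)"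

lemma function_algebra_const: "function_algebra P \<Longrightarrow> (\<lambda>x. c) \<in> P"
  by (simp add: function_algebra_def)

lemma function_algebra_add:
  "function_algebra P \<Longrightarrow> f \<in> P \<Longrightarrow> g \<in> P \<Longrightarrow> (\<lambda>x. f x + g x) \<in> P"
  by (simp add: function_algebra_def)

lemma function_algebra_mult:
  "function_algebra P \<Longrightarrow> f \<in> P \<Longrightarrow> g \<in> P \<Longrightarrow> (\<lambda>x. f x * g x) \<in> P"
  by (simp add: function_algebra_def)

lemma function_algebra_sum:
  assumes "function_algebra P" "\<And>i. i \<in> A \<Longrightarrow> f i \<in> P"
  shows "(\<lambda>x. \<Sum>i\<in>A. f i x) \<in> P"
  using assms(2) by (induction A rule: infinite_finite_induct)
    (use assms(1) in \<open>auto simp: function_algebra_def\<close>)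

lemma function_algebra_prod:
  assumes "function_algebra P" "\<And>i. i \<in> A \<Longrightarrow> f i \<in> P"
  shows "(\<lambda>x. \<Prod>i\<in>A. f i x) \<in> P"
  using assms(2) by (induction A rule: infinite_finite_induct)
    (use assms(1) in \<open>auto simp: function_algebra_def\<close>)

lemma function_algebra_power:
  assumes "function_algebra P" "f \<in> P"
  shows "(\<lambda>x. f x ^ e) \<in> P"
  using assms by (induction e) (auto simp: function_algebra_def)

lemma function_algebra_det:
  assumes P: "function_algebra P" and M: "\<And>x. M x \<in> carrier_mat N N"
    and ij: "\<And>i j. i < N \<Longrightarrow> j < N \<Longrightarrow> (\<lambda>x. M x $$ (i, j)) \<in> P"
  shows "(\<lambda>x. det (M x)) \<in> P"
proof -
  have "(\<lambda>x. \<Sum>p\<in>{p. p permutes {0..<N}}. signof p * (\<Prod>i = 0..<N. M x $$ (i, p i))) \<in> P"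
  proof (intro function_algebra_sum[OF P])
    fix p assume "p \<in> {p. p permutes {0..<N}}"
    then have "p i < N" if "i < N" for i using permutes_in_image[of p "{0..<N}" i] that by auto
    then have "(\<lambda>x. \<Prod>i\<in>{0..<N}. M x $$ (i, p i)) \<in> P"
      by (intro function_algebra_prod[OF P] ij) auto
    then show "(\<lambda>x. signof p * (\<Prod>i = 0..<N. M x $$ (i, p i))) \<in> P"
      using P by (intro function_algebra_mult function_algebra_const)
  qed
  then show ?thesis using M by (simp add: det_def'[OF M])
qed

lemma independent_family:
  fixes h :: "'x \<Rightarrow> ('i \<Rightarrow>\<^sub>0 'k::field)"
  assumes X: "finite X" and zero: "\<And>c. (\<Sum>x\<in>X. scale (c x) (h x)) = 0 \<Longrightarrow> \<forall>x\<in>X. c x = 0"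
  shows "inj_on h X" "vs.independent (h ` X)"
proof -
  show inj: "inj_on h X"
  proof (rule inj_onI, rule ccontr)
    fix x y assume xy: "x \<in> X" "y \<in> X" "h x = h y" "x \<noteq> y"
    define c :: "'x \<Rightarrow> 'k" where "c z = (if z = x then 1 else if z = y then - 1 else 0)" for z
    have "(\<Sum>z\<in>X. scale (c z) (h z)) = (\<Sum>z\<in>{x, y}. scale (c z) (h z))"
      using X xy by (intro sum.mono_neutral_right) (auto simp: c_def)
    also have "\<dots> = 0" using xy by (simp add: c_def)
    finally have "c x = 0" using zero xy(1) by blast
    then show False by (simp add: c_def)
  qed
  show "vs.independent (h ` X)"
  proof (rule vs.independent_if_scalars_zero)
    fix g y assume s: "(\<Sum>y\<in>h ` X. scale (g y) y) = 0" and y: "y \<in> h ` X"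
    then have "(\<Sum>x\<in>X. scale (g (h x)) (h x)) = 0" by (simp add: sum.reindex[OF inj])
    then have "\<forall>x\<in>X. g (h x) = 0" by (rule zero)
    then show "g y = 0" using y by blast
  qed (use X in simp)
qed

text \<open>Functionals dual to the vectors at \<open>x0\<close> turn the family into a square matrix that is the
  identity at \<open>x0\<close>; its determinant is the required function.\<close>

lemma independent_open:
  fixes z :: "nat \<Rightarrow> 'x \<Rightarrow> ('i \<Rightarrow>\<^sub>0 'k::field)"
  assumes P: "function_algebra P" and X: "finite X"
    and keys: "\<And>i x. i < N \<Longrightarrow> keys (z i x) \<subseteq> X"
    and coeffs: "\<And>i m. i < N \<Longrightarrow> (\<lambda>x. lookup (z i x) m) \<in> P"
    and inj: "inj_on (\<lambda>i. z i x0) {..<N}"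
    and indep: "vs.independent ((\<lambda>i. z i x0) ` {..<N})"
  shows "\<exists>\<delta>\<in>P. \<delta> x0 \<noteq> 0 \<and> (\<forall>x. \<delta> x \<noteq> 0 \<longrightarrow>
    inj_on (\<lambda>i. z i x) {..<N} \<and> vs.independent ((\<lambda>i. z i x) ` {..<N}))"
proof -
  have "\<exists>L. Vector_Spaces.linear scale (*) L \<and> (\<forall>j<N. L (z j x0) = (if i = j then 1 else 0))" for i
  proof -
    obtain L where L: "Vector_Spaces.linear scale (*) L"
      "\<forall>y\<in>(\<lambda>i. z i x0) ` {..<N}. L y = (if y = z i x0 \<and> i < N then 1 else 0 :: 'k)"
      using vsf.linear_independent_extend[OF indep, of "\<lambda>y. if y = z i x0 \<and> i < N then 1 else 0"]
      by blast
    have "L (z j x0) = (if i = j then 1 else 0)" if "j < N" for j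
      using L(2) that inj by (auto dest: inj_onD)
    then show ?thesis using L(1) by blast
  qed
  then obtain L where lin: "\<And>i. Vector_Spaces.linear scale (*) (L i)"
    and dual: "\<And>i j. j < N \<Longrightarrow> L i (z j x0) = (if i = j then 1 else 0 :: 'k)" by metis
  define M where "M x = mat N N (\<lambda>(i, j). L i (z j x))" for x
  have expand: "L i (z j x) = (\<Sum>m\<in>X. lookup (z j x) m * L i (single m 1))"
    if "j < N" for i j x
  proof -
    have "z j x = (\<Sum>m\<in>X. scale (lookup (z j x) m) (single m 1))"
    proof (rule poly_mapping_eqI)
      fix m
      have "(\<Sum>m'\<in>X. lookup (z j x) m' * (1 when m' = m))
          = (\<Sum>m'\<in>X. if m' = m then lookup (z j x) m' else 0)"
        by (intro sum.cong) (simp_all add: when_def)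
      also have "\<dots> = lookup (z j x) m"
        using keys[OF that, of x] X by (auto simp: sum.delta in_keys_iff)
      finally show "lookup (z j x) m = lookup
          (\<Sum>m\<in>X. scale (lookup (z j x) m) (single m 1)) m"
        by (simp add: lookup_sum lookup_single)
    qed
    then have "L i (z j x) = L i (\<Sum>m\<in>X. scale (lookup (z j x) m) (single m 1))"
      by simp
    also have "\<dots> = (\<Sum>m\<in>X. lookup (z j x) m * L i (single m 1))"
      by (simp add: vsf.linear_sum[OF lin] vsf.linear_scale[OF lin])
    finally show ?thesis .
  qed
  have "(\<lambda>x. det (M x)) \<in> P"
  proof (rule function_algebra_det[OF P])
    show "M x \<in> carrier_mat N N" for x by (simp add: M_def)
    fix i j assume ij: "i < N" "j < N"
    have "(\<lambda>x. \<Sum>m\<in>X. lookup (z j x) m * L i (single m 1)) \<in> P"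
      using P coeffs[OF ij(2)] by (intro function_algebra_sum[OF P]) (simp add: function_algebra_def)
    then show "(\<lambda>x. M x $$ (i, j)) \<in> P" using ij expand[OF ij(2)] by (simp add: M_def)
  qed
  moreover have "M x0 = 1\<^sub>m N" by (auto simp: M_def dual intro!: eq_matI)
  then have "det (M x0) \<noteq> 0" by simp
  moreover have "inj_on (\<lambda>i. z i x) {..<N} \<and> vs.independent ((\<lambda>i. z i x) ` {..<N})"
    if nz: "det (M x) \<noteq> 0" for x
  proof -
    have zero: "\<forall>j<N. c j = 0" if s: "(\<Sum>j<N. scale (c j) (z j x)) = 0" for c
    proof -
      have Mc: "M x \<in> carrier_mat N N" by (simp add: M_def)
      have "M x *\<^sub>v vec N c = 0\<^sub>v N"
      proof (rule eq_vecI)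
        fix i assume i: "i < dim_vec (0\<^sub>v N :: 'k vec)"
        have "(M x *\<^sub>v vec N c) $ i = (\<Sum>j<N. L i (z j x) * c j)"
          using i by (auto simp: M_def scalar_prod_def lessThan_atLeast0 intro!: sum.cong)
        also have "\<dots> = L i (\<Sum>j<N. scale (c j) (z j x))"
          by (simp add: vsf.linear_sum[OF lin] vsf.linear_scale[OF lin] mult.commute)
        also have "\<dots> = 0" by (simp add: s vsf.linear_0[OF lin])
        finally show "(M x *\<^sub>v vec N c) $ i = 0\<^sub>v N $ i" using i by simp
      qed (simp add: M_def)
      then have "vec N c = 0\<^sub>v N"
        using nz det_0_iff_vec_prod_zero_field[OF Mc] by (metis vec_carrier)
      then show ?thesis by (metis index_vec index_zero_vec(1))
    qed
    show ?thesis using independent_family[of "{..<N}" "\<lambda>i. z i x"] zero by auto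
  qed
  ultimately show ?thesis by (intro bexI[of _ "\<lambda>x. det (M x)"]) auto
qed

section \<open>Monomials and forms\<close>

lemma mon_deg_superset:
  assumes "finite A" "keys m \<subseteq> A"
  shows "mon_deg m = (\<Sum>i\<in>A. lookup m i)"
  unfolding mon_deg_def using assms by (intro sum.mono_neutral_left) (auto simp: in_keys_iff)

lemma mon_deg_add [simp]: "mon_deg (m + m') = mon_deg m + mon_deg m'"
proof -
  let ?A = "keys m \<union> keys m'"
  have "mon_deg (m + m') = (\<Sum>i\<in>?A. lookup (m + m') i)"
    using Poly_Mapping.keys_add[of m m'] by (intro mon_deg_superset) auto
  also have "\<dots> = mon_deg m + mon_deg m'"
    by (simp add: lookup_add sum.distrib mon_deg_superset[of ?A m] mon_deg_superset[of ?A m'])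
  finally show ?thesis .
qed

lemma mon_deg_zero [simp]: "mon_deg 0 = 0"
  by (simp add: mon_deg_def)

lemma mon_deg_single [simp]: "mon_deg (single i a) = a"
  by (simp add: mon_deg_def)

lemma keys_add_nat: "keys (m + m' :: 'i \<Rightarrow>\<^sub>0 nat) = keys m \<union> keys m'"
  by (auto simp: in_keys_iff lookup_add)

definition mons :: "nat \<Rightarrow> nat \<Rightarrow> (nat \<Rightarrow>\<^sub>0 nat) set"
  where "mons n d = {m. keys m \<subseteq> {1..n} \<and> mon_deg m = d}"

lemma finite_mons: "finite (mons n d)"
proof -
  have "inj_on (\<lambda>m. restrict (lookup m) {1..n}) (mons n d)"
  proof (rule inj_onI, rule poly_mapping_eqI)
    fix m m' i
    assume m: "m \<in> mons n d" "m' \<in> mons n d"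
      and eq: "restrict (lookup m) {1..n} = restrict (lookup m') {1..n}"
    show "lookup m i = lookup m' i"
    proof (cases "i \<in> {1..n}")
      case True
      then show ?thesis using fun_cong[OF eq, of i] by simp
    next
      case False
      then have "i \<notin> keys m" "i \<notin> keys m'"
        using m unfolding mons_def by blast+
      then show ?thesis by (simp add: in_keys_iff)
    qed
  qed
  moreover have "(\<lambda>m. restrict (lookup m) {1..n}) ` mons n d \<subseteq> {1..n} \<rightarrow>\<^sub>E {..d}"
  proof (clarsimp simp: PiE_iff)
    fix m i assume "m \<in> mons n d" "Suc 0 \<le> i" "i \<le> n"
    then show "lookup m i \<le> d"
      using member_le_sum[of i "{1..n}" "lookup m"]
      by (auto simp: mons_def mon_deg_superset[of "{1..n}" m])
  qed
  moreover have "finite ({1..n} \<rightarrow>\<^sub>E {..d})" by (intro finite_PiE) auto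
  ultimately show ?thesis by (rule inj_on_finite)
qed

lemma mons_add: "m \<in> mons n d \<Longrightarrow> m' \<in> mons n d' \<Longrightarrow> m + m' \<in> mons n (d + d')"
  by (auto simp: mons_def keys_add_nat)

lemma single_in_mons: "i \<in> {1..n} \<Longrightarrow> single i d \<in> mons n d"
  by (auto simp: mons_def)

definition supported :: "('i \<Rightarrow>\<^sub>0 nat) set \<Rightarrow> ('i, 'k::field_char_0) mpoly set"
  where "supported X = {p. keys p \<subseteq> X}"

lemma supportedD: "p \<in> supported X \<Longrightarrow> m \<notin> X \<Longrightarrow> lookup p m = 0"
  by (auto simp: supported_def in_keys_iff)

lemma supportedI: "(\<And>m. m \<notin> X \<Longrightarrow> lookup p m = 0) \<Longrightarrow> p \<in> supported X"
  by (auto simp: supported_def in_keys_iff)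

lemma subspace_supported: "vs.subspace (supported X)"
  unfolding vs.subspace_def by (auto intro!: supportedI simp: lookup_add supportedD)

lemma expand_supported:
  assumes "finite X" "p \<in> supported X"
  shows "p = (\<Sum>m\<in>X. scale (lookup p m) (monomial m))"
proof (rule poly_mapping_eqI)
  fix m
  have "(\<Sum>m'\<in>X. lookup p m' * (1 when m' = m))
      = (\<Sum>m'\<in>X. if m' = m then lookup p m' else 0)"
    by (intro sum.cong) (simp_all add: when_def)
  also have "\<dots> = lookup p m"
    using assms by (auto simp: sum.delta dest: supportedD)
  finally show "lookup p m = lookup
      (\<Sum>m\<in>X. scale (lookup p m) (monomial m)) m"
    by (simp add: lookup_sum lookup_single monomial_def)
qed

lemma supported_eq_span: "finite X \<Longrightarrow> supported X = vs.span (monomial ` X)"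
proof
  assume X: "finite X"
  show "supported X \<subseteq> vs.span (monomial ` X)"
  proof
    fix p assume "p \<in> supported X"
    then have "p = (\<Sum>m\<in>X. scale (lookup p m) (monomial m))"
      using expand_supported[OF X] by blast
    also have "\<dots> \<in> vs.span (monomial ` X)"
      by (intro vs.span_sum vs.span_scale vs.span_base) auto
    finally show "p \<in> vs.span (monomial ` X)" .
  qed
  show "vs.span (monomial ` X) \<subseteq> supported X"
    by (rule vs.span_minimal[OF _ subspace_supported]) (auto simp: supported_def monomial_def)
qed

definition forms :: "nat \<Rightarrow> nat \<Rightarrow> (nat, 'k::field_char_0) mpoly set"
  where "forms n d = supported (mons n d)"

lemma subspace_forms: "vs.subspace (forms n d)"
  unfolding forms_def by (rule subspace_supported)

lemma fin_span_forms: "vs.fin_span (forms n d :: (nat, 'k::field_char_0) mpoly set)"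
  unfolding forms_def supported_eq_span[OF finite_mons]
  by (intro vs.fin_span_span finite_imageI finite_mons)

lemma fin_span_subset_forms: "V \<subseteq> forms n d \<Longrightarrow> vs.fin_span (V :: (nat, 'k::field_char_0) mpoly set)"
  using vs.fin_span_subset fin_span_forms by blast

lemma forms_mult: "p \<in> forms n d \<Longrightarrow> q \<in> forms n d' \<Longrightarrow> p * q \<in> forms n (d + d')"
proof -
  assume pq: "p \<in> forms n d" "q \<in> forms n d'"
  have "m \<in> mons n (d + d')" if m: "m \<in> keys (p * q)" for m
  proof -
    obtain u w where "u \<in> keys p" "w \<in> keys q" "m = u + w"
      using m keys_mult[of p q] by blast
    then show ?thesis using pq mons_add[of u n d w d'] by (auto simp: forms_def supported_def)
  qed
  then show ?thesis by (auto simp: forms_def supported_def)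
qed

lemma monomial_in_forms: "m \<in> mons n d \<Longrightarrow> monomial m \<in> forms n d"
  by (auto simp: forms_def supported_def monomial_def)

lemma is_form_iff: "is_form n d f \<longleftrightarrow> f \<in> forms n d \<and> f \<noteq> 0"
  unfolding is_form_def forms_def supported_def mons_def poly_ring_def polys_in_def by auto

abbreviation var :: "nat \<Rightarrow> (nat, 'k::field_char_0) mpoly"
  where "var i \<equiv> monomial (single i 1)"

lemma var_in_forms: "i \<in> {1..n} \<Longrightarrow> var i \<in> forms n 1"
  using monomial_in_forms single_in_mons by blast

lemma monomial_add: "monomial (m + m') = monomial m * monomial m'"
  by (simp add: monomial_def mult_single)

lemma monomial_zero: "monomial 0 = 1"
  by (simp add: monomial_def)

lemma monomial_neq_0 [simp]: "monomial m \<noteq> 0"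
proof
  assume "monomial m = (0 :: ('a, 'b) mpoly)"
  then have "keys (monomial m :: ('a, 'b) mpoly) = {}" by simp
  then show False by (simp add: monomial_def)
qed

lemma lookup_monomial_mult_add [simp]:
  "lookup (monomial a * p) (a + m) = lookup p m"
proof -
  have "lookup (monomial a * p) (a + m)
      = (\<Sum>l. (\<Sum>q. lookup p q when a + m = l + q) when l = a)"
    unfolding lookup_mult by (rule arg_cong[of _ _ Sum_any]) (auto simp: lookup_single when_def monomial_def)
  then show ?thesis by (simp add: Sum_any_when_equal')
qed

lemma keys_monomial_mult: "keys (monomial a * p) = (+) a ` keys p"
proof
  show "keys (monomial a * p) \<subseteq> (+) a ` keys p"
    using keys_mult[of "monomial a" p] by (auto simp: monomial_def)
  show "(+) a ` keys p \<subseteq> keys (monomial a * p)"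
    by (auto simp: in_keys_iff)
qed

lemma lookup_monomial_mult_other:
  "\<nexists>m'. m = a + m' \<Longrightarrow> lookup (monomial a * p) m = 0"
proof -
  assume "\<nexists>m'. m = a + m'"
  then have "m \<notin> keys (monomial a * p)" unfolding keys_monomial_mult by blast
  then show ?thesis by (simp add: in_keys_iff)
qed

lemma monomial_mult_inject: "monomial a * p = monomial a * q \<longleftrightarrow> p = (q :: ('i, 'k::field_char_0) mpoly)"
proof
  assume eq: "monomial a * p = monomial a * q"
  show "p = q"
  proof (rule poly_mapping_eqI)
    fix m
    have "lookup (monomial a * p) (a + m) = lookup (monomial a * q) (a + m)"
      by (simp only: eq)
    then show "lookup p m = lookup q m" by simp
  qed
qed simp

lemma inj_monomial_mult: "inj_on ((*) (monomial a)) V"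
  by (simp add: inj_on_def monomial_mult_inject)

section \<open>Leading monomials count dimensions\<close>

lemma revlex_irrefl: "\<not> revlex_greater m m"
  by (simp add: revlex_greater_def)

lemma revlex_trans:
  assumes "revlex_greater p q" "revlex_greater q r"
  shows "revlex_greater p r"
proof -
  obtain i where i: "lookup p i < lookup q i"
    "\<forall>j>i. lookup p j = lookup q j"
    using assms(1) by (auto simp: revlex_greater_def)
  obtain i' where i': "lookup q i' < lookup r i'"
    "\<forall>j>i'. lookup q j = lookup r j"
    using assms(2) by (auto simp: revlex_greater_def)
  have "lookup p (max i i') < lookup r (max i i')"
    using i i' by (cases i i' rule: linorder_cases) (auto simp: max_def)
  then show ?thesis using i(2) i'(2) assms
    by (auto simp: revlex_greater_def intro!: exI[of _ "max i i'"])
qed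

lemma revlex_total:
  assumes "mon_deg p = mon_deg q" "p \<noteq> q"
  shows "revlex_greater p q \<or> revlex_greater q p"
proof -
  define D where "D = {i. lookup p i \<noteq> lookup q i}"
  have "D \<subseteq> keys p \<union> keys q"
    by (auto simp: D_def in_keys_iff)
  then have fin: "finite D" by (rule finite_subset) simp
  have "D \<noteq> {}" using assms(2) by (auto simp: D_def intro: poly_mapping_eqI)
  then have "Max D \<in> D" "\<forall>j>Max D. j \<notin> D" using fin Max_ge by (auto simp: not_le[symmetric])
  moreover have D_iff: "i \<in> D \<longleftrightarrow> lookup p i \<noteq> lookup q i" for i
    by (simp add: D_def)
  ultimately have "\<forall>j>Max D. lookup p j = lookup q j"
    "lookup p (Max D) < lookup q (Max D)
     \<or> lookup q (Max D) < lookup p (Max D)"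
    by (blast, metis linorder_neqE_nat)
  then show ?thesis using assms(1) unfolding revlex_greater_def by metis
qed

lemma revlex_add_iff: "revlex_greater (a + p) (a + q) \<longleftrightarrow> revlex_greater p q"
  by (simp add: revlex_greater_def lookup_add)

definition revlex_rank :: "nat \<Rightarrow> nat \<Rightarrow> (nat \<Rightarrow>\<^sub>0 nat) \<Rightarrow> nat"
  where "revlex_rank n d m = card {m'\<in>mons n d. revlex_greater m m'}"

lemma revlex_rank_less:
  assumes "m \<in> mons n d" "m' \<in> mons n d"
  shows "revlex_rank n d m' < revlex_rank n d m \<longleftrightarrow> revlex_greater m m'"
proof -
  have *: "revlex_rank n d b < revlex_rank n d a" if "b \<in> mons n d" "revlex_greater a b" for a b
  proof -
    have "{m'\<in>mons n d. revlex_greater b m'} \<subset> {m'\<in>mons n d. revlex_greater a m'}"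
      using that revlex_trans[OF that(2)] revlex_irrefl[of b] by blast
    then show ?thesis unfolding revlex_rank_def
      by (rule psubset_card_mono[rotated]) (simp add: finite_mons)
  qed
  show ?thesis
  proof
    assume less: "revlex_rank n d m' < revlex_rank n d m"
    then have "\<not> revlex_greater m' m" "m \<noteq> m'" using *[of m m'] assms by auto
    then show "revlex_greater m m'" using assms revlex_total[of m m'] by (auto simp: mons_def)
  qed (use * assms in blast)
qed

lemma finite_arg_max:
  fixes f :: "'a \<Rightarrow> nat"
  assumes "finite A" "A \<noteq> {}"
  obtains a where "a \<in> A" "\<And>b. b \<in> A \<Longrightarrow> f b \<le> f a"
proof -
  have "Max (f ` A) \<in> f ` A" using assms by (intro Max_in) auto
  then obtain a where a: "a \<in> A" "Max (f ` A) = f a" by blast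
  have "f b \<le> f a" if "b \<in> A" for b using Max_ge[of "f ` A" "f b"] that assms(1) a(2) by simp
  then show ?thesis using that a(1) by blast
qed

lemma leading_monomial_exists:
  fixes p :: "(nat, 'k::field_char_0) mpoly"
  assumes "p \<in> forms n d" "p \<noteq> 0"
  shows "\<exists>m\<in>mons n d. is_leading_monomial p m"
proof -
  let ?K = "keys p"
  have "?K \<noteq> {}" using assms(2) by simp
  then obtain m where m: "m \<in> ?K" "\<And>m'. m' \<in> ?K \<Longrightarrow> revlex_rank n d m' \<le> revlex_rank n d m"
    using finite_arg_max[OF finite_keys, of p "revlex_rank n d"] by blast
  have K: "?K \<subseteq> mons n d" using assms(1) by (simp add: forms_def supported_def)
  have "m' = m \<or> revlex_greater m m'" if m': "m' \<in> ?K" for m'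
  proof -
    have in_mons: "m \<in> mons n d" "m' \<in> mons n d" using K m(1) m' by blast+
    then have "\<not> revlex_greater m' m"
      using m(2)[OF m'] revlex_rank_less[of m' n d m] by simp
    then show ?thesis using in_mons revlex_total[of m m'] by (auto simp: mons_def)
  qed
  then show ?thesis using m(1) K by (auto simp: is_leading_monomial_def)
qed

definition leading :: "(nat, 'k::field_char_0) mpoly set \<Rightarrow> (nat \<Rightarrow>\<^sub>0 nat) set"
  where "leading V = {m. \<exists>p\<in>V. is_leading_monomial p m}"

lemma leading_subset_mons: "V \<subseteq> forms n d \<Longrightarrow> leading V \<subseteq> mons n d"
  by (auto simp: leading_def is_leading_monomial_def forms_def supported_def)

lemma lookup_leading:
  assumes "is_leading_monomial p m" "p \<in> forms n d" "m' \<in> mons n d"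
    "revlex_rank n d m \<le> revlex_rank n d m'" "m \<noteq> m'"
  shows "lookup p m' = 0"
proof (rule ccontr)
  assume "lookup p m' \<noteq> 0"
  then have "revlex_greater m m'" using assms by (auto simp: is_leading_monomial_def in_keys_iff)
  moreover have "m \<in> mons n d" using assms by (auto simp: is_leading_monomial_def forms_def supported_def)
  ultimately show False using revlex_rank_less[of m n d m'] assms by simp
qed


text \<open>Exponents and variable indices equal to 1 keep this form, also under simplification.\<close>

declare One_nat_def [simp del]

text \<open>Polynomials with distinct leading monomials are independent, and subtracting multiples of
  them strictly lowers leading monomials, so one element for each leading monomial makes a basis.\<close>

lemma card_leading:
  fixes V :: "(nat, 'k::field_char_0) mpoly set"
  assumes V: "vs.subspace V" "V \<subseteq> forms n d"
  shows "card (leading V) = vs.dim V"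
proof -
  let ?L = "leading V" and ?rk = "revlex_rank n d"
  have L: "?L \<subseteq> mons n d" using leading_subset_mons[OF V(2)] .
  have finL: "finite ?L" using finite_subset[OF L finite_mons] .
  have "\<forall>m\<in>?L. \<exists>q. q \<in> V \<and> is_leading_monomial q m" by (auto simp: leading_def)
  from bchoice[OF this] obtain p
    where "\<forall>m\<in>?L. p m \<in> V \<and> is_leading_monomial (p m) m" ..
  then have p: "\<And>m. m \<in> ?L \<Longrightarrow> p m \<in> V \<and> is_leading_monomial (p m) m" by blast
  have rk_inj: "m = m'" if "m \<in> mons n d" "m' \<in> mons n d" "?rk m = ?rk m'" for m m'
    using that revlex_rank_less[of m n d m'] revlex_rank_less[of m' n d m] revlex_total[of m m']
    by (auto simp: mons_def)
  have inj: "inj_on p ?L"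
  proof (rule inj_onI, rule ccontr)
    fix m m' assume m: "m \<in> ?L" "m' \<in> ?L" "p m = p m'" "m \<noteq> m'"
    then have "revlex_greater m m'" "revlex_greater m' m"
      using p[OF m(1)] p[OF m(2)] unfolding is_leading_monomial_def by auto
    then show False using revlex_trans revlex_irrefl by blast
  qed
  have "vs.independent (p ` ?L)"
  proof (rule vs.independent_if_scalars_zero)
    show "finite (p ` ?L)" using finL by simp
    fix f q assume s: "(\<Sum>x\<in>p ` ?L. scale (f x) x) = 0" and q: "q \<in> p ` ?L"
    have s': "(\<Sum>m\<in>?L. scale (f (p m)) (p m)) = 0" using s by (simp add: sum.reindex[OF inj])
    have "f (p m) = 0" if "m \<in> ?L" for m
    proof (rule ccontr)
      assume "f (p m) \<noteq> 0"
      then have "{m\<in>?L. f (p m) \<noteq> 0} \<noteq> {}" "finite {m\<in>?L. f (p m) \<noteq> 0}" using that finL by auto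
      note Z = this
      have "\<exists>m0\<in>{m\<in>?L. f (p m) \<noteq> 0}. \<forall>m\<in>{m\<in>?L. f (p m) \<noteq> 0}. ?rk m \<le> ?rk m0"
        by (rule finite_arg_max[OF Z(2,1), of ?rk]) blast
      then obtain m0 where m0_max: "m0 \<in> {m\<in>?L. f (p m) \<noteq> 0}"
        "\<forall>m\<in>{m\<in>?L. f (p m) \<noteq> 0}. ?rk m \<le> ?rk m0" ..
      have m0: "m0 \<in> ?L" "f (p m0) \<noteq> 0"
        "\<And>m. m \<in> ?L \<Longrightarrow> f (p m) \<noteq> 0 \<Longrightarrow> ?rk m \<le> ?rk m0" using m0_max by auto
      have "f (p m) * lookup (p m) m0 = 0" if "m \<in> ?L - {m0}" for m
      proof (cases "f (p m) = 0")
        case False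
        have "lookup (p m) m0 = 0"
          using that m0(1) m0(3)[of m] False p[of m] V(2) L
          by (intro lookup_leading[of "p m" m n d m0]) auto
        then show ?thesis by simp
      qed simp
      then have "(\<Sum>m\<in>?L - {m0}. f (p m) * lookup (p m) m0) = 0"
        by (intro sum.neutral) blast
      then have "(\<Sum>m\<in>?L. f (p m) * lookup (p m) m0)
          = f (p m0) * lookup (p m0) m0"
        using sum.remove[OF finL m0(1), of "\<lambda>m. f (p m) * lookup (p m) m0"] by simp
      then have "lookup (\<Sum>m\<in>?L. scale (f (p m)) (p m)) m0
          = f (p m0) * lookup (p m0) m0"
        by (simp add: lookup_sum)
      moreover have "lookup (p m0) m0 \<noteq> 0"
        using p[OF m0(1)] by (simp add: is_leading_monomial_def in_keys_iff)
      ultimately show False using s' m0(2) by simp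
    qed
    then show "f q = 0" using q by blast
  qed
  moreover have "v \<in> vs.span (p ` ?L)" if "v \<in> V" "v \<noteq> 0" "is_leading_monomial v m" for v m
    using that
  proof (induction "?rk m" arbitrary: v m rule: less_induct)
    case less
    have mL: "m \<in> ?L" using less.prems by (auto simp: leading_def)
    define c where "c = lookup v m / lookup (p m) m"
    define v' where "v' = v - scale c (p m)"
    have nz: "lookup (p m) m \<noteq> 0"
      using p[OF mL] by (simp add: is_leading_monomial_def in_keys_iff)
    have v'V: "v' \<in> V" unfolding v'_def
      using less.prems(1) p[OF mL] V(1) vs.subspace_diff vs.subspace_scale by blast
    have "v' \<in> vs.span (p ` ?L)"
    proof (cases "v' = 0")
      case True
      then show ?thesis by (simp add: vs.span_zero)
    next
      case False
      then obtain m' where m': "m' \<in> mons n d" "is_leading_monomial v' m'"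
        using leading_monomial_exists[of v' n d] v'V V(2) by blast
      have "\<not> (?rk m \<le> ?rk m')"
      proof
        assume le: "?rk m \<le> ?rk m'"
        have "lookup v' m' = 0"
        proof (cases "m' = m")
          case True
          then show ?thesis using nz by (simp add: v'_def lookup_minus c_def)
        next
          case False
          have "lookup v m' = 0"
            using lookup_leading[of v m n d m'] less.prems V(2) m'(1) le False by blast
          moreover have "lookup (p m) m' = 0"
            using lookup_leading[of "p m" m n d m'] p[OF mL] V(2) m'(1) le False by blast
          ultimately show ?thesis by (simp add: v'_def lookup_minus)
        qed
        then show False using m'(2) by (simp add: is_leading_monomial_def in_keys_iff)
      qed
      then show ?thesis using less.hyps[of m' v'] v'V False m'(2) by simp
    qed
    moreover have "v = v' + scale c (p m)" by (simp add: v'_def)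
    moreover have "scale c (p m) \<in> vs.span (p ` ?L)" using mL by (intro vs.span_scale vs.span_base) blast
    ultimately show ?case using vs.span_add by metis
  qed
  then have "v \<in> vs.span (p ` ?L)" if "v \<in> V" for v
    using that leading_monomial_exists[of v n d] V(2) vs.span_zero[of "p ` ?L"] by (cases "v = 0") auto
  then have "V \<subseteq> vs.span (p ` ?L)" by blast
  moreover have "p ` ?L \<subseteq> V" using p by blast
  ultimately have "card (p ` ?L) = vs.dim V" using vs.basis_card_eq_dim by blast
  then show ?thesis using card_image[OF inj] by simp
qed

lemma leading_monomial_mult:
  "is_leading_monomial p m \<Longrightarrow> is_leading_monomial (monomial a * p) (a + m)"
  by (auto simp: is_leading_monomial_def keys_monomial_mult revlex_add_iff)
section \<open>Substitution and changes of coordinates\<close>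

definition mon_eval :: "('i \<Rightarrow> 'r::comm_semiring_1) \<Rightarrow> ('i \<Rightarrow>\<^sub>0 nat) \<Rightarrow> 'r"
  where "mon_eval x m = (\<Prod>i\<in>keys m. x i ^ lookup m i)"

lemma mon_eval_superset:
  assumes "finite A" "keys m \<subseteq> A"
  shows "mon_eval x m = (\<Prod>i\<in>A. x i ^ lookup m i)"
  unfolding mon_eval_def using assms by (intro prod.mono_neutral_left) (auto simp: in_keys_iff)

lemma mon_eval_add: "mon_eval x (m + m') = mon_eval x m * mon_eval x m'"
proof -
  let ?A = "keys m \<union> keys m'"
  have "mon_eval x (m + m') = (\<Prod>i\<in>?A. x i ^ lookup (m + m') i)"
    by (intro mon_eval_superset) (auto simp: keys_add_nat)
  also have "\<dots> = mon_eval x m * mon_eval x m'"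
    by (simp add: lookup_add power_add prod.distrib mon_eval_superset[of ?A m] mon_eval_superset[of ?A m'])
  finally show ?thesis .
qed

lemma mon_eval_single: "mon_eval x (single i a) = x i ^ a"
  by (simp add: mon_eval_def)

lemma mon_eval_zero [simp]: "mon_eval x 0 = 1"
  by (simp add: mon_eval_def)

lemma monomial_sum: "finite A \<Longrightarrow> monomial (\<Sum>i\<in>A. f i) = (\<Prod>i\<in>A. monomial (f i))"
  by (induction A rule: finite_induct) (auto simp: monomial_zero monomial_add)

lemma monomial_power: "monomial (single i a) = monomial (single i 1) ^ a"
proof (induction a)
  case (Suc a)
  have "single i (Suc a) = single i 1 + single i a"
    by (simp add: single_add[symmetric] plus_1_eq_Suc)
  then show ?case using Suc by (simp add: monomial_add)
qed (simp add: monomial_zero)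

definition scalar_hom :: "('k::field_char_0 \<Rightarrow> 'r::comm_ring_1) \<Rightarrow> bool"
  where "scalar_hom h \<longleftrightarrow> h 0 = 0 \<and> h 1 = 1 \<and> (\<forall>a b. h (a + b) = h a + h b) \<and> (\<forall>a b. h (a * b) = h a * h b)"

lemma scalar_hom_single: "scalar_hom (single 0 :: 'k::field_char_0 \<Rightarrow> ('i, 'k) mpoly)"
  by (simp add: scalar_hom_def single_add mult_single)

lemma scalar_hom_id: "scalar_hom id"
  by (simp add: scalar_hom_def)

lemma poly_subst_superset:
  assumes "scalar_hom h" "finite A" "keys p \<subseteq> A"
  shows "poly_subst h x p = (\<Sum>m\<in>A. h (lookup p m) * mon_eval x m)"
  unfolding poly_subst_def mon_eval_def[symmetric]
  using assms by (intro sum.mono_neutral_left) (auto simp: in_keys_iff scalar_hom_def)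

lemma poly_subst_add:
  assumes h: "scalar_hom h"
  shows "poly_subst h x (p + q) = poly_subst h x p + poly_subst h x q"
proof -
  let ?A = "keys p \<union> keys q"
  have "poly_subst h x (p + q) = (\<Sum>m\<in>?A. h (lookup (p + q) m) * mon_eval x m)"
    using Poly_Mapping.keys_add[of p q] by (intro poly_subst_superset[OF h]) auto
  also have "\<dots> = (\<Sum>m\<in>?A. h (lookup p m) * mon_eval x m + h (lookup q m) * mon_eval x m)"
    using h by (intro sum.cong) (auto simp: scalar_hom_def lookup_add algebra_simps)
  also have "\<dots> = poly_subst h x p + poly_subst h x q"
    by (simp add: sum.distrib poly_subst_superset[OF h, of ?A p] poly_subst_superset[OF h, of ?A q])
  finally show ?thesis .
qed

lemma poly_subst_zero [simp]: "poly_subst h x 0 = 0"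
  by (simp add: poly_subst_def)

lemma poly_subst_sum:
  assumes "scalar_hom h"
  shows "poly_subst h x (\<Sum>i\<in>A. f i) = (\<Sum>i\<in>A. poly_subst h x (f i))"
  by (induction A rule: infinite_finite_induct) (auto simp: poly_subst_add[OF assms])

lemma poly_subst_single:
  assumes "scalar_hom h"
  shows "poly_subst h x (single m c) = h c * mon_eval x m"
  using assms by (auto simp: poly_subst_def mon_eval_def scalar_hom_def)

lemma sum_singles: "p = (\<Sum>m\<in>keys p. single m (lookup p m))"
proof (rule poly_mapping_eqI)
  fix m
  have "(\<Sum>m'\<in>keys p. lookup p m' when m' = m)
      = (\<Sum>m'\<in>keys p. if m' = m then lookup p m' else 0)"
    by (intro sum.cong) (simp_all add: when_def)
  also have "\<dots> = lookup p m" by (auto simp: in_keys_iff)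
  finally show "lookup p m = lookup
      (\<Sum>m\<in>keys p. single m (lookup p m)) m"
    by (simp add: lookup_sum lookup_single)
qed

lemma poly_subst_mult:
  fixes p q :: "('i, 'k::field_char_0) mpoly"
  assumes h: "scalar_hom h"
  shows "poly_subst h x (p * q) = poly_subst h x p * poly_subst h x q"
proof -
  have single: "poly_subst h x (single m a * single m' b)
      = poly_subst h x (single m a) * poly_subst h x (single m' b)" for m m' a b
    using h by (simp add: mult_single poly_subst_single[OF h] mon_eval_add scalar_hom_def algebra_simps)
  let ?s = "\<lambda>p m. single m (lookup p m)"
  have "p * q = (\<Sum>m\<in>keys p. ?s p m) * (\<Sum>m\<in>keys q. ?s q m)"
    using sum_singles[of p] sum_singles[of q] by simp
  also have "\<dots> = (\<Sum>m\<in>keys p. \<Sum>m'\<in>keys q. ?s p m * ?s q m')"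
    by (rule sum_product)
  finally have "poly_subst h x (p * q)
      = (\<Sum>m\<in>keys p. \<Sum>m'\<in>keys q. poly_subst h x (?s p m) * poly_subst h x (?s q m'))"
    by (simp only: poly_subst_sum[OF h] single)
  also have "\<dots> = (\<Sum>m\<in>keys p. poly_subst h x (?s p m)) * (\<Sum>m\<in>keys q. poly_subst h x (?s q m))"
    by (rule sum_product[symmetric])
  also have "\<dots> = poly_subst h x p * poly_subst h x q"
    by (simp only: poly_subst_sum[OF h, symmetric] sum_singles[symmetric])
  finally show ?thesis .
qed

lemma poly_subst_monomial: "scalar_hom h \<Longrightarrow> poly_subst h x (monomial m) = mon_eval x m"
  by (simp add: monomial_def poly_subst_single scalar_hom_def)

definition lin_form :: "nat \<Rightarrow> 'k::field_char_0 mat \<Rightarrow> nat \<Rightarrow> (nat, 'k) mpoly"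
  where "lin_form n A j = (\<Sum>i\<in>{1..n}. scale (A $$ (i - 1, j - 1)) (var i))"

lemma single_eq_scale: "single m c = scale c (monomial m)"
  by (auto intro!: poly_mapping_eqI simp: monomial_def lookup_single when_def)

lemma coord_change_alt: "coord_change n A = poly_subst (single 0) (lin_form n A)"
  unfolding coord_change_def lin_form_def[abs_def] single_eq_scale[of "single _ _"] ..

lemmas coord_change_add = poly_subst_add[OF scalar_hom_single, of "lin_form n A" for n A, folded coord_change_alt]
lemmas coord_change_mult = poly_subst_mult[OF scalar_hom_single, of "lin_form n A" for n A, folded coord_change_alt]
lemmas coord_change_sum = poly_subst_sum[OF scalar_hom_single, of "lin_form n A" for n A, folded coord_change_alt]
lemmas coord_change_monomial =
  poly_subst_monomial[OF scalar_hom_single, of "lin_form n A" for n A, folded coord_change_alt]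

lemma coord_change_scale: "coord_change n A (scale c p) = scale c (coord_change n A p)"
proof -
  have "coord_change n A (single 0 c) = single 0 c"
    by (simp add: coord_change_alt poly_subst_single[OF scalar_hom_single])
  then show ?thesis by (simp add: scale_conv_mult coord_change_mult)
qed

lemma linear_coord_change: "linear_map (coord_change n A)"
  by (simp add: Vector_Spaces.linear_iff vs.vector_space_axioms coord_change_add coord_change_scale)

lemma coord_change_zero [simp]: "coord_change n A 0 = 0"
  by (simp add: coord_change_alt)

lemma coord_change_var: "coord_change n A (var j) = lin_form n A j"
  by (simp add: coord_change_monomial mon_eval_single)

lemma coord_change_mon_eval: "coord_change n A (mon_eval x m) = mon_eval (\<lambda>i. coord_change n A (x i)) m"
proof -
  have one: "coord_change n A 1 = 1" using coord_change_monomial[of n A 0] by (simp add: monomial_zero)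
  have pow: "coord_change n A (p ^ e) = coord_change n A p ^ e" for p :: "(nat, 'a) mpoly" and e
    by (induction e) (auto simp: one coord_change_mult)
  have "coord_change n A (\<Prod>i\<in>K. f i) = (\<Prod>i\<in>K. coord_change n A (f i))"
    for K :: "'b set" and f :: "'b \<Rightarrow> (nat, 'a) mpoly"
    by (induction K rule: infinite_finite_induct) (auto simp: one coord_change_mult)
  then show ?thesis by (simp add: mon_eval_def pow)
qed

lemma sum_scale_monomials: "p = (\<Sum>m\<in>keys p. scale (lookup p m) (monomial m))"
  by (rule expand_supported) (auto simp: supported_def)

lemma coord_change_expand:
  "coord_change n A p = (\<Sum>m\<in>keys p. scale (lookup p m) (mon_eval (lin_form n A) m))"
proof -
  have "coord_change n A p
      = coord_change n A (\<Sum>m\<in>keys p. scale (lookup p m) (monomial m))"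
    by (simp only: sum_scale_monomials[symmetric])
  then show ?thesis by (simp only: coord_change_sum coord_change_scale coord_change_monomial)
qed

lemma lin_form_in_forms: "lin_form n A j \<in> forms n 1"
  unfolding lin_form_def
  by (intro vs.subspace_sum[OF subspace_forms] vs.subspace_scale[OF subspace_forms] var_in_forms)

lemma one_in_forms: "1 \<in> forms n 0"
  using monomial_in_forms[of 0 n 0] by (simp add: monomial_zero mons_def)

lemma power_in_forms: "p \<in> forms n d \<Longrightarrow> p ^ e \<in> forms n (e * d)"
  by (induction e) (auto simp: one_in_forms add.commute dest: forms_mult)

lemma mon_eval_in_forms:
  assumes "\<And>i. x i \<in> forms n 1"
  shows "mon_eval x m \<in> forms n (mon_deg m)"
proof -
  have "(\<Prod>i\<in>K. x i ^ e i) \<in> forms n (\<Sum>i\<in>K. e i)" if "finite K" for K e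
    using that
  proof (induction K rule: finite_induct)
    case (insert i K)
    have "x i ^ e i \<in> forms n (e i)" using power_in_forms[OF assms, of i "e i"] by simp
    then show ?case using insert forms_mult by simp
  qed (simp add: one_in_forms)
  then show ?thesis by (simp add: mon_eval_def mon_deg_def)
qed

lemma coord_change_in_forms:
  assumes "p \<in> forms n d"
  shows "coord_change n A p \<in> forms n d"
proof -
  have "(\<Sum>m\<in>keys p. scale (lookup p m) (mon_eval (lin_form n A) m)) \<in> forms n d"
  proof (intro vs.subspace_sum[OF subspace_forms] vs.subspace_scale[OF subspace_forms])
    fix m assume "m \<in> keys p"
    then have "mon_deg m = d" using assms by (auto simp: forms_def supported_def mons_def)
    then show "mon_eval (lin_form n A) m \<in> forms n d" using mon_eval_in_forms lin_form_in_forms by metis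
  qed
  then show ?thesis by (simp only: coord_change_expand)
qed

lemma coord_change_lin_form:
  assumes "A \<in> carrier_mat n n" "B \<in> carrier_mat n n" "j \<in> {1..n}"
  shows "coord_change n B (lin_form n A j) = lin_form n (B * A) j"
proof -
  have "coord_change n B (lin_form n A j)
      = (\<Sum>i\<in>{1..n}. \<Sum>k\<in>{1..n}. scale (A $$ (i - 1, j - 1) * B $$ (k - 1, i - 1)) (var k))"
    by (simp add: lin_form_def coord_change_sum coord_change_scale coord_change_monomial
        mon_eval_single vs.scale_sum_right)
  also have "\<dots> = (\<Sum>k\<in>{1..n}. \<Sum>i\<in>{1..n}. scale (A $$ (i - 1, j - 1) * B $$ (k - 1, i - 1)) (var k))"
    by (rule sum.swap)
  also have "\<dots> = (\<Sum>k\<in>{1..n}. scale (\<Sum>i\<in>{1..n}. B $$ (k - 1, i - 1) * A $$ (i - 1, j - 1)) (var k))"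
    by (simp add: vs.scale_sum_left mult.commute)
  also have "\<dots> = lin_form n (B * A) j" unfolding lin_form_def
  proof (intro sum.cong refl arg_cong2[of _ _ _ _ scale])
    fix k assume k: "k \<in> {1..n}"
    have "(\<Sum>i\<in>{1..n}. B $$ (k - 1, i - 1) * A $$ (i - 1, j - 1))
        = (\<Sum>i\<in>{0..<n}. B $$ (k - 1, i) * A $$ (i, j - 1))"
      by (rule sum.reindex_bij_witness[of _ Suc "\<lambda>i. i - 1"]) auto
    then show "(\<Sum>i\<in>{1..n}. B $$ (k - 1, i - 1) * A $$ (i - 1, j - 1)) = (B * A) $$ (k - 1, j - 1)"
      using assms k by (auto simp: scalar_prod_def)
  qed
  finally show ?thesis .
qed

lemma mon_eval_cong: "(\<And>i. i \<in> keys m \<Longrightarrow> x i = y i) \<Longrightarrow> mon_eval x m = mon_eval y m"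
  by (simp add: mon_eval_def)

lemma coord_change_compose:
  assumes AB: "A \<in> carrier_mat n n" "B \<in> carrier_mat n n" and p: "p \<in> polys_in {1..n}"
  shows "coord_change n B (coord_change n A p) = coord_change n (B * A) p"
proof -
  have "coord_change n B (mon_eval (lin_form n A) m) = mon_eval (lin_form n (B * A)) m"
    if "m \<in> keys p" for m
    unfolding coord_change_mon_eval
  proof (rule mon_eval_cong)
    fix i assume "i \<in> keys m"
    then have "i \<in> {1..n}" using that p unfolding polys_in_def by blast
    then show "coord_change n B (lin_form n A i) = lin_form n (B * A) i"
      by (rule coord_change_lin_form[OF AB])
  qed
  then show ?thesis
    unfolding coord_change_expand[of n A p] coord_change_expand[of n "B * A" p]
    by (simp add: coord_change_sum coord_change_scale)
qed

lemma lin_form_one: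
  assumes "j \<in> {1..n}"
  shows "lin_form n (1\<^sub>m n) j = var j"
proof -
  have "lin_form n (1\<^sub>m n) j = (\<Sum>i\<in>{1..n}. if i = j then var i else 0)"
    unfolding lin_form_def using assms by (intro sum.cong) auto
  then show ?thesis using assms by simp
qed

lemma mon_eval_var: "mon_eval (\<lambda>i. monomial (single i 1)) m = monomial m"
proof -
  have "m = (\<Sum>i\<in>keys m. single i (lookup m i))"
    by (rule sum_singles)
  then have "monomial m = (\<Prod>i\<in>keys m. monomial (single i (lookup m i)))"
    using monomial_sum[OF finite_keys] by metis
  also have "\<dots> = mon_eval (\<lambda>i. monomial (single i 1)) m"
    unfolding mon_eval_def by (intro prod.cong refl monomial_power)
  finally show ?thesis by (rule sym)
qed

lemma coord_change_one:
  fixes p :: "(nat, 'k::field_char_0) mpoly"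
  assumes p: "p \<in> polys_in {1..n}"
  shows "coord_change n (1\<^sub>m n) p = p"
proof -
  have "mon_eval (lin_form n (1\<^sub>m n :: 'k mat)) m = mon_eval (\<lambda>i. var i) m" if "m \<in> keys p" for m
  proof (rule mon_eval_cong)
    fix i assume "i \<in> keys m"
    then have "i \<in> {1..n}" using that p unfolding polys_in_def by blast
    then show "lin_form n (1\<^sub>m n :: 'k mat) i = var i" by (rule lin_form_one)
  qed
  then have "coord_change n (1\<^sub>m n :: 'k mat) p
      = (\<Sum>m\<in>keys p. scale (lookup p m) (monomial m))"
    unfolding coord_change_expand by (simp add: mon_eval_var)
  then show ?thesis by (simp only: sum_scale_monomials[symmetric])
qed

lemma forms_subset_polys_in: "forms n d \<subseteq> polys_in {1..n}"
  by (auto simp: forms_def supported_def mons_def polys_in_def)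

lemma GL_inverse:
  assumes "A \<in> GL n"
  obtains B where "B \<in> GL n" "A * B = 1\<^sub>m n" "B * A = 1\<^sub>m n"
proof -
  have A: "A \<in> carrier_mat n n" using assms by (simp add: GL_def)
  obtain B where B: "A * B = 1\<^sub>m n" "B * A = 1\<^sub>m (dim_row B)"
    using assms by (auto simp: GL_def invertible_mat_def inverts_mat_def)
  have "dim_col B = n" using arg_cong[OF B(1), of dim_col] by simp
  moreover have "dim_row B = n" using arg_cong[OF B(2), of dim_col] A by simp
  ultimately have "B \<in> carrier_mat n n" by auto
  then have "B \<in> GL n" using A B by (auto simp: GL_def invertible_mat_def inverts_mat_def)
  then show ?thesis using that B \<open>dim_row B = n\<close> by simp
qed

lemma coord_change_inverse:
  assumes "A \<in> carrier_mat n n" "B \<in> carrier_mat n n" "B * A = 1\<^sub>m n" "p \<in> polys_in {1..n}"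
  shows "coord_change n B (coord_change n A p) = p"
  using coord_change_compose[OF assms(1,2,4)] coord_change_one[OF assms(4)] assms(3) by simp

lemma inj_on_coord_change:
  assumes "A \<in> GL n"
  shows "inj_on (coord_change n A) (polys_in {1..n})"
proof -
  obtain B where B: "B \<in> GL n" "A * B = 1\<^sub>m n" "B * A = 1\<^sub>m n" using GL_inverse[OF assms] .
  have "coord_change n B (coord_change n A p) = p" if "p \<in> polys_in {1..n}" for p
    using coord_change_inverse[of A n B p] B assms that by (simp add: GL_def)
  then show ?thesis by (rule inj_on_inverseI)
qed

lemma dim_coord_change:
  assumes "A \<in> GL n" "vs.subspace V" "V \<subseteq> forms n d"
  shows "vs.dim (coord_change n A ` V) = vs.dim V"
proof -
  have "inj_on (coord_change n A) V"
    by (rule inj_on_subset[OF inj_on_coord_change[OF assms(1)]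
          subset_trans[OF assms(3) forms_subset_polys_in]])
  then show ?thesis by (rule vsp.dim_image_inj[OF linear_coord_change assms(2)])
qed

lemma coord_change_image:
  assumes "vs.subspace V" "V \<subseteq> forms n d"
  shows "vs.subspace (coord_change n A ` V)" "coord_change n A ` V \<subseteq> forms n d"
proof -
  show "vs.subspace (coord_change n A ` V)"
    by (rule vsp.linear_subspace_image[OF linear_coord_change assms(1)])
  show "coord_change n A ` V \<subseteq> forms n d"
    using assms(2) coord_change_in_forms[of _ n d A] by auto
qed

lemma GL_iff_det: "A \<in> GL n \<longleftrightarrow> A \<in> carrier_mat n n \<and> det A \<noteq> 0"
proof
  assume A: "A \<in> GL n"
  then obtain B where "B \<in> GL n" "A * B = 1\<^sub>m n" using GL_inverse by blast
  then have "det A * det B = 1" using A det_mult[of A n B] by (simp add: GL_def)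
  then show "A \<in> carrier_mat n n \<and> det A \<noteq> 0" using A by (auto simp: GL_def)
next
  assume A: "A \<in> carrier_mat n n \<and> det A \<noteq> 0"
  then obtain B where "B \<in> carrier_mat n n" "A * B = 1\<^sub>m n" "B * A = 1\<^sub>m n"
    using det_non_zero_imp_unit[of A n "()"] by (auto simp: Units_def ring_mat_def)
  then show "A \<in> GL n" using A by (auto simp: GL_def invertible_mat_def inverts_mat_def)
qed

section \<open>Zariski-generic matrices\<close>

lemma expand_supported_keys:
  "finite X \<Longrightarrow> keys p \<subseteq> X \<Longrightarrow> p = (\<Sum>m\<in>X. scale (lookup p m) (monomial m))"
  by (rule expand_supported) (auto simp: supported_def)

definition coeff_family :: "('x \<Rightarrow> 'k::field_char_0) set \<Rightarrow> ('x \<Rightarrow> ('i, 'k) mpoly) \<Rightarrow> bool"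
  where "coeff_family P z \<longleftrightarrow> (\<forall>m. (\<lambda>x. lookup (z x) m) \<in> P) \<and>
    (\<exists>X. finite X \<and> (\<forall>x. keys (z x) \<subseteq> X))"

lemma coeff_familyI:
  "(\<And>m. (\<lambda>x. lookup (z x) m) \<in> P) \<Longrightarrow> finite X \<Longrightarrow>
    (\<And>x. keys (z x) \<subseteq> X) \<Longrightarrow> coeff_family P z"
  unfolding coeff_family_def by blast

lemma coeff_family_lookup: "coeff_family P z \<Longrightarrow> (\<lambda>x. lookup (z x) m) \<in> P"
  unfolding coeff_family_def by blast

lemma coeff_family_keys:
  assumes "coeff_family P z"
  obtains X where "finite X" "\<forall>x. keys (z x) \<subseteq> X"
  using assms unfolding coeff_family_def by blast

lemma coeff_family_const: "function_algebra P \<Longrightarrow> coeff_family P (\<lambda>x. p)"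
  by (rule coeff_familyI[of _ _ "keys p"]) (simp_all add: function_algebra_const)

lemma coeff_family_add:
  assumes P: "function_algebra P" and z: "coeff_family P z" and w: "coeff_family P w"
  shows "coeff_family P (\<lambda>x. z x + w x)"
proof -
  obtain X where X': "finite X" "\<forall>x. keys (z x) \<subseteq> X"
    using coeff_family_keys[OF z] .
  note X = X'(1) X'(2)[rule_format]
  obtain Y where Y': "finite Y" "\<forall>x. keys (w x) \<subseteq> Y"
    using coeff_family_keys[OF w] .
  note Y = Y'(1) Y'(2)[rule_format]
  show ?thesis
  proof (rule coeff_familyI[of _ _ "X \<union> Y"])
    show "(\<lambda>x. lookup (z x + w x) m) \<in> P" for m
      unfolding lookup_add
      by (intro function_algebra_add[OF P] coeff_family_lookup[OF z] coeff_family_lookup[OF w])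
    show "keys (z x + w x) \<subseteq> X \<union> Y" for x
      by (rule subset_trans[OF Poly_Mapping.keys_add Un_mono[OF X(2) Y(2)]])
  qed (use X Y in simp)
qed

lemma coeff_family_scale:
  assumes P: "function_algebra P" and f: "f \<in> P" and z: "coeff_family P z"
  shows "coeff_family P (\<lambda>x. scale (f x) (z x))"
proof -
  obtain X where X': "finite X" "\<forall>x. keys (z x) \<subseteq> X"
    using coeff_family_keys[OF z] .
  note X = X'(1) X'(2)[rule_format]
  show ?thesis
  proof (rule coeff_familyI[OF _ X(1)])
    show "(\<lambda>x. lookup (scale (f x) (z x)) m) \<in> P" for m
      unfolding lookup_scale by (intro function_algebra_mult[OF P f] coeff_family_lookup[OF z])
    show "keys (scale (f x) (z x)) \<subseteq> X" for x
      by (rule subset_trans[OF _ X(2)[of x]]) (auto simp: in_keys_iff)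
  qed
qed

lemma coeff_family_sum:
  assumes P: "function_algebra P" and "\<And>i. i \<in> A \<Longrightarrow> coeff_family P (z i)"
  shows "coeff_family P (\<lambda>x. \<Sum>i\<in>A. z i x)"
  using assms(2) by (induction A rule: infinite_finite_induct)
    (simp_all add: coeff_family_const[OF P] coeff_family_add[OF P])

lemma coeff_family_mult:
  fixes z w :: "'x \<Rightarrow> ('i, 'k::field_char_0) mpoly"
  assumes P: "function_algebra P" and z: "coeff_family P z" and w: "coeff_family P w"
  shows "coeff_family P (\<lambda>x. z x * w x)"
proof -
  obtain X where X': "finite X" "\<forall>x. keys (z x) \<subseteq> X"
    using coeff_family_keys[OF z] .
  note X = X'(1) X'(2)[rule_format]
  obtain Y where Y': "finite Y" "\<forall>x. keys (w x) \<subseteq> Y"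
    using coeff_family_keys[OF w] .
  note Y = Y'(1) Y'(2)[rule_format]
  let ?l = "lookup"
  have prod: "scale c p * scale c' q = scale (c * c') (p * q)" for c c' and p q :: "('i, 'k) mpoly"
  proof -
    have "single 0 (c * c') = single 0 c * (single 0 c' :: ('i, 'k) mpoly)"
      by (simp add: mult_single)
    then show ?thesis by (simp only: scale_conv_mult ac_simps)
  qed
  have expand: "z x * w x = (\<Sum>a\<in>X. \<Sum>b\<in>Y. scale (?l (z x) a * ?l (w x) b) (monomial (a + b)))" for x
  proof -
    have "z x * w x = (\<Sum>a\<in>X. scale (?l (z x) a) (monomial a)) * (\<Sum>b\<in>Y. scale (?l (w x) b) (monomial b))"
      by (simp only: expand_supported_keys[OF X, symmetric] expand_supported_keys[OF Y, symmetric])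
    then show ?thesis by (simp only: sum_product prod monomial_add)
  qed
  show ?thesis
    unfolding expand
    by (intro coeff_family_sum[OF P] coeff_family_scale[OF P] function_algebra_mult[OF P]
        coeff_family_const[OF P] coeff_family_lookup[OF z] coeff_family_lookup[OF w])
qed

lemma coeff_family_power:
  assumes P: "function_algebra P" and "coeff_family P z"
  shows "coeff_family P (\<lambda>x. z x ^ e)"
  using assms(2) by (induction e) (simp_all add: coeff_family_const[OF P] coeff_family_mult[OF P])

lemma coeff_family_prod:
  assumes P: "function_algebra P" and "\<And>i. i \<in> A \<Longrightarrow> coeff_family P (z i)"
  shows "coeff_family P (\<lambda>x. \<Prod>i\<in>A. z i x)"
  using assms(2) by (induction A rule: infinite_finite_induct)
    (simp_all add: coeff_family_const[OF P] coeff_family_mult[OF P])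

definition mat_poly_funs :: "nat \<Rightarrow> ('k::field_char_0 mat \<Rightarrow> 'k) set"
  where "mat_poly_funs n =
    {\<phi>. \<exists>P\<in>polys_in ({0..<n} \<times> {0..<n}). \<phi> = (\<lambda>A. poly_subst id (\<lambda>ij. A $$ ij) P)}"

lemma function_algebra_mat_poly_funs: "function_algebra (mat_poly_funs n :: ('k::field_char_0 mat \<Rightarrow> 'k) set)"
  unfolding function_algebra_def
proof (intro conjI allI ballI)
  let ?V = "{0..<n} \<times> {0..<n}"
  show "(\<lambda>A. c) \<in> mat_poly_funs n" for c :: 'k
  proof -
    have "single 0 c \<in> polys_in ?V" by (simp add: polys_in_def)
    moreover have "(\<lambda>A. c) = (\<lambda>A :: 'k mat. poly_subst id (\<lambda>ij. A $$ ij) (single 0 c))"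
      by (simp add: poly_subst_single[OF scalar_hom_id])
    ultimately show ?thesis unfolding mat_poly_funs_def by blast
  qed
  fix f g :: "'k mat \<Rightarrow> 'k" assume "f \<in> mat_poly_funs n" "g \<in> mat_poly_funs n"
  then obtain P Q where P: "P \<in> polys_in ?V" "f = (\<lambda>A. poly_subst id (\<lambda>ij. A $$ ij) P)"
    and Q: "Q \<in> polys_in ?V" "g = (\<lambda>A. poly_subst id (\<lambda>ij. A $$ ij) Q)"
    unfolding mat_poly_funs_def by blast
  have "(\<lambda>A. f A + g A) = (\<lambda>A. poly_subst id (\<lambda>ij. A $$ ij) (P + Q))"
    by (simp add: P Q poly_subst_add[OF scalar_hom_id])
  then show "(\<lambda>A. f A + g A) \<in> mat_poly_funs n"
    using polys_in_add[OF P(1) Q(1)] unfolding mat_poly_funs_def by blast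
  have "(\<lambda>A. f A * g A) = (\<lambda>A. poly_subst id (\<lambda>ij. A $$ ij) (P * Q))"
    by (simp add: P Q poly_subst_mult[OF scalar_hom_id])
  then show "(\<lambda>A. f A * g A) \<in> mat_poly_funs n"
    using polys_in_mult[OF P(1) Q(1)] unfolding mat_poly_funs_def by blast
qed

lemma entry_in_mat_poly_funs:
  assumes "i < n" "j < n"
  shows "(\<lambda>A :: 'k::field_char_0 mat. A $$ (i, j)) \<in> mat_poly_funs n"
proof -
  have "(\<lambda>A :: 'k mat. A $$ (i, j)) = (\<lambda>A. poly_subst id (\<lambda>ij. A $$ ij) (monomial (single (i, j) 1)))"
    by (simp add: poly_subst_monomial[OF scalar_hom_id] mon_eval_single)
  moreover have "monomial (single (i, j) 1) \<in> polys_in ({0..<n} \<times> {0..<n})"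
    using assms by (simp add: polys_in_def monomial_def)
  ultimately show ?thesis unfolding mat_poly_funs_def by blast
qed

definition line_poly_funs :: "('k::field_char_0 \<Rightarrow> 'k) set"
  where "line_poly_funs = range poly"

lemma function_algebra_line_poly_funs: "function_algebra line_poly_funs"
  unfolding function_algebra_def line_poly_funs_def
proof (intro conjI allI ballI)
  show "(\<lambda>x. c) \<in> range poly" for c :: 'a by (rule range_eqI[of _ _ "[:c:]"]) (simp add: fun_eq_iff)
  fix f g :: "'a \<Rightarrow> 'a" assume "f \<in> range poly" "g \<in> range poly"
  then obtain p q where "f = poly p" "g = poly q" by blast
  then have "(\<lambda>x. f x + g x) = poly (p + q)" "(\<lambda>x. f x * g x) = poly (p * q)"
    by (simp_all add: fun_eq_iff)
  then show "(\<lambda>x. f x + g x) \<in> range poly" "(\<lambda>x. f x * g x) \<in> range poly"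
    by simp_all
qed

lemma ident_in_line_poly_funs: "(\<lambda>s. s) \<in> line_poly_funs"
  unfolding line_poly_funs_def by (rule range_eqI[of _ _ "[:0, 1:]"]) (simp add: fun_eq_iff)

definition mat_line :: "nat \<Rightarrow> 'k::field_char_0 mat \<Rightarrow> 'k mat \<Rightarrow> 'k \<Rightarrow> 'k mat"
  where "mat_line n A B s = mat n n (\<lambda>ij. A $$ ij + s * (B $$ ij - A $$ ij))"

lemma mat_line_entry: "i < n \<Longrightarrow> j < n \<Longrightarrow> (\<lambda>s. mat_line n A B s $$ (i, j)) \<in> line_poly_funs"
  using function_algebra_line_poly_funs ident_in_line_poly_funs
  by (simp add: mat_line_def)
    (intro function_algebra_add function_algebra_mult function_algebra_const)

lemma mat_poly_funs_on_line:
  assumes "\<phi> \<in> mat_poly_funs n"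
  shows "(\<lambda>s. \<phi> (mat_line n A B s)) \<in> line_poly_funs"
proof -
  obtain P where P: "P \<in> polys_in ({0..<n} \<times> {0..<n})" "\<phi> = (\<lambda>A. poly_subst id (\<lambda>ij. A $$ ij) P)"
    using assms unfolding mat_poly_funs_def by blast
  note alg = function_algebra_line_poly_funs
  have "(\<lambda>s. mat_line n A B s $$ ij ^ e) \<in> line_poly_funs"
    if "m \<in> keys P" "ij \<in> keys m" for m ij e
  proof -
    have "ij \<in> {0..<n} \<times> {0..<n}" using P(1) that unfolding polys_in_def by blast
    then show ?thesis
      using mat_line_entry[of "fst ij" n "snd ij" A B] by (intro function_algebra_power[OF alg]) auto
  qed
  then show ?thesis unfolding P(2) poly_subst_def
    by (intro function_algebra_sum[OF alg] function_algebra_mult[OF alg] function_algebra_const[OF alg]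
        function_algebra_prod[OF alg])
qed

text \<open>Basic open sets suffice, since every nonempty open set contains a nonempty one, and unlike open
  sets in general they are described by a single polynomial.\<close>

definition generically :: "nat \<Rightarrow> ('k::field_char_0 mat \<Rightarrow> bool) \<Rightarrow> bool"
  where "generically n Q \<longleftrightarrow>
    (\<exists>\<delta>\<in>mat_poly_funs n. (\<exists>A\<in>GL n. \<delta> A \<noteq> 0) \<and> (\<forall>A\<in>GL n. \<delta> A \<noteq> 0 \<longrightarrow> Q A))"

lemma one_in_GL: "1\<^sub>m n \<in> GL n"
  by (simp add: GL_iff_det)

lemma generically_ex: "generically n Q \<Longrightarrow> \<exists>A\<in>GL n. Q A"
  unfolding generically_def by blast

lemma generically_mono: "generically n Q \<Longrightarrow> (\<And>A. A \<in> GL n \<Longrightarrow> Q A \<Longrightarrow> Q' A) \<Longrightarrow> generically n Q'"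
  unfolding generically_def by blast

lemma generically_True: "generically n (\<lambda>A :: 'k::field_char_0 mat. True)"
  unfolding generically_def
  by (rule bexI[OF _ function_algebra_const[OF function_algebra_mat_poly_funs, of 1]])
    (use one_in_GL in auto)

text \<open>Restricted to the line through two matrices, polynomial functions become univariate
  polynomials, and finitely many nonzero ones have a common nonroot in an infinite field.\<close>

lemma generically_conj:
  fixes Q Q' :: "'k::field_char_0 mat \<Rightarrow> bool"
  assumes "generically n Q" "generically n Q'"
  shows "generically n (\<lambda>A. Q A \<and> Q' A)"
proof -
  obtain \<delta> A where \<delta>: "\<delta> \<in> mat_poly_funs n" "A \<in> GL n" "\<delta> A \<noteq> 0" "\<forall>A\<in>GL n. \<delta> A \<noteq> 0 \<longrightarrow> Q A"
    using assms(1) unfolding generically_def by blast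
  obtain \<delta>' B where \<delta>': "\<delta>' \<in> mat_poly_funs n" "B \<in> GL n" "\<delta>' B \<noteq> 0" "\<forall>A\<in>GL n. \<delta>' A \<noteq> 0 \<longrightarrow> Q' A"
    using assms(2) unfolding generically_def by blast
  let ?M = "mat_line n A B"
  have M0: "?M 0 = A" and M1: "?M 1 = B"
    using \<delta>(2) \<delta>'(2) by (auto simp: mat_line_def GL_def intro!: eq_matI)
  have Mc: "?M s \<in> carrier_mat n n" for s by (simp add: mat_line_def)
  have "(\<lambda>s. det (?M s)) \<in> line_poly_funs"
    by (intro function_algebra_det[OF function_algebra_line_poly_funs Mc] mat_line_entry)
  then obtain q where "(\<lambda>s. det (?M s)) = poly q" unfolding line_poly_funs_def by blast
  then have q: "\<And>s. det (?M s) = poly q s" by (rule fun_cong)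
  obtain p where "(\<lambda>s. \<delta> (?M s)) = poly p"
    using mat_poly_funs_on_line[OF \<delta>(1), of A B] unfolding line_poly_funs_def by blast
  then have p: "\<And>s. \<delta> (?M s) = poly p s" by (rule fun_cong)
  obtain p' where "(\<lambda>s. \<delta>' (?M s)) = poly p'"
    using mat_poly_funs_on_line[OF \<delta>'(1), of A B] unfolding line_poly_funs_def by blast
  then have p': "\<And>s. \<delta>' (?M s) = poly p' s" by (rule fun_cong)
  have "p \<noteq> 0" "p' \<noteq> 0" "q \<noteq> 0"
    using p[of 0] p'[of 1] q[of 0] \<delta> \<delta>' by (auto simp: M0 M1 GL_iff_det)
  then have "p * p' * q \<noteq> 0" by simp
  then obtain s where s: "poly (p * p' * q) s \<noteq> 0" using poly_all_0_iff_0 by blast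
  then have "?M s \<in> GL n" "\<delta> (?M s) * \<delta>' (?M s) \<noteq> 0" using p p' q Mc by (auto simp: GL_iff_det)
  then show ?thesis
    unfolding generically_def using \<delta>(4) \<delta>'(4)
    by (rule_tac bexI[OF _ function_algebra_mult[OF function_algebra_mat_poly_funs \<delta>(1) \<delta>'(1)]]) auto
qed

lemma generically_ball:
  assumes "finite X" "\<And>x. x \<in> X \<Longrightarrow> generically n (Q x)"
  shows "generically n (\<lambda>A. \<forall>x\<in>X. Q x A)"
  using assms
proof (induction X rule: finite_induct)
  case empty
  show ?case using generically_True by simp
next
  case (insert x X)
  then have "generically n (\<lambda>A. Q x A \<and> (\<forall>x\<in>X. Q x A))" by (intro generically_conj) auto
  then show ?case by (rule generically_mono) auto
qed

definition proj :: "('i \<Rightarrow>\<^sub>0 nat) set \<Rightarrow> ('i, 'k::field_char_0) mpoly \<Rightarrow> ('i, 'k) mpoly"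
  where "proj T p = (\<Sum>m\<in>keys p \<inter> T. single m (lookup p m))"

lemma lookup_proj: "lookup (proj T p) m = (if m \<in> T then lookup p m else 0)"
proof -
  have "lookup (proj T p) m
      = (\<Sum>m'\<in>keys p \<inter> T. if m' = m then lookup p m' else 0)"
    unfolding proj_def lookup_sum by (intro sum.cong) (auto simp: lookup_single when_def)
  then show ?thesis by (auto simp: in_keys_iff)
qed

lemma linear_proj: "linear_map (proj T)"
  by (auto simp: Vector_Spaces.linear_iff vs.vector_space_axioms lookup_proj lookup_add
      intro!: poly_mapping_eqI)

lemma proj_in_forms: "p \<in> forms n d \<Longrightarrow> proj T p \<in> forms n d"
  unfolding forms_def by (intro supportedI) (auto simp: lookup_proj supportedD)

lemma coeff_family_proj:
  assumes P: "function_algebra P" and z: "coeff_family P z"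
  shows "coeff_family P (\<lambda>x. proj T (z x))"
proof -
  obtain X where X': "finite X" "\<forall>x. keys (z x) \<subseteq> X"
    using coeff_family_keys[OF z] .
  note X = X'(1) X'(2)[rule_format]
  show ?thesis
  proof (rule coeff_familyI[OF _ X(1)])
    show "(\<lambda>x. lookup (proj T (z x)) m) \<in> P" for m
      by (cases "m \<in> T") (simp_all add: lookup_proj coeff_family_lookup[OF z] function_algebra_const[OF P])
    show "keys (proj T (z x)) \<subseteq> X" for x
      by (rule subset_trans[OF _ X(2)[of x]]) (auto simp: in_keys_iff lookup_proj split: if_splits)
  qed
qed

lemma coeff_family_coord_change:
  fixes u :: "(nat, 'k::field_char_0) mpoly"
  assumes "u \<in> forms n d"
  shows "coeff_family (mat_poly_funs n) (\<lambda>A. coord_change n A u)"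
proof -
  note alg = function_algebra_mat_poly_funs
  have "coeff_family (mat_poly_funs n) (\<lambda>A :: 'k mat. lin_form n A j ^ e)"
    if "m \<in> keys u" "j \<in> keys m" for m j e
  proof -
    have "m \<in> mons n d" using assms that by (auto simp: forms_def supported_def)
    then have "j \<in> {1..n}" using that unfolding mons_def by blast
    then have "(\<lambda>A :: 'k mat. A $$ (i - 1, j - 1)) \<in> mat_poly_funs n" if "i \<in> {1..n}" for i
      using that by (intro entry_in_mat_poly_funs) auto
    then show ?thesis unfolding lin_form_def
      by (intro coeff_family_power[OF alg] coeff_family_sum[OF alg] coeff_family_scale[OF alg]
          coeff_family_const[OF alg])
  qed
  then show ?thesis unfolding coord_change_expand mon_eval_def
    by (intro coeff_family_sum[OF alg] coeff_family_scale[OF alg] coeff_family_prod[OF alg]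
        function_algebra_const[OF alg])
qed

text \<open>These dimensions determine the leading monomials of the transformed space. Quantifying over
  arbitrary sets of monomials avoids a description of the upper sets of the order.\<close>

definition max_rank :: "nat \<Rightarrow> (nat, 'k::field_char_0) mpoly set \<Rightarrow> 'k mat \<Rightarrow> bool"
  where "max_rank n U A \<longleftrightarrow> (\<forall>T. \<forall>B\<in>GL n.
    vs.dim (proj T ` coord_change n B ` U) \<le> vs.dim (proj T ` coord_change n A ` U))"

text \<open>At a matrix of largest rank choose preimages of a basis of the projection. Their images at other
  matrices have polynomial coefficients and stay independent on an open set, where the rank is then at
  least as large.\<close>

lemma generically_max_rank:
  fixes U :: "(nat, 'k::field_char_0) mpoly set"
  assumes U: "vs.subspace U" "U \<subseteq> forms n d"
  shows "generically n (max_rank n U)"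
proof -
  let ?r = "\<lambda>T A. vs.dim (proj T ` coord_change n A ` U)"
  have one: "generically n (\<lambda>A. \<forall>B\<in>GL n. ?r T B \<le> ?r T A)" for T
  proof -
    have bound: "?r T A \<le> vs.dim U" for A
    proof -
      have "linear_map (proj T \<circ> coord_change n A)"
        using linear_coord_change linear_proj by (rule Vector_Spaces.linear_compose)
      then show ?thesis
        using vsp.dim_image_le_finite[of "proj T \<circ> coord_change n A" U] fin_span_subset_forms[OF U(2)]
        by (simp add: image_comp)
    qed
    have "\<exists>A. A \<in> GL n \<and> (\<forall>B. B \<in> GL n \<longrightarrow> ?r T B \<le> ?r T A)"
      by (rule ex_has_greatest_nat[where P = "\<lambda>A. A \<in> GL n" and k = "1\<^sub>m n" and b = "Suc (vs.dim U)"])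
        (simp_all add: bound less_Suc_eq_le one_in_GL)
    then obtain A0 where A0: "A0 \<in> GL n" "\<forall>B\<in>GL n. ?r T B \<le> ?r T A0" by blast
    let ?W = "\<lambda>A. proj T ` coord_change n A ` U"
    have W: "?W A \<subseteq> forms n d" for A
    proof clarify
      fix u assume "u \<in> U"
      then have "u \<in> forms n d" using U(2) by blast
      then show "proj T (coord_change n A u) \<in> forms n d" by (intro proj_in_forms coord_change_in_forms)
    qed
    obtain B where B: "finite B" "B \<subseteq> ?W A0" "vs.independent B" "card B = ?r T A0"
      using vs.fin_span_basis[OF fin_span_subset_forms[OF W[of A0]]] by metis
    define N where "N = card B"
    obtain f where f: "bij_betw f {..<N} B"
      using ex_bij_betw_nat_finite[OF B(1)] by (auto simp: N_def lessThan_atLeast0)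
    have "\<forall>i\<in>{..<N}. \<exists>w. w \<in> U \<and> proj T (coord_change n A0 w) = f i"
    proof
      fix i assume "i \<in> {..<N}"
      then have "f i \<in> ?W A0" using f B(2) unfolding bij_betw_def by blast
      then show "\<exists>w. w \<in> U \<and> proj T (coord_change n A0 w) = f i" by auto
    qed
    from bchoice[OF this] obtain w
      where w: "\<forall>i\<in>{..<N}. w i \<in> U \<and> proj T (coord_change n A0 (w i)) = f i" ..
    define z where "z i A = proj T (coord_change n A (w i))" for i A
    have z0: "z i A0 = f i" if "i < N" for i using w that by (simp add: z_def)
    have zW: "z i A \<in> ?W A" if "i < N" for i A using w that by (auto simp: z_def)
    have "\<exists>\<delta>\<in>mat_poly_funs n. \<delta> A0 \<noteq> 0 \<and> (\<forall>A. \<delta> A \<noteq> 0 \<longrightarrow>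
        inj_on (\<lambda>i. z i A) {..<N} \<and> vs.independent ((\<lambda>i. z i A) ` {..<N}))"
    proof (rule independent_open[OF function_algebra_mat_poly_funs finite_mons])
      show "keys (z i A) \<subseteq> mons n d" if "i < N" for i A
        using zW[OF that, of A] W[of A] by (auto simp: forms_def supported_def)
      show "(\<lambda>A. lookup (z i A) m) \<in> mat_poly_funs n" if "i < N" for i m
      proof -
        have "w i \<in> forms n d" using w that U(2) by auto
        then have "coeff_family (mat_poly_funs n) (z i)"
          unfolding z_def by (intro coeff_family_proj coeff_family_coord_change function_algebra_mat_poly_funs)
        then show ?thesis by (simp add: coeff_family_def)
      qed
      show "inj_on (\<lambda>i. z i A0) {..<N}"
        using f z0 by (auto simp: bij_betw_def inj_on_def)
      have "(\<lambda>i. z i A0) ` {..<N} = B" using f z0 by (auto simp: bij_betw_def image_iff)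
      then show "vs.independent ((\<lambda>i. z i A0) ` {..<N})" using B(3) by simp
    qed
    then obtain \<delta> where \<delta>: "\<delta> \<in> mat_poly_funs n" "\<delta> A0 \<noteq> 0"
      "\<And>A. \<delta> A \<noteq> 0 \<Longrightarrow> inj_on (\<lambda>i. z i A) {..<N} \<and> vs.independent ((\<lambda>i. z i A) ` {..<N})"
      by blast
    have "?r T C \<le> ?r T A" if "\<delta> A \<noteq> 0" "C \<in> GL n" for A C
    proof -
      have "card ((\<lambda>i. z i A) ` {..<N}) \<le> ?r T A"
        using \<delta>(3)[OF that(1)] zW by (intro vs.independent_card_le_dim[OF fin_span_subset_forms[OF W]]) auto
      then have "N \<le> ?r T A" using \<delta>(3)[OF that(1)] by (simp add: card_image)
      then show ?thesis using A0(2) that(2) B(4) by (auto simp: N_def intro: order_trans)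
    qed
    then show ?thesis unfolding generically_def using \<delta>(1,2) A0(1) by blast
  qed
  have fin_case: "generically n (\<lambda>A. \<forall>T\<in>Pow (mons n d). \<forall>B\<in>GL n. ?r T B \<le> ?r T A)"
    by (rule generically_ball[OF _ one]) (simp add: finite_mons)
  have proj_eq: "proj T ` coord_change n A ` U = proj (T \<inter> mons n d) ` coord_change n A ` U" for T A
  proof -
    have "proj T p = proj (T \<inter> mons n d) p" if "p \<in> forms n d" for p :: "(nat, 'k) mpoly"
      using that by (intro poly_mapping_eqI) (auto simp: lookup_proj forms_def dest: supportedD)
    then show ?thesis using coord_change_in_forms U(2) by (intro image_cong) blast+
  qed
  have "generically n (\<lambda>A. \<forall>T. \<forall>B\<in>GL n. ?r T B \<le> ?r T A)"
    using fin_case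
  proof (rule generically_mono)
    fix A assume max: "\<forall>T\<in>Pow (mons n d). \<forall>B\<in>GL n. ?r T B \<le> ?r T A"
    show "\<forall>T. \<forall>B\<in>GL n. ?r T B \<le> ?r T A"
    proof (intro allI ballI)
      fix T and B :: "'k mat" assume "B \<in> GL n"
      then show "?r T B \<le> ?r T A" using max unfolding proj_eq[of T] by blast
    qed
  qed
  then show ?thesis by (simp add: max_rank_def[abs_def])
qed

section \<open>Homogeneous ideals\<close>

lemma poly_ring_simps [simp]:
  "carrier (poly_ring n) = polys_in {1..n}"
  "p \<otimes>\<^bsub>poly_ring n\<^esub> q = p * q" "p \<oplus>\<^bsub>poly_ring n\<^esub> q = p + q"
  "\<zero>\<^bsub>poly_ring n\<^esub> = 0" "\<one>\<^bsub>poly_ring n\<^esub> = 1"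
  by (simp_all add: poly_ring_def)

lemma ring_poly_ring: "ring (poly_ring n :: (nat, 'k::field_char_0) mpoly ring)"
  using cring_poly_ring cring.axioms(1) by blast

lemma poly_idealI:
  fixes I :: "(nat, 'k::field_char_0) mpoly set"
  assumes sub: "I \<subseteq> polys_in {1..n}" and zero: "0 \<in> I"
    and add: "\<And>p q. p \<in> I \<Longrightarrow> q \<in> I \<Longrightarrow> p + q \<in> I"
    and mult: "\<And>p q. p \<in> I \<Longrightarrow> q \<in> polys_in {1..n} \<Longrightarrow> q * p \<in> I"
  shows "ideal I (poly_ring n)"
proof (rule idealI[OF ring_poly_ring])
  interpret R: cring "poly_ring n :: (nat, 'k) mpoly ring" by (rule cring_poly_ring)
  have minus_one: "- 1 \<in> polys_in {1..n}" by (simp add: polys_in_def)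
  show "subgroup I (add_monoid (poly_ring n))"
  proof (rule subgroup.intro)
    fix p assume p: "p \<in> I"
    have "- p = (- 1) * p" by simp
    then have mp: "- p \<in> I" using mult[OF p minus_one] by simp
    have "\<ominus>\<^bsub>poly_ring n\<^esub> p = - p"
      using p mp sub by (intro R.minus_equality) auto
    then show "inv\<^bsub>add_monoid (poly_ring n)\<^esub> p \<in> I" using mp by (simp add: a_inv_def)
  qed (use sub zero add in auto)
qed (use mult in \<open>auto simp: mult.commute\<close>)

lemma poly_idealD:
  fixes I :: "(nat, 'k::field_char_0) mpoly set"
  assumes "ideal I (poly_ring n)"
  shows "I \<subseteq> polys_in {1..n}" "0 \<in> I" "\<And>p q. p \<in> I \<Longrightarrow> q \<in> I \<Longrightarrow> p + q \<in> I"
    "\<And>p q. p \<in> I \<Longrightarrow> q \<in> polys_in {1..n} \<Longrightarrow> q * p \<in> I"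
proof -
  interpret ideal I "poly_ring n :: (nat, 'k) mpoly ring" by fact
  show "I \<subseteq> polys_in {1..n}" using a_subset by simp
  show "0 \<in> I" using additive_subgroup.zero_closed[OF ideal.axioms(1)[OF assms]] by simp
  show "p + q \<in> I" if "p \<in> I" "q \<in> I" for p q using additive_subgroup.a_closed[OF ideal.axioms(1)[OF assms] that] by simp
  show "q * p \<in> I" if "p \<in> I" "q \<in> polys_in {1..n}" for p q using I_l_closed[of p q] that by simp
qed

lemma poly_ideal_sum:
  assumes "ideal I (poly_ring n)" "\<And>i. i \<in> A \<Longrightarrow> f i \<in> I"
  shows "(\<Sum>i\<in>A. f i) \<in> I"
  using assms(2) poly_idealD(2,3)[OF assms(1)]
  by (induction A rule: infinite_finite_induct) simp_all

lemma poly_ideal_scale: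
  assumes "ideal I (poly_ring n)" "p \<in> I"
  shows "scale c p \<in> I"
proof -
  have "single 0 c \<in> polys_in {1..n}" by (simp add: polys_in_def)
  then show ?thesis using poly_idealD(4)[OF assms] by (simp add: scale_conv_mult)
qed

lemma genideal_poly:
  fixes S :: "(nat, 'k::field_char_0) mpoly set"
  assumes "S \<subseteq> polys_in {1..n}"
  shows "ideal (genideal (poly_ring n) S) (poly_ring n)" "S \<subseteq> genideal (poly_ring n) S"
  using ring.genideal_ideal[OF ring_poly_ring, of S n] ring.genideal_self[OF ring_poly_ring, of S n] assms
  by simp_all

lemma genideal_poly_minimal:
  fixes S :: "(nat, 'k::field_char_0) mpoly set"
  shows "ideal I (poly_ring n) \<Longrightarrow> S \<subseteq> I \<Longrightarrow> genideal (poly_ring n) S \<subseteq> I"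
  by (rule ring.genideal_minimal[OF ring_poly_ring])

lemma proj_zero [simp]: "proj T 0 = 0"
  by (simp add: proj_def)

lemma proj_monomial_mult:
  assumes "keys m \<subseteq> {1..n}"
  shows "proj (mons n d) (monomial m * p)
    = (if mon_deg m \<le> d then monomial m * proj (mons n (d - mon_deg m)) p else 0)"
proof (rule poly_mapping_eqI)
  fix k
  show "lookup (proj (mons n d) (monomial m * p)) k = lookup
    (if mon_deg m \<le> d then monomial m * proj (mons n (d - mon_deg m)) p else 0) k"
  proof (cases "\<exists>k'. k = m + k'")
    case True
    then obtain k' where k: "k = m + k'" ..
    have "k \<in> mons n d \<longleftrightarrow> mon_deg m \<le> d \<and> k' \<in> mons n (d - mon_deg m)"
      using assms by (auto simp: k mons_def keys_add_nat)
    then show ?thesis by (simp add: k lookup_proj)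
  next
    case False
    then show ?thesis by (simp add: lookup_proj lookup_monomial_mult_other)
  qed
qed

lemma mult_expand_left:
  "q * p = (\<Sum>m\<in>keys q. scale (lookup q m) (monomial m * p))"
proof -
  have "q * p = (\<Sum>m\<in>keys q. scale (lookup q m) (monomial m)) * p"
    by (simp only: sum_scale_monomials[symmetric])
  then show ?thesis by (simp add: sum_distrib_right scale_conv_mult mult.assoc)
qed

lemma monomial_in_polys_in: "keys m \<subseteq> V \<Longrightarrow> monomial m \<in> polys_in V"
  by (simp add: polys_in_def monomial_def)

text \<open>The elements of the ideal all of whose components lie in the ideal form an ideal, and it contains
  the homogeneous generators.\<close>

lemma homogeneous_component:
  fixes I :: "(nat, 'k::field_char_0) mpoly set"
  assumes I: "homogeneous_ideal n I" and p: "p \<in> I"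
  shows "proj (mons n d) p \<in> I"
proof -
  obtain S where S: "\<forall>f\<in>S. \<exists>d. is_form n d f" "I = genideal (poly_ring n) S" and id: "ideal I (poly_ring n)"
    using I unfolding homogeneous_ideal_def by blast
  have S_sub: "S \<subseteq> polys_in {1..n}" using S(1) by (auto simp: is_form_def)
  let ?X = "{p\<in>I. \<forall>d. proj (mons n d) p \<in> I}"
  have "ideal ?X (poly_ring n)"
  proof (rule poly_idealI)
    show "?X \<subseteq> polys_in {1..n}" using poly_idealD(1)[OF id] by blast
    show "0 \<in> ?X" using poly_idealD(2)[OF id] by simp
    show "p + q \<in> ?X" if "p \<in> ?X" "q \<in> ?X" for p q
      using that poly_idealD(3)[OF id] by (simp add: vsp.linear_add[OF linear_proj])
    show "q * p \<in> ?X" if p: "p \<in> ?X" and q: "q \<in> polys_in {1..n}" for p q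
    proof -
      have "proj (mons n d) (q * p) \<in> I" for d
      proof -
        have "proj (mons n d) (q * p) = (\<Sum>m\<in>keys q. scale (lookup q m)
            (if mon_deg m \<le> d then monomial m * proj (mons n (d - mon_deg m)) p else 0))"
          unfolding mult_expand_left[of q p] vsp.linear_sum[OF linear_proj] vsp.linear_scale[OF linear_proj]
        proof (intro sum.cong refl arg_cong[of _ _ "scale _"] proj_monomial_mult)
          show "keys m \<subseteq> {1..n}" if "m \<in> keys q" for m
            using that q unfolding polys_in_def by blast
        qed
        also have "\<dots> \<in> I"
        proof (intro poly_ideal_sum[OF id] poly_ideal_scale[OF id])
          fix m assume "m \<in> keys q"
          then have "keys m \<subseteq> {1..n}" using q unfolding polys_in_def by blast
          then have "monomial m * proj (mons n (d - mon_deg m)) p \<in> I"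
            using p by (intro poly_idealD(4)[OF id] monomial_in_polys_in) auto
          then show "(if mon_deg m \<le> d then monomial m * proj (mons n (d - mon_deg m)) p else 0) \<in> I"
            using poly_idealD(2)[OF id] by simp
        qed
        finally show ?thesis .
      qed
      then show ?thesis using p q poly_idealD(4)[OF id] by simp
    qed
  qed
  moreover have "S \<subseteq> ?X"
  proof
    fix f assume f: "f \<in> S"
    then obtain e where "f \<in> forms n e" using S(1) is_form_iff by blast
    then have "proj (mons n d) f = (if d = e then f else 0)" for d
      by (intro poly_mapping_eqI) (auto simp: lookup_proj forms_def mons_def supported_def in_keys_iff)
    moreover have "f \<in> I" using f genideal_poly(2)[OF S_sub] S(2) by blast
    ultimately show "f \<in> ?X" using poly_idealD(2)[OF id] by simp
  qed
  ultimately have "I \<subseteq> ?X" unfolding S(2) by (rule genideal_poly_minimal)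
  then show ?thesis using p by blast
qed

definition degree_part :: "nat \<Rightarrow> (nat, 'k::field_char_0) mpoly set \<Rightarrow> nat \<Rightarrow> (nat, 'k) mpoly set"
  where "degree_part n I d = I \<inter> forms n d"

lemma degree_part_subset: "degree_part n I d \<subseteq> forms n d"
  by (simp add: degree_part_def)

lemma subspace_degree_part: "ideal I (poly_ring n) \<Longrightarrow> vs.subspace (degree_part n I d)"
  using poly_idealD(2,3)[of I n] poly_ideal_scale[of I n]
  unfolding degree_part_def
  by (intro vs.subspace_inter[OF _ subspace_forms]) (simp add: vs.subspace_def)

lemma degree_part_mult:
  "ideal I (poly_ring n) \<Longrightarrow> p \<in> degree_part n I d \<Longrightarrow> q \<in> forms n e \<Longrightarrow> q * p \<in> degree_part n I (e + d)"
  using forms_mult[of q n e p d] poly_idealD(4)[of I n p q] forms_subset_polys_in[of n e]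
  unfolding degree_part_def by blast

text \<open>A change of coordinates preserves degrees.\<close>

lemma proj_coord_change:
  assumes p: "p \<in> polys_in {1..n}"
  shows "proj (mons n d) (coord_change n A p) = coord_change n A (proj (mons n d) p)"
proof -
  have "proj (mons n d) (mon_eval (lin_form n A) m)
      = (if m \<in> mons n d then mon_eval (lin_form n A) m else 0)" if "m \<in> keys p" for m
  proof -
    have "keys m \<subseteq> {1..n}" using p that unfolding polys_in_def by blast
    then have mem: "m \<in> mons n d \<longleftrightarrow> mon_deg m = d" by (simp add: mons_def)
    have ev: "mon_eval (lin_form n A) m \<in> forms n (mon_deg m)"
      by (intro mon_eval_in_forms lin_form_in_forms)
    show ?thesis unfolding mem
      using ev by (intro poly_mapping_eqI)
        (auto simp: lookup_proj forms_def mons_def supported_def in_keys_iff)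
  qed
  then have "proj (mons n d) (coord_change n A p)
      = (\<Sum>m\<in>keys p. if m \<in> mons n d
          then scale (lookup p m) (mon_eval (lin_form n A) m) else 0)"
    unfolding coord_change_expand vsp.linear_sum[OF linear_proj] vsp.linear_scale[OF linear_proj]
    by (intro sum.cong) simp_all
  also have "\<dots> = (\<Sum>m\<in>keys p \<inter> mons n d. scale (lookup p m) (mon_eval (lin_form n A) m))"
    by (simp add: sum.inter_restrict)
  also have "\<dots> = coord_change n A (proj (mons n d) p)"
  proof -
    have "keys (proj (mons n d) p) = keys p \<inter> mons n d"
      by (auto simp: in_keys_iff lookup_proj split: if_splits)
    then show ?thesis unfolding coord_change_expand by (simp add: lookup_proj)
  qed
  finally show ?thesis .
qed

section \<open>Generic initial ideals exist\<close>

text \<open>Every sequence has a monotone subsequence, and a nonincreasing one of natural numbers is eventually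
  constant.\<close>

lemma nondecreasing_subsequence:
  fixes s :: "nat \<Rightarrow> nat"
  shows "\<exists>g :: nat \<Rightarrow> nat. strict_mono g \<and> mono (\<lambda>k. s (g k))"
proof -
  obtain g :: "nat \<Rightarrow> nat" where g: "strict_mono g" "monoseq (\<lambda>k. s (g k))"
    using seq_monosub[of s] by blast
  show ?thesis
  proof (cases "mono (\<lambda>k. s (g k))")
    case False
    then have dec: "s (g k') \<le> s (g k)" if "k \<le> k'" for k k'
      using g(2) that unfolding monoseq_def mono_def by blast
    obtain N where N: "\<forall>k. s (g N) \<le> s (g k)"
      using ex_has_least_nat[of "\<lambda>_. True" 0 "\<lambda>k. s (g k)"] by blast
    have const: "s (g (N + k)) = s (g N)" for k using dec[of N "N + k"] N by (simp add: antisym)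
    then have "mono (\<lambda>k. s (g (N + k)))" by (simp add: mono_def)
    moreover have "strict_mono (\<lambda>k. g (N + k))" using g(1) by (simp add: strict_mono_def)
    ultimately show ?thesis by blast
  qed (use g in blast)
qed

lemma nondecreasing_subsequence_finite:
  fixes f :: "nat \<Rightarrow> 'i \<Rightarrow> nat"
  assumes "finite V"
  shows "\<exists>g :: nat \<Rightarrow> nat. strict_mono g \<and> (\<forall>i\<in>V. mono (\<lambda>k. f (g k) i))"
  using assms
proof (induction V rule: finite_induct)
  case empty
  show ?case by (rule exI[of _ "\<lambda>k. k"]) (simp add: strict_mono_def)
next
  case (insert i V)
  then obtain g :: "nat \<Rightarrow> nat" where g: "strict_mono g" "\<forall>i\<in>V. mono (\<lambda>k. f (g k) i)" by blast
  obtain h :: "nat \<Rightarrow> nat" where h: "strict_mono h" "mono (\<lambda>k. f (g (h k)) i)"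
    using nondecreasing_subsequence[of "\<lambda>k. f (g k) i"] by blast
  have "strict_mono (\<lambda>k. g (h k))" using g(1) h(1) by (simp add: strict_mono_def)
  moreover have "mono (\<lambda>k. f (g (h k)) j)" if "j \<in> V" for j
    using g(2) h(1) that strict_mono_mono[OF h(1)] by (simp add: mono_def)
  ultimately show ?case using h(2) by (intro exI[of _ "\<lambda>k. g (h k)"]) auto
qed

text \<open>Dickson's lemma: a sequence of monomials of growing degree without divisibility relations to
  earlier members would have a subsequence that is nondecreasing in every exponent.\<close>

lemma dickson:
  fixes M :: "(nat \<Rightarrow>\<^sub>0 nat) set"
  assumes M: "\<And>m. m \<in> M \<Longrightarrow> keys m \<subseteq> {1..n}"
  shows "\<exists>D. \<forall>m\<in>M. \<exists>m'\<in>M. mon_deg m' \<le> D \<and> (\<exists>w. keys w \<subseteq> {1..n} \<and> m = w + m')"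
proof (rule ccontr)
  assume "\<not> ?thesis"
  then have "\<forall>D. \<exists>m. m \<in> M \<and> (\<forall>m'\<in>M. mon_deg m' \<le> D \<longrightarrow> \<not> (\<exists>w. keys w \<subseteq> {1..n} \<and> m = w + m'))"
    by blast
  from choice[OF this] obtain f where f: "\<And>D. f D \<in> M"
    "\<And>D m'. m' \<in> M \<Longrightarrow> mon_deg m' \<le> D \<Longrightarrow> \<not> (\<exists>w. keys w \<subseteq> {1..n} \<and> f D = w + m')"
    by blast
  obtain g :: "nat \<Rightarrow> nat" where g: "strict_mono g" "\<forall>i\<in>{1..n}. mono (\<lambda>k. lookup (f (g k)) i)"
    using nondecreasing_subsequence_finite[of "{1..n}" "\<lambda>k. lookup (f k)"] by blast
  define j where "j = mon_deg (f (g 0))"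
  have "mon_deg (f (g 0)) \<le> g j" using strict_mono_imp_increasing[OF g(1), of j] by (simp add: j_def)
  moreover have "f (g j) = (f (g j) - f (g 0)) + f (g 0)"
  proof (rule poly_mapping_eqI)
    fix i
    have "lookup (f (g 0)) i \<le> lookup (f (g j)) i"
    proof (cases "i \<in> {1..n}")
      case True
      then show ?thesis using g(2) by (auto simp: mono_def)
    next
      case False
      then have "i \<notin> keys (f (g 0))" using M[OF f(1)] by blast
      then show ?thesis by (simp add: in_keys_iff)
    qed
    then show "lookup (f (g j)) i = lookup ((f (g j) - f (g 0)) + f (g 0)) i"
      by (simp add: lookup_add lookup_minus)
  qed
  moreover have "keys (f (g j) - f (g 0)) \<subseteq> {1..n}"
  proof
    fix i assume "i \<in> keys (f (g j) - f (g 0))"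
    then have "i \<in> keys (f (g j))" by (simp add: in_keys_iff lookup_minus)
    then show "i \<in> {1..n}" using M[OF f(1)] by blast
  qed
  ultimately show False using f(2)[OF f(1)] by blast
qed

text \<open>On a nonzero projection to an upper set the leading monomial is the same as before projecting.\<close>

lemma leading_proj_upper:
  fixes Y :: "(nat, 'k::field_char_0) mpoly set"
  assumes Y: "Y \<subseteq> forms n d"
    and T: "\<And>m m'. m \<in> T \<Longrightarrow> m' \<in> mons n d \<Longrightarrow> revlex_greater m' m \<Longrightarrow> m' \<in> T"
  shows "leading (proj T ` Y) = leading Y \<inter> T"
proof
  show "leading Y \<inter> T \<subseteq> leading (proj T ` Y)"
  proof
    fix m assume "m \<in> leading Y \<inter> T"
    then obtain p where "p \<in> Y" "is_leading_monomial p m" "m \<in> T" by (auto simp: leading_def)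
    then have "proj T p \<in> proj T ` Y" "is_leading_monomial (proj T p) m"
      by (auto simp: is_leading_monomial_def in_keys_iff lookup_proj split: if_splits)
    then show "m \<in> leading (proj T ` Y)" unfolding leading_def by blast
  qed
  show "leading (proj T ` Y) \<subseteq> leading Y \<inter> T"
  proof
    fix m assume "m \<in> leading (proj T ` Y)"
    then obtain p where p: "p \<in> Y" "is_leading_monomial (proj T p) m" by (auto simp: leading_def)
    have keys: "keys (proj T p) = keys p \<inter> T"
      by (auto simp: in_keys_iff lookup_proj split: if_splits)
    have m: "m \<in> keys p" "m \<in> T" using p(2) keys by (auto simp: is_leading_monomial_def)
    have K: "keys p \<subseteq> mons n d" using p(1) Y by (auto simp: forms_def supported_def)
    have "revlex_greater m m'" if m': "m' \<in> keys p" "m' \<noteq> m" for m'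
    proof (cases "m' \<in> T")
      case True
      then show ?thesis using p(2) m' keys by (auto simp: is_leading_monomial_def)
    next
      case False
      then have "\<not> revlex_greater m' m" using T[OF m(2), of m'] K m'(1) by blast
      moreover have "mon_deg m = mon_deg m'" using K m(1) m'(1) by (auto simp: mons_def)
      ultimately show ?thesis using revlex_total[of m m'] m'(2) by blast
    qed
    then have "is_leading_monomial p m" using m(1) by (simp add: is_leading_monomial_def)
    then show "m \<in> leading Y \<inter> T" using p(1) m(2) unfolding leading_def by blast
  qed
qed

text \<open>A monomial \<open>m\<close> is leading exactly if the projection to the monomials from \<open>m\<close> upwards has larger
  dimension than the projection to those strictly above \<open>m\<close>, and maximal dimensions agree.\<close>

lemma max_rank_leading_eq:
  fixes U :: "(nat, 'k::field_char_0) mpoly set"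
  assumes U: "vs.subspace U" "U \<subseteq> forms n d"
    and A: "A \<in> GL n" "max_rank n U A" and B: "B \<in> GL n" "max_rank n U B"
  shows "leading (coord_change n A ` U) = leading (coord_change n B ` U)"
proof -
  let ?Y = "\<lambda>A. coord_change n A ` U"
  have card_eq: "card (leading (?Y A) \<inter> T) = card (leading (?Y B) \<inter> T)"
    if T: "\<And>m m'. m \<in> T \<Longrightarrow> m' \<in> mons n d \<Longrightarrow> revlex_greater m' m \<Longrightarrow> m' \<in> T" for T
  proof -
    have "card (leading (?Y C) \<inter> T) = vs.dim (proj T ` ?Y C)" for C
    proof -
      note Y = coord_change_image[OF U, of C]
      have "proj T ` ?Y C \<subseteq> forms n d" using Y(2) proj_in_forms by blast
      moreover have "vs.subspace (proj T ` ?Y C)" by (rule vsp.linear_subspace_image[OF linear_proj Y(1)])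
      ultimately have "card (leading (proj T ` ?Y C)) = vs.dim (proj T ` ?Y C)"
        by (intro card_leading)
      moreover have "leading (proj T ` ?Y C) = leading (?Y C) \<inter> T"
        by (rule leading_proj_upper[OF Y(2)]) (rule T)
      ultimately show ?thesis by simp
    qed
    then show ?thesis using A B unfolding max_rank_def by (simp add: antisym)
  qed
  have fin: "finite (leading (?Y C))" for C
    using leading_subset_mons[OF coord_change_image(2)[OF U]] finite_mons finite_subset by blast
  have "m \<in> leading (?Y A) \<longleftrightarrow> m \<in> leading (?Y B)" if m: "m \<in> mons n d" for m
  proof -
    let ?T = "{m'. revlex_greater m' m}"
    have "card (leading (?Y A) \<inter> ?T) = card (leading (?Y B) \<inter> ?T)"
      by (rule card_eq) (use revlex_trans in blast)
    moreover have "card (leading (?Y A) \<inter> insert m ?T) = card (leading (?Y B) \<inter> insert m ?T)"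
      by (rule card_eq) (use revlex_trans in blast)
    moreover have "card (leading (?Y C) \<inter> insert m ?T)
        = (if m \<in> leading (?Y C) then Suc (card (leading (?Y C) \<inter> ?T)) else card (leading (?Y C) \<inter> ?T))" for C
      using fin[of C] revlex_irrefl[of m] by (simp add: Int_insert_right)
    ultimately show ?thesis by (simp split: if_splits)
  qed
  then show ?thesis
    using leading_subset_mons[OF coord_change_image(2)[OF U, of A]]
      leading_subset_mons[OF coord_change_image(2)[OF U, of B]] by blast
qed

text \<open>The polynomials supported on \<open>M\<close> form an ideal.\<close>

lemma mem_monomial_ideal:
  assumes M: "\<And>m. m \<in> M \<Longrightarrow> keys m \<subseteq> {1..n}"
    and closed: "\<And>m w. m \<in> M \<Longrightarrow> keys w \<subseteq> {1..n} \<Longrightarrow> w + m \<in> M"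
  shows "(monomial m :: (nat, 'k::field_char_0) mpoly) \<in> genideal (poly_ring n) {monomial m |m. m \<in> M}
    \<longleftrightarrow> m \<in> M"
proof
  let ?S = "{monomial m |m. m \<in> M} :: (nat, 'k) mpoly set"
  have sub: "?S \<subseteq> polys_in {1..n}"
  proof clarify
    fix m assume "m \<in> M"
    then show "(monomial m :: (nat, 'k) mpoly) \<in> polys_in {1..n}" by (intro monomial_in_polys_in M)
  qed
  show "monomial m \<in> genideal (poly_ring n) ?S" if "m \<in> M"
  proof -
    have "monomial m \<in> ?S" using that by blast
    then show ?thesis using genideal_poly(2)[OF sub] by (rule set_mp[rotated])
  qed
  let ?X = "{p \<in> polys_in {1..n}. keys p \<subseteq> M} :: (nat, 'k) mpoly set"
  have "ideal ?X (poly_ring n)"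
  proof (rule poly_idealI)
    show "p + q \<in> ?X" if "p \<in> ?X" "q \<in> ?X" for p q
      using that polys_in_add[of p "{1..n}" q] Poly_Mapping.keys_add[of p q] by blast
    show "q * p \<in> ?X" if p: "p \<in> ?X" and q: "q \<in> polys_in {1..n}" for p q
    proof -
      have "k \<in> M" if k: "k \<in> keys (q * p)" for k
      proof -
        obtain u w where uw: "u \<in> keys q" "w \<in> keys p" "k = u + w"
          using k keys_mult[of q p] by blast
        then have "keys u \<subseteq> {1..n}" "w \<in> M" using p q unfolding polys_in_def by blast+
        then show ?thesis using closed uw(3) by blast
      qed
      then show ?thesis using polys_in_mult[OF q, of p] p by blast
    qed
  qed (auto simp: polys_in_def)
  moreover have "?S \<subseteq> ?X"
  proof clarify
    fix m assume m: "m \<in> M"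
    have "(monomial m :: (nat, 'k) mpoly) \<in> polys_in {1..n}" using m by (intro monomial_in_polys_in M)
    then show "(monomial m :: (nat, 'k) mpoly) \<in> polys_in {1..n} \<and> keys (monomial m :: (nat, 'k) mpoly) \<subseteq> M"
      using m by (simp add: monomial_def)
  qed
  ultimately have gen: "genideal (poly_ring n) ?S \<subseteq> ?X" by (rule genideal_poly_minimal)
  show "m \<in> M" if "(monomial m :: (nat, 'k) mpoly) \<in> genideal (poly_ring n) ?S"
  proof -
    have "(monomial m :: (nat, 'k) mpoly) \<in> ?X" using gen that by (rule set_mp)
    then show ?thesis by (simp add: monomial_def)
  qed
qed

abbreviation leading_part :: "nat \<Rightarrow> (nat, 'k::field_char_0) mpoly set \<Rightarrow> 'k mat \<Rightarrow> nat \<Rightarrow> (nat \<Rightarrow>\<^sub>0 nat) set"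
  where "leading_part n I A d \<equiv> leading (coord_change n A ` degree_part n I d)"

lemma leading_part_subset: "leading_part n I A d \<subseteq> mons n d"
  using degree_part_subset coord_change_in_forms by (intro leading_subset_mons) blast

text \<open>Multiplication by a monomial in the new coordinates is multiplication by a form in the old ones.\<close>

lemma leading_part_closed:
  fixes I :: "(nat, 'k::field_char_0) mpoly set"
  assumes I: "ideal I (poly_ring n)" and A: "A \<in> GL n"
    and m: "m \<in> leading_part n I A d" and w: "w \<in> mons n e"
  shows "w + m \<in> leading_part n I A (e + d)"
proof -
  obtain p where p: "p \<in> degree_part n I d" "is_leading_monomial (coord_change n A p) m"
    using m by (auto simp: leading_def)
  obtain B where B: "B \<in> GL n" "A * B = 1\<^sub>m n" using GL_inverse[OF A] by metis
  let ?q = "coord_change n B (monomial w)"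
  have q: "?q \<in> forms n e" by (intro coord_change_in_forms monomial_in_forms w)
  have "monomial w \<in> polys_in {1..n}" using monomial_in_forms[OF w] forms_subset_polys_in by blast
  then have "coord_change n A ?q = monomial w"
    using coord_change_inverse[of B n A] A B by (simp add: GL_def)
  then have "is_leading_monomial (coord_change n A (?q * p)) (w + m)"
    using leading_monomial_mult[OF p(2)] by (simp add: coord_change_mult)
  then show ?thesis using degree_part_mult[OF I p(1) q] unfolding leading_def by blast
qed

lemma initial_ideal_eq:
  fixes I :: "(nat, 'k::field_char_0) mpoly set"
  assumes I: "homogeneous_ideal n I"
  shows "initial_ideal n (coord_change n A ` I)
    = genideal (poly_ring n) {monomial m |m. m \<in> (\<Union>d. leading_part n I A d)}"
proof -
  have id: "ideal I (poly_ring n)" using I by (simp add: homogeneous_ideal_def)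
  have "(\<exists>f\<in>coord_change n A ` I. (\<exists>d. is_form n d f) \<and> is_leading_monomial f m)
      \<longleftrightarrow> m \<in> (\<Union>d. leading_part n I A d)" for m
  proof
    assume "\<exists>f\<in>coord_change n A ` I. (\<exists>d. is_form n d f) \<and> is_leading_monomial f m"
    then obtain p d where p: "p \<in> I" "coord_change n A p \<in> forms n d"
      "is_leading_monomial (coord_change n A p) m"
      by (auto simp: is_form_iff)
    let ?q = "proj (mons n d) p"
    have "?q \<in> forms n d" unfolding forms_def by (intro supportedI) (simp add: lookup_proj)
    then have "?q \<in> degree_part n I d"
      using homogeneous_component[OF I p(1)] by (simp add: degree_part_def)
    moreover have "coord_change n A ?q = coord_change n A p"
    proof -
      have "proj (mons n d) (coord_change n A p) = coord_change n A p"
        using p(2) by (intro poly_mapping_eqI) (simp add: lookup_proj forms_def supportedD)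
      moreover have "p \<in> polys_in {1..n}" using p(1) poly_idealD(1)[OF id] by blast
      ultimately show ?thesis using proj_coord_change by metis
    qed
    ultimately have "m \<in> leading_part n I A d" using p(3) unfolding leading_def by (metis (mono_tags, lifting) imageI mem_Collect_eq)
    then show "m \<in> (\<Union>d. leading_part n I A d)" by blast
  next
    assume "m \<in> (\<Union>d. leading_part n I A d)"
    then obtain d p where p: "p \<in> degree_part n I d" "is_leading_monomial (coord_change n A p) m"
      by (auto simp: leading_def)
    then have "coord_change n A p \<noteq> 0" by (auto simp: is_leading_monomial_def)
    moreover have "coord_change n A p \<in> forms n d"
      using p(1) degree_part_subset coord_change_in_forms by blast
    ultimately have "is_form n d (coord_change n A p)" by (simp add: is_form_iff)
    then show "\<exists>f\<in>coord_change n A ` I. (\<exists>d. is_form n d f) \<and> is_leading_monomial f m"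
      using p unfolding degree_part_def by blast
  qed
  then show ?thesis unfolding initial_ideal_def by simp
qed

text \<open>The leading monomials of all degrees together are closed under multiplication by monomials, so the
  ideal that they generate contains no further monomials.\<close>

lemma monomial_in_initial_ideal:
  fixes I :: "(nat, 'k::field_char_0) mpoly set"
  assumes I: "homogeneous_ideal n I" and A: "A \<in> GL n"
  shows "monomial m \<in> initial_ideal n (coord_change n A ` I) \<longleftrightarrow> m \<in> leading_part n I A (mon_deg m)"
proof -
  have id: "ideal I (poly_ring n)" using I by (simp add: homogeneous_ideal_def)
  let ?M = "\<Union>d. leading_part n I A d"
  have deg: "m \<in> mons n d" if "m \<in> leading_part n I A d" for m d
    using that leading_part_subset by blast
  have "monomial m \<in> initial_ideal n (coord_change n A ` I) \<longleftrightarrow> m \<in> ?M"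
    unfolding initial_ideal_eq[OF I]
  proof (rule mem_monomial_ideal)
    show "keys m \<subseteq> {1..n}" if "m \<in> ?M" for m
      using that deg by (auto simp: mons_def)
    show "w + m \<in> ?M" if mw: "m \<in> ?M" "keys w \<subseteq> {1..n}" for m w
    proof -
      obtain d where "m \<in> leading_part n I A d" using mw(1) by blast
      moreover have "w \<in> mons n (mon_deg w)" using mw(2) by (simp add: mons_def)
      ultimately show ?thesis using leading_part_closed[OF id A] by blast
    qed
  qed
  also have "\<dots> \<longleftrightarrow> m \<in> leading_part n I A (mon_deg m)"
    using deg by (auto simp: mons_def)
  finally show ?thesis .
qed

text \<open>Degree by degree the leading monomials are generically constant; by Dickson's lemma finitely
  many degrees generate all of them, and equality of dimensions does the rest.\<close>

lemma generic_initial_ideal_exists: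
  fixes I :: "(nat, 'k::field_char_0) mpoly set"
  assumes I: "homogeneous_ideal n I"
  shows "\<exists>J. generically n (\<lambda>A. initial_ideal n (coord_change n A ` I) = J)"
proof -
  have id: "ideal I (poly_ring n)" using I by (simp add: homogeneous_ideal_def)
  note part = subspace_degree_part[OF id] degree_part_subset[of n I]
  have gen: "generically n (max_rank n (degree_part n I d))" for d
    using generically_max_rank[OF part] .
  have "\<forall>d. \<exists>A. A \<in> GL n \<and> max_rank n (degree_part n I d) A" using generically_ex[OF gen] by blast
  from choice[OF this] obtain B where B: "\<And>d. B d \<in> GL n" "\<And>d. max_rank n (degree_part n I d) (B d)"
    by blast
  define L where "L d = leading_part n I (B d) d" for d
  have L_eq: "leading_part n I A d = L d" if "A \<in> GL n" "max_rank n (degree_part n I d) A" for A d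
    unfolding L_def using max_rank_leading_eq[OF part that B(1) B(2)] .
  have L_mons: "L d \<subseteq> mons n d" for d unfolding L_def by (rule leading_part_subset)
  have L_closed: "w + m \<in> L (e + d)" if "m \<in> L d" "w \<in> mons n e" for m w d e
  proof -
    obtain A where "A \<in> GL n" "max_rank n (degree_part n I d) A" "max_rank n (degree_part n I (e + d)) A"
      using generically_ex[OF generically_conj[OF gen[of d] gen[of "e + d"]]] by blast
    then show ?thesis using leading_part_closed[OF id, of A m d w e] that L_eq by simp
  qed
  have card_L: "card (leading_part n I A d) = card (L d)" if "A \<in> GL n" for A d
    unfolding L_def card_leading[OF coord_change_image[OF part]]
    by (simp add: dim_coord_change[OF that part] dim_coord_change[OF B(1) part])
  have "\<exists>D. \<forall>m\<in>(\<Union>d. L d). \<exists>m'\<in>(\<Union>d. L d). mon_deg m' \<le> D \<and> (\<exists>w. keys w \<subseteq> {1..n} \<and> m = w + m')"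
    by (rule dickson) (use L_mons in \<open>auto simp: mons_def\<close>)
  then obtain D where D: "\<And>m. m \<in> (\<Union>d. L d) \<Longrightarrow>
      \<exists>m'\<in>(\<Union>d. L d). mon_deg m' \<le> D \<and> (\<exists>w. keys w \<subseteq> {1..n} \<and> m = w + m')"
    by blast
  have const: "leading_part n I A d = L d"
    if A: "A \<in> GL n" "\<forall>e\<in>{..D}. max_rank n (degree_part n I e) A" for A d
  proof -
    have "L d \<subseteq> leading_part n I A d"
    proof
      fix m assume m: "m \<in> L d"
      then obtain m' e w where w: "m' \<in> L e" "mon_deg m' \<le> D" "keys w \<subseteq> {1..n}" "m = w + m'"
        using D by blast
      have deg: "mon_deg m' = e" "mon_deg m = d" using w(1) m L_mons by (auto simp: mons_def)
      then have "m' \<in> leading_part n I A e" using L_eq[OF A(1)] A(2) w(1,2) by simp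
      moreover have "w \<in> mons n (mon_deg w)" using w(3) by (simp add: mons_def)
      ultimately have "w + m' \<in> leading_part n I A (mon_deg w + e)" by (rule leading_part_closed[OF id A(1)])
      then show "m \<in> leading_part n I A d" using w(4) deg by simp
    qed
    moreover have "finite (leading_part n I A d)"
      using leading_part_subset finite_mons by (rule finite_subset)
    ultimately show ?thesis using card_L[OF A(1), of d] card_subset_eq by metis
  qed
  have "generically n (\<lambda>A. \<forall>e\<in>{..D}. max_rank n (degree_part n I e) A)"
    by (rule generically_ball[OF _ gen]) simp
  then have "generically n (\<lambda>A. initial_ideal n (coord_change n A ` I)
      = genideal (poly_ring n) {monomial m |m. m \<in> (\<Union>d. L d)})"
  proof (rule generically_mono)
    fix A :: "'k mat" assume "A \<in> GL n" "\<forall>e\<in>{..D}. max_rank n (degree_part n I e) A"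
    then have "leading_part n I A d = L d" for d by (rule const)
    then show "initial_ideal n (coord_change n A ` I)
      = genideal (poly_ring n) {monomial m |m. m \<in> (\<Union>d. L d)}"
      unfolding initial_ideal_eq[OF I] by simp
  qed
  then show ?thesis by blast
qed

text \<open>Two nonempty open sets of matrices meet, which makes the generic value unique.\<close>

lemma generically_gin:
  fixes I :: "(nat, 'k::field_char_0) mpoly set"
  assumes I: "homogeneous_ideal n I"
  shows "generically n (\<lambda>A. initial_ideal n (coord_change n A ` I) = gin n I)"
proof -
  obtain J where J: "generically n (\<lambda>A. initial_ideal n (coord_change n A ` I) = J)"
    using generic_initial_ideal_exists[OF I] by blast
  have open_generic: "generically n Q" if U: "zariski_open n U" "U \<noteq> {}" "\<forall>A\<in>U. Q A"
    for U and Q :: "'k mat \<Rightarrow> bool"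
  proof -
    obtain F where F: "F \<subseteq> polys_in ({0..<n} \<times> {0..<n})"
      "U = {A \<in> GL n. \<exists>P\<in>F. poly_subst id (\<lambda>ij. A $$ ij) P \<noteq> 0}"
      using U(1) unfolding zariski_open_def by blast
    obtain A P where A: "A \<in> GL n" "P \<in> F" "poly_subst id (\<lambda>ij. A $$ ij) P \<noteq> 0"
      using U(2) F(2) by blast
    let ?\<delta> = "\<lambda>A :: 'k mat. poly_subst id (\<lambda>ij. A $$ ij) P"
    have "?\<delta> \<in> mat_poly_funs n"
      using F(1) A(2) unfolding mat_poly_funs_def by blast
    moreover have "\<forall>A\<in>GL n. ?\<delta> A \<noteq> 0 \<longrightarrow> Q A" using F(2) U(3) A(2) by blast
    moreover have "\<exists>A\<in>GL n. ?\<delta> A \<noteq> 0" using A(1,3) by blast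
    ultimately show ?thesis unfolding generically_def by (intro bexI[of _ ?\<delta>]) simp_all
  qed
  have "gin n I = J" unfolding gin_def
  proof (rule the_equality)
    obtain \<delta> A where \<delta>: "\<delta> \<in> mat_poly_funs n" "A \<in> GL n" "\<delta> A \<noteq> 0"
      "\<forall>A\<in>GL n. \<delta> A \<noteq> 0 \<longrightarrow> initial_ideal n (coord_change n A ` I) = J"
      using J unfolding generically_def by blast
    then obtain P where P: "P \<in> polys_in ({0..<n} \<times> {0..<n})" "\<delta> = (\<lambda>A. poly_subst id (\<lambda>ij. A $$ ij) P)"
      unfolding mat_poly_funs_def by blast
    let ?U = "{A \<in> GL n. \<exists>P\<in>{P}. poly_subst id (\<lambda>ij. A $$ ij) P \<noteq> 0}"
    have "zariski_open n ?U" unfolding zariski_open_def using P(1) by blast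
    moreover have "?U \<noteq> {}" "\<forall>A\<in>?U. initial_ideal n (coord_change n A ` I) = J"
      using \<delta> P(2) by auto
    ultimately show "\<exists>U. zariski_open n U \<and> U \<noteq> {} \<and> (\<forall>A\<in>U. initial_ideal n (coord_change n A ` I) = J)"
      by blast
  next
    fix J' assume "\<exists>U. zariski_open n U \<and> U \<noteq> {} \<and> (\<forall>A\<in>U. initial_ideal n (coord_change n A ` I) = J')"
    then have "generically n (\<lambda>A. initial_ideal n (coord_change n A ` I) = J')"
      using open_generic[of _ "\<lambda>A. initial_ideal n (coord_change n A ` I) = J'"] by blast
    then have "\<exists>A\<in>GL n. initial_ideal n (coord_change n A ` I) = J \<and> initial_ideal n (coord_change n A ` I) = J'"
      by (rule generically_ex[OF generically_conj[OF J]])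
    then show "J' = J" by blast
  qed
  then show ?thesis using J by simp
qed

section \<open>Slices by the exponents of the variables after the second\<close>

definition below :: "(nat \<Rightarrow>\<^sub>0 nat) \<Rightarrow> (nat \<Rightarrow>\<^sub>0 nat) \<Rightarrow> bool"
  where "below c m \<longleftrightarrow> (\<exists>i\<ge>3. lookup c i < lookup m i \<and>
    (\<forall>j>i. lookup m j = lookup c j))"

definition slice :: "(nat \<Rightarrow>\<^sub>0 nat) \<Rightarrow> nat \<Rightarrow> (nat, 'k::field_char_0) mpoly set \<Rightarrow> (nat, 'k) mpoly set"
  where "slice c x Y = {g \<in> forms 2 x. \<exists>q. monomial c * g + q \<in> Y \<and> (\<forall>m\<in>keys q. below c m)}"

lemma slice_subset: "slice c x Y \<subseteq> forms 2 x"
  by (auto simp: slice_def)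

lemma keys_scale_subset: "keys (scale a p) \<subseteq> keys p"
  by (auto simp: in_keys_iff)

lemma mult_scale: "p * scale a q = scale a (p * q)" for p q :: "('i, 'k::field_char_0) mpoly"
  by (simp add: scale_conv_mult ac_simps)

lemma subspace_slice:
  assumes Y: "vs.subspace Y"
  shows "vs.subspace (slice c x Y)"
proof (rule vs.subspaceI)
  show "0 \<in> slice c x Y"
    using vs.subspace_0[OF Y] vs.subspace_0[OF subspace_forms[of 2 x]]
    by (auto simp: slice_def intro!: exI[of _ 0])
next
  fix g h assume "g \<in> slice c x Y" "h \<in> slice c x Y"
  then obtain p q where g: "g \<in> forms 2 x" "monomial c * g + p \<in> Y" "\<forall>m\<in>keys p. below c m"
    and h: "h \<in> forms 2 x" "monomial c * h + q \<in> Y" "\<forall>m\<in>keys q. below c m"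
    unfolding slice_def by blast
  have "monomial c * (g + h) + (p + q) \<in> Y"
    using vs.subspace_add[OF Y g(2) h(2)] by (simp add: algebra_simps)
  moreover have "\<forall>m\<in>keys (p + q). below c m"
    using g(3) h(3) Poly_Mapping.keys_add[of p q] by blast
  ultimately show "g + h \<in> slice c x Y"
    using vs.subspace_add[OF subspace_forms g(1) h(1)] unfolding slice_def by blast
next
  fix a g assume "g \<in> slice c x Y"
  then obtain p where g: "g \<in> forms 2 x" "monomial c * g + p \<in> Y" "\<forall>m\<in>keys p. below c m"
    unfolding slice_def by blast
  have "monomial c * scale a g + scale a p \<in> Y"
    using vs.subspace_scale[OF Y g(2), of a] by (simp add: mult_scale vs.scale_right_distrib)
  moreover have "\<forall>m\<in>keys (scale a p). below c m"
    using g(3) keys_scale_subset[of a p] by blast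
  ultimately show "scale a g \<in> slice c x Y"
    using vs.subspace_scale[OF subspace_forms g(1)] unfolding slice_def by blast
qed

lemma monomial_factor:
  fixes p :: "('i, 'k::field_char_0) mpoly"
  assumes "\<And>k. k \<in> keys p \<Longrightarrow> \<exists>k'. k = c + k'"
  shows "\<exists>g. p = monomial c * g"
proof -
  have "\<forall>k\<in>keys p. \<exists>k'. k = c + k'" using assms by blast
  from bchoice[OF this] obtain f where f: "\<forall>k\<in>keys p. k = c + f k" ..
  have "p = (\<Sum>k\<in>keys p. scale (lookup p k) (monomial k))"
    by (rule sum_scale_monomials)
  also have "\<dots> = (\<Sum>k\<in>keys p. monomial c * scale (lookup p k) (monomial (f k)))"
  proof (rule sum.cong[OF refl])
    fix k assume "k \<in> keys p"
    then have "(monomial k :: ('i, 'k) mpoly) = monomial c * monomial (f k)"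
      using f monomial_add by metis
    then show "scale (lookup p k) (monomial k)
        = monomial c * scale (lookup p k) (monomial (f k))"
      by (simp add: mult_scale)
  qed
  finally show ?thesis by (auto simp: sum_distrib_left[symmetric])
qed

lemma lookup_tail_zero: "m \<in> mons 2 x \<Longrightarrow> 3 \<le> i \<Longrightarrow> lookup m i = 0"
proof -
  assume "m \<in> mons 2 x" "3 \<le> i"
  then have "i \<notin> keys m" unfolding mons_def by fastforce
  then show ?thesis by (simp add: in_keys_iff)
qed

lemma not_below_self_tail: "m \<in> mons 2 x \<Longrightarrow> \<not> below c (c + m)"
  by (auto simp: below_def lookup_add lookup_tail_zero)

text \<open>In revlex the exponents of the later variables decide first, so the leading monomials of a
  space with given such exponents are those of the corresponding slice.\<close>

lemma leading_slice:
  fixes Y :: "(nat, 'k::field_char_0) mpoly set"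
  assumes Y: "Y \<subseteq> forms n d" and c: "keys c \<subseteq> {3..n}" and d: "mon_deg c + x = d"
    and m: "m \<in> mons 2 x"
  shows "c + m \<in> leading Y \<longleftrightarrow> m \<in> leading (slice c x Y)"
proof
  assume "c + m \<in> leading Y"
  then obtain p where p: "p \<in> Y" "is_leading_monomial p (c + m)" by (auto simp: leading_def)
  have K: "keys p \<subseteq> mons n d" using p(1) Y by (auto simp: forms_def supported_def)
  let ?T = "{k. \<forall>i\<ge>3. lookup k i = lookup c i}"
  have keysT: "keys (proj ?T p) = keys p \<inter> ?T"
    by (auto simp: in_keys_iff lookup_proj split: if_splits)
  have c0: "lookup c i = 0" if "i < 3" for i
  proof -
    have "i \<notin> keys c" using c that by auto
    then show ?thesis by (simp add: in_keys_iff)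
  qed
  have decomp: "k = c + (k - c) \<and> k - c \<in> mons 2 x" if k: "k \<in> keys p \<inter> ?T" for k
  proof
    have le: "lookup c i \<le> lookup k i" for i
      using k c0[of i] by (cases "i < 3") auto
    show eq: "k = c + (k - c)"
      by (rule poly_mapping_eqI) (simp add: lookup_add lookup_minus le)
    have "i \<in> {1..2}" if i: "i \<in> keys (k - c)" for i
    proof -
      have nz: "lookup k i - lookup c i \<noteq> 0"
        using i by (simp add: in_keys_iff lookup_minus)
      then have "i < 3" using k by (cases "i < 3") auto
      moreover have "i \<in> keys k" using nz by (auto simp: in_keys_iff)
      then have "i \<in> {1..n}" using k K unfolding mons_def by blast
      then have "1 \<le> i" by simp
      ultimately show ?thesis by auto
    qed
    moreover have "mon_deg k = d" using k K by (auto simp: mons_def)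
    then have "mon_deg (k - c) = x" using arg_cong[OF eq, of mon_deg] d by simp
    ultimately show "k - c \<in> mons 2 x" unfolding mons_def by blast
  qed
  have "\<exists>k'. k = c + k'" if "k \<in> keys (proj ?T p)" for k
    using decomp[of k] that unfolding keysT by blast
  from monomial_factor[OF this] obtain g where g: "proj ?T p = monomial c * g" ..
  have keys_g: "k \<in> keys g \<longleftrightarrow> c + k \<in> keys p \<inter> ?T" for k
    unfolding keysT[symmetric] g keys_monomial_mult by auto
  have g_forms: "g \<in> forms 2 x"
    unfolding forms_def supported_def
  proof clarify
    fix k assume "k \<in> keys g"
    then have "c + k - c \<in> mons 2 x" using decomp[of "c + k"] keys_g by blast
    then show "k \<in> mons 2 x" by simp
  qed
  have in_T: "c + m \<in> ?T" by (simp add: lookup_add lookup_tail_zero[OF m])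
  have lead: "is_leading_monomial g m"
    unfolding is_leading_monomial_def
  proof (intro conjI ballI impI)
    show "m \<in> keys g" using p(2) in_T by (simp add: keys_g is_leading_monomial_def)
    fix k assume k: "k \<in> keys g" "k \<noteq> m"
    then have "c + k \<in> keys p" "c + k \<noteq> c + m" by (auto simp: keys_g)
    then show "revlex_greater m k" using p(2) revlex_add_iff by (auto simp: is_leading_monomial_def)
  qed
  define q where "q = p - monomial c * g"
  have "below c k" if k: "k \<in> keys q" for k
  proof -
    have "q = proj (- ?T) p" unfolding q_def g[symmetric]
      by (rule poly_mapping_eqI) (auto simp: lookup_proj lookup_minus)
    then have kp: "k \<in> keys p" "k \<notin> ?T"
      using k by (auto simp: in_keys_iff lookup_proj split: if_splits)
    then have "revlex_greater (c + m) k" using p(2) in_T by (auto simp: is_leading_monomial_def)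
    then obtain i where i: "lookup (c + m) i < lookup k i"
      "\<forall>j>i. lookup (c + m) j = lookup k j"
      unfolding revlex_greater_def by blast
    have "3 \<le> i"
    proof (rule ccontr)
      assume "\<not> 3 \<le> i"
      then have "lookup k j = lookup c j" if "3 \<le> j" for j
        using i(2)[rule_format, of j] that by (simp add: lookup_add lookup_tail_zero[OF m])
      then show False using kp(2) by blast
    qed
    then show ?thesis using i unfolding below_def
      by (intro exI[of _ i]) (auto simp: lookup_add lookup_tail_zero[OF m])
  qed
  moreover have "monomial c * g + q \<in> Y" using p(1) by (simp add: q_def)
  ultimately have "g \<in> slice c x Y" using g_forms unfolding slice_def by blast
  then show "m \<in> leading (slice c x Y)" using lead unfolding leading_def by blast
next
  assume "m \<in> leading (slice c x Y)"
  then obtain g q where g: "is_leading_monomial g m" "g \<in> forms 2 x" "monomial c * g + q \<in> Y"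
    "\<forall>k\<in>keys q. below c k"
    unfolding leading_def slice_def by blast
  let ?p = "monomial c * g + q"
  have K: "keys ?p \<subseteq> mons n d" using g(3) Y by (auto simp: forms_def supported_def)
  have "c + m \<notin> keys q" using g(4) not_below_self_tail[OF m] by blast
  then have cm: "c + m \<in> keys ?p"
    using g(1) by (simp add: is_leading_monomial_def in_keys_iff lookup_add)
  have "revlex_greater (c + m) k" if k: "k \<in> keys ?p" "k \<noteq> c + m" for k
  proof (cases "k \<in> keys q")
    case True
    then obtain i where "3 \<le> i" "lookup c i < lookup k i"
      "\<forall>j>i. lookup k j = lookup c j"
      using g(4) unfolding below_def by blast
    moreover have "c + m \<in> mons n d" "k \<in> mons n d" using K k(1) cm by blast+
    then have "mon_deg (c + m) = mon_deg k" unfolding mons_def by simp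
    ultimately show ?thesis unfolding revlex_greater_def
      by (auto simp: lookup_add lookup_tail_zero[OF m] intro!: exI[of _ i])
  next
    case False
    then have "k \<in> keys (monomial c * g)" using k(1) Poly_Mapping.keys_add[of "monomial c * g" q] by blast
    then obtain k' where "k' \<in> keys g" "k = c + k'" by (auto simp: keys_monomial_mult)
    then show ?thesis using g(1) k(2) by (auto simp: is_leading_monomial_def revlex_add_iff)
  qed
  then have "is_leading_monomial ?p (c + m)" using cm by (auto simp: is_leading_monomial_def)
  then show "c + m \<in> leading Y" using g(3) unfolding leading_def by blast
qed

section \<open>Slices and multiplication by the first two variables\<close>

text \<open>If the derivative at a kernel vector were not in the image at 0, the vectors of the family over a
  basis of this image, together with the divided difference at the kernel vector, would be independent at
  0, hence at some nonzero parameter, where they would exceed the largest rank.\<close>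

lemma constant_rank_derivative:
  fixes L :: "'k::field_char_0 \<Rightarrow> (nat, 'k) mpoly \<Rightarrow> (nat, 'k) mpoly"
  assumes U: "vs.subspace U" "vs.fin_span U" and lin: "\<And>s. linear_map (L s)"
    and expand: "\<And>u. u \<in> U \<Longrightarrow> \<exists>R. coeff_family line_poly_funs R \<and>
      (\<forall>s. L s u = L 0 u + scale s (DL u) + scale (s * s) (R s))"
    and rank: "\<And>s. vs.dim (L s ` U) \<le> vs.dim (L 0 ` U)"
    and u0: "u0 \<in> U" "L 0 u0 = 0"
  shows "DL u0 \<in> L 0 ` U"
proof (rule ccontr)
  assume notin: "DL u0 \<notin> L 0 ` U"
  note alg = function_algebra_line_poly_funs
  have fin: "vs.fin_span (L s ` U)" for s using vsp.dim_image_le_finite[OF lin U(2)] by blast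
  have sub: "vs.subspace (L s ` U)" for s by (rule vsp.linear_subspace_image[OF lin U(1)])
  obtain B where B: "finite B" "B \<subseteq> L 0 ` U" "vs.independent B" "L 0 ` U \<subseteq> vs.span B" "card B = vs.dim (L 0 ` U)"
    using vs.fin_span_basis[OF fin] .
  define N where "N = card B"
  obtain f where f: "bij_betw f {..<N} B"
    using ex_bij_betw_nat_finite[OF B(1)] by (auto simp: N_def lessThan_atLeast0)
  have "\<forall>i\<in>{..<N}. \<exists>w. w \<in> U \<and> L 0 w = f i"
  proof
    fix i assume "i \<in> {..<N}"
    then have "f i \<in> L 0 ` U" using f B(2) unfolding bij_betw_def by blast
    then show "\<exists>w. w \<in> U \<and> L 0 w = f i" by auto
  qed
  from bchoice[OF this] obtain w where w: "\<forall>i\<in>{..<N}. w i \<in> U \<and> L 0 (w i) = f i" ..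
  obtain R where R: "coeff_family line_poly_funs R"
    "\<And>s. L s u0 = L 0 u0 + scale s (DL u0) + scale (s * s) (R s)"
    using expand[OF u0(1)] by blast
  have fam: "coeff_family line_poly_funs (\<lambda>s. L s u)" if u: "u \<in> U" for u
  proof -
    obtain R v where R: "coeff_family line_poly_funs R"
      "\<And>s. L s u = v + scale s (DL u) + scale (s * s) (R s)"
      using expand[OF u] by blast
    show ?thesis unfolding R(2)
      by (intro coeff_family_add[OF alg] coeff_family_const[OF alg] coeff_family_scale[OF alg]
          function_algebra_mult[OF alg] ident_in_line_poly_funs R(1))
  qed
  \<comment> \<open>For a nonzero parameter the last vector is the quotient of the value at the kernel vector by the parameter.\<close>
  define z where "z i s = (if i < N then L s (w i) else DL u0 + scale s (R s))" for i s
  have z_fam: "coeff_family line_poly_funs (z i)" for i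
  proof (cases "i < N")
    case True
    then have "z i = (\<lambda>s. L s (w i))" by (simp add: z_def fun_eq_iff)
    then show ?thesis using fam[of "w i"] w True by simp
  next
    case False
    then have "z i = (\<lambda>s. DL u0 + scale s (R s))" by (simp add: z_def fun_eq_iff)
    then show ?thesis
      using coeff_family_add[OF alg coeff_family_const[OF alg]
          coeff_family_scale[OF alg ident_in_line_poly_funs R(1)]] by simp
  qed
  have "\<forall>i. \<exists>X. finite X \<and> (\<forall>s. keys (z i s) \<subseteq> X)"
    using z_fam unfolding coeff_family_def by blast
  from choice[OF this] obtain X where X: "\<And>i. finite (X i)" "\<And>i s. keys (z i s) \<subseteq> X i" by blast
  have z0: "z i 0 = (if i < N then f i else DL u0)" for i using w by (simp add: z_def)
  have not_span: "DL u0 \<notin> vs.span B" using notin vs.span_minimal[OF B(2) sub] by blast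
  have image0: "(\<lambda>i. z i 0) ` {..<Suc N} = insert (DL u0) B"
  proof -
    have "(\<lambda>i. z i 0) ` {..<Suc N} = insert (DL u0) (f ` {..<N})"
      by (auto simp: z0 lessThan_Suc image_iff)
    then show ?thesis using f by (simp add: bij_betw_def)
  qed
  have "\<exists>\<delta>\<in>line_poly_funs. \<delta> 0 \<noteq> 0 \<and> (\<forall>s. \<delta> s \<noteq> 0 \<longrightarrow>
      inj_on (\<lambda>i. z i s) {..<Suc N} \<and> vs.independent ((\<lambda>i. z i s) ` {..<Suc N}))"
  proof (rule independent_open[OF alg])
    show "finite (\<Union>i<Suc N. X i)" using X(1) by simp
    show "keys (z i s) \<subseteq> (\<Union>i<Suc N. X i)" if "i < Suc N" for i s
      using X(2)[of i s] that by blast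
    show "(\<lambda>s. lookup (z i s) m) \<in> line_poly_funs" for i m
      by (rule coeff_family_lookup[OF z_fam])
    show "vs.independent ((\<lambda>i. z i 0) ` {..<Suc N})"
      unfolding image0 by (rule vs.independent_insertI[OF not_span B(3)])
    have "DL u0 \<notin> B" using not_span vs.span_base by blast
    then have "card ((\<lambda>i. z i 0) ` {..<Suc N}) = card {..<Suc N}"
      unfolding image0 using B(1) by (simp add: N_def)
    then show "inj_on (\<lambda>i. z i 0) {..<Suc N}" by (rule eq_card_imp_inj_on[rotated]) simp
  qed
  then obtain \<delta> where \<delta>: "\<delta> \<in> line_poly_funs" "\<delta> 0 \<noteq> 0"
    "\<And>s. \<delta> s \<noteq> 0 \<Longrightarrow> inj_on (\<lambda>i. z i s) {..<Suc N} \<and> vs.independent ((\<lambda>i. z i s) ` {..<Suc N})"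
    by blast
  obtain q where q: "\<delta> = poly q" using \<delta>(1) unfolding line_poly_funs_def by blast
  have "q \<noteq> 0" using \<delta>(2) q by auto
  \<comment> \<open>The factor excludes the parameter 0.\<close>
  then have "[:0, 1:] * q \<noteq> 0" by simp
  then obtain s where "poly ([:0, 1:] * q) s \<noteq> 0" using poly_all_0_iff_0 by blast
  then have s: "s \<noteq> 0" "\<delta> s \<noteq> 0" using q by auto
  have "z i s \<in> L s ` U" if "i < Suc N" for i
  proof (cases "i < N")
    case True
    then show ?thesis using w by (simp add: z_def)
  next
    case False
    have "L s u0 = scale s (z i s)"
      using False R(2)[of s] by (simp add: u0(2) z_def vs.scale_right_distrib)
    then have "z i s = scale (inverse s) (L s u0)" using s(1) by simp
    moreover have "scale (inverse s) (L s u0) \<in> L s ` U"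
      using u0(1) by (intro vs.subspace_scale[OF sub]) blast
    ultimately show ?thesis by simp
  qed
  then have "card ((\<lambda>i. z i s) ` {..<Suc N}) \<le> vs.dim (L s ` U)"
    using \<delta>(3)[OF s(2)] by (intro vs.independent_card_le_dim[OF fin]) auto
  then have "Suc N \<le> vs.dim (L s ` U)" using \<delta>(3)[OF s(2)] by (simp add: card_image)
  then show False using rank[of s] B(5) by (simp add: N_def)
qed

text \<open>The remainder of second order is kept as a family of polynomials, since later the quotient by \<open>s\<close>
  has to depend polynomially on \<open>s\<close>.\<close>

lemma binomial_first_order:
  fixes x y :: "(nat, 'k::field_char_0) mpoly"
  shows "\<exists>R. coeff_family line_poly_funs R \<and>
    (\<forall>s. (x + scale s y) ^ a = x ^ a + scale s (of_nat a * (x ^ (a - 1) * y)) + scale (s * s) (R s))"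
proof (induction a)
  case 0
  show ?case
    using coeff_family_const[OF function_algebra_line_poly_funs, of 0] by (intro exI[of _ "\<lambda>s. 0"]) simp
next
  case (Suc a)
  then obtain R where R: "coeff_family line_poly_funs R"
    "\<And>s. (x + scale s y) ^ a = x ^ a + scale s (of_nat a * (x ^ (a - 1) * y)) + scale (s * s) (R s)"
    by blast
  note alg = function_algebra_line_poly_funs
  let ?R = "\<lambda>s. x * R s + of_nat a * (x ^ (a - 1) * y) * y + scale s (y * R s)"
  have "coeff_family line_poly_funs ?R"
    using R(1) by (intro coeff_family_add[OF alg] coeff_family_mult[OF alg] coeff_family_const[OF alg]
        coeff_family_scale[OF alg] ident_in_line_poly_funs)
  moreover have "(x + scale s y) ^ Suc a
      = x ^ Suc a + scale s (of_nat (Suc a) * (x ^ (Suc a - 1) * y)) + scale (s * s) (?R s)" for s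
  proof -
    let ?c = "single 0 s :: (nat, 'k) mpoly"
    have cc: "single 0 (s * s) = ?c * ?c" by (simp add: mult_single)
    have x: "of_nat a * (x ^ (a - 1) * x) = of_nat a * x ^ a" by (cases a) (simp_all add: mult.commute)
    have "(x + scale s y) ^ Suc a = (x + ?c * y) *
        (x ^ a + ?c * (of_nat a * (x ^ (a - 1) * y)) + ?c * ?c * R s)"
      by (simp only: power_Suc R(2)) (simp only: scale_conv_mult cc)
    also have "\<dots> = x * x ^ a + ?c * (x ^ a * y) + ?c * (of_nat a * (x ^ (a - 1) * x)) * y
        + ?c * ?c * (x * R s + of_nat a * (x ^ (a - 1) * y) * y + ?c * (y * R s))"
      by (simp add: algebra_simps)
    also have "\<dots> = x ^ Suc a + scale s (of_nat (Suc a) * (x ^ (Suc a - 1) * y)) + scale (s * s) (?R s)"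
      unfolding x by (simp add: scale_conv_mult cc algebra_simps)
    finally show ?thesis .
  qed
  ultimately show ?case by blast
qed

text \<open>The derivation \<open>x\<^sub>k \<partial>/\<partial>x\<^sub>r\<close>.\<close>

definition polarize :: "nat \<Rightarrow> nat \<Rightarrow> (nat, 'k::field_char_0) mpoly \<Rightarrow> (nat, 'k) mpoly"
  where "polarize k r p = (\<Sum>m\<in>keys p. scale (lookup p m)
    (of_nat (lookup m r) * (monomial (m - single r 1) * var k)))"

text \<open>The matrix describes the change of coordinates \<open>x\<^sub>r \<mapsto> x\<^sub>r + s x\<^sub>k\<close>.\<close>

lemma shear_first_order:
  fixes p :: "(nat, 'k::field_char_0) mpoly"
  assumes p: "p \<in> polys_in {1..n}" and kr: "k \<in> {1..n}" "r \<in> {1..n}" "k \<noteq> r"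
  shows "\<exists>R. coeff_family line_poly_funs R \<and>
    (\<forall>s. coord_change n (addrow_mat n s (k - 1) (r - 1)) p
      = p + scale s (polarize k r p) + scale (s * s) (R s))"
proof -
  note alg = function_algebra_line_poly_funs
  let ?E = "\<lambda>s :: 'k. addrow_mat n s (k - 1) (r - 1)"
  have lin: "lin_form n (?E s) j = var j + (if j = r then scale s (var k) else 0)" if j: "j \<in> {1..n}" for s j
  proof -
    have "lin_form n (?E s) j
        = (\<Sum>i\<in>{1..n}. (if i = j then var i else 0) + (if i = k then (if j = r then scale s (var i) else 0) else 0))"
      unfolding lin_form_def
    proof (rule sum.cong[OF refl])
      fix i assume i: "i \<in> {1..n}"
      have "(k - 1 = i - 1) = (i = k)" "(r - 1 = j - 1) = (j = r)" "(i - 1 = j - 1) = (i = j)"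
        using i j kr by auto
      then show "scale (?E s $$ (i - 1, j - 1)) (var i)
          = (if i = j then var i else 0) + (if i = k then (if j = r then scale s (var i) else 0) else 0)"
        using i j kr by (auto simp: vs.scale_left_distrib)
    qed
    then show ?thesis using j kr by (simp add: sum.distrib)
  qed
  have mono: "\<exists>R. coeff_family line_poly_funs R \<and> (\<forall>s. coord_change n (?E s) (monomial m)
      = monomial m + scale s (of_nat (lookup m r) * (monomial (m - single r 1) * var k))
        + scale (s * s) (R s))" if m: "keys m \<subseteq> {1..n}" for m
  proof -
    define a where "a = lookup m r"
    define m' where "m' = m - single r a"
    have m_eq: "m = single r a + m'"
      by (rule poly_mapping_eqI) (simp add: m'_def lookup_add lookup_minus lookup_single when_def a_def)
    have r_notin: "r \<notin> keys m'" by (simp add: m'_def in_keys_iff lookup_minus a_def)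
    have keys': "keys m' \<subseteq> {1..n}" using m unfolding m'_def by (auto simp: in_keys_iff lookup_minus)
    have ev': "mon_eval (lin_form n (?E s)) m' = monomial m'" for s
    proof -
      have "mon_eval (lin_form n (?E s)) m' = mon_eval (\<lambda>i. var i) m'"
      proof (rule mon_eval_cong)
        fix i assume "i \<in> keys m'"
        then have "i \<in> {1..n}" "i \<noteq> r" using keys' r_notin by auto
        then show "lin_form n (?E s) i = var i" by (simp add: lin)
      qed
      then show ?thesis by (simp add: mon_eval_var)
    qed
    obtain R where R: "coeff_family line_poly_funs R"
      "\<And>s :: 'k. (var r + scale s (var k)) ^ a = var r ^ a + scale s (of_nat a * (var r ^ (a - 1) * var k)) + scale (s * s) (R s)"
      using binomial_first_order[of "var r :: (nat, 'k) mpoly" "var k" a] by blast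
    have pow: "(var r :: (nat, 'k) mpoly) ^ b = monomial (single r b)" for b by (rule monomial_power[symmetric])
    have "coord_change n (?E s) (monomial m)
        = monomial m + scale s (of_nat a * (monomial (m - single r 1) * var k))
          + scale (s * s) (R s * monomial m')" for s
    proof -
      have "coord_change n (?E s) (monomial m) = (var r + scale s (var k)) ^ a * monomial m'"
        unfolding coord_change_monomial by (subst m_eq) (simp add: mon_eval_add mon_eval_single ev' lin[OF kr(2)])
      also have "\<dots> = var r ^ a * monomial m' + scale s (of_nat a * ((var r ^ (a - 1) * monomial m') * var k))
          + scale (s * s) (R s * monomial m')"
        unfolding R(2) by (simp add: scale_conv_mult algebra_simps)
      also have "(var r :: (nat, 'k) mpoly) ^ a * monomial m' = monomial m"
        unfolding pow monomial_add[symmetric] using m_eq by metis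
      also have "of_nat a * (((var r :: (nat, 'k) mpoly) ^ (a - 1) * monomial m') * var k)
          = of_nat a * (monomial (m - single r 1) * var k)"
      proof (cases a)
        case (Suc b)
        have "m - single r 1 = single r b + m'"
          using Suc by (intro poly_mapping_eqI)
            (auto simp: a_def m'_def lookup_add lookup_minus lookup_single when_def)
        then show ?thesis by (simp add: Suc pow monomial_add)
      qed simp
      finally show ?thesis .
    qed
    moreover have "coeff_family line_poly_funs (\<lambda>s. R s * monomial m')"
      using R(1) by (intro coeff_family_mult[OF alg] coeff_family_const[OF alg])
    ultimately show ?thesis unfolding a_def by blast
  qed
  have "\<forall>m\<in>keys p. \<exists>R. coeff_family line_poly_funs R \<and> (\<forall>s. coord_change n (?E s) (monomial m)
      = monomial m + scale s (of_nat (lookup m r) * (monomial (m - single r 1) * var k))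
        + scale (s * s) (R s))"
    using mono p unfolding polys_in_def by blast
  from bchoice[OF this] obtain R where R: "\<forall>m\<in>keys p. coeff_family line_poly_funs (R m) \<and>
      (\<forall>s. coord_change n (?E s) (monomial m)
      = monomial m + scale s (of_nat (lookup m r) * (monomial (m - single r 1) * var k))
        + scale (s * s) (R m s))" ..
  let ?R = "\<lambda>s. \<Sum>m\<in>keys p. scale (lookup p m) (R m s)"
  have "coeff_family line_poly_funs ?R"
    using R by (intro coeff_family_sum[OF alg] coeff_family_scale[OF alg] function_algebra_const[OF alg]) blast
  moreover have "coord_change n (?E s) p = p + scale s (polarize k r p) + scale (s * s) (?R s)" for s
  proof -
    let ?l = "lookup p"
    have "coord_change n (?E s) p = coord_change n (?E s) (\<Sum>m\<in>keys p. scale (?l m) (monomial m))"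
      by (simp only: sum_scale_monomials[symmetric])
    also have "\<dots> = (\<Sum>m\<in>keys p. scale (?l m) (monomial m + scale s (of_nat (lookup m r)
        * (monomial (m - single r 1) * var k)) + scale (s * s) (R m s)))"
      unfolding coord_change_sum coord_change_scale using R by (intro sum.cong refl) simp
    also have "\<dots> = (\<Sum>m\<in>keys p. scale (?l m) (monomial m)) + scale s (polarize k r p) + scale (s * s) (?R s)"
      by (simp add: polarize_def vs.scale_right_distrib sum.distrib vs.scale_sum_right mult.commute mult.left_commute)
    finally show ?thesis by (simp only: sum_scale_monomials[symmetric])
  qed
  ultimately show ?thesis by blast
qed

lemma polarize_add: "polarize k r (p + q) = polarize k r p + polarize k r q"
proof -
  let ?K = "keys p \<union> keys q"
  have ext: "polarize k r u = (\<Sum>m\<in>?K. scale (lookup u m)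
      (of_nat (lookup m r) * (monomial (m - single r 1) * var k)))"
    if "keys u \<subseteq> ?K" for u :: "(nat, 'a) mpoly"
    unfolding polarize_def using that by (intro sum.mono_neutral_left) (auto simp: in_keys_iff)
  show ?thesis
    using ext[of p] ext[of q] ext[OF Poly_Mapping.keys_add]
    by (simp add: lookup_add vs.scale_left_distrib sum.distrib)
qed

lemma keys_polarize:
  fixes p :: "(nat, 'k::field_char_0) mpoly"
  assumes "k \<noteq> r" "v \<in> keys (polarize k r p)"
  shows "\<exists>m\<in>keys p. 0 < lookup m r \<and>
    v = m - single r 1 + single k 1"
proof (rule ccontr)
  assume neg: "\<not> ?thesis"
  have "lookup (of_nat (lookup m r)
      * (monomial (m - single r 1) * var k) :: (nat, 'k) mpoly) v = 0"
    if "m \<in> keys p" for m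
  proof (cases "lookup m r = 0")
    case False
    then have "v \<noteq> m - single r 1 + single k 1" using neg that by blast
    moreover have eq: "of_nat (lookup m r) * (monomial (m - single r 1) * var k)
        = scale (of_nat (lookup m r)) (monomial (m - single r 1 + single k 1) :: (nat, 'k) mpoly)"
      by (simp add: scale_conv_mult monomial_add)
    ultimately show ?thesis unfolding eq by (simp add: monomial_def lookup_single when_def)
  qed simp
  then have "lookup (polarize k r p) v = 0"
    unfolding polarize_def lookup_sum by (intro sum.neutral) simp
  then show False using assms(2) by (simp add: in_keys_iff)
qed

lemma polarize_monomial_mult:
  fixes g :: "(nat, 'k::field_char_0) mpoly"
  assumes g: "g \<in> forms 2 x" and r: "3 \<le> r"
  shows "polarize k r (monomial (c + single r 1) * g)
    = scale (of_nat (Suc (lookup c r))) (monomial c * (var k * g))"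
proof -
  let ?c = "c + single r 1"
  have "polarize k r (monomial ?c * g) = (\<Sum>m\<in>keys g. scale (lookup g m)
      (of_nat (lookup (?c + m) r) * (monomial (?c + m - single r 1) * var k)))"
    unfolding polarize_def keys_monomial_mult by (subst sum.reindex) simp_all
  also have "\<dots> = (\<Sum>m\<in>keys g. scale (lookup g m)
      (of_nat (Suc (lookup c r)) * (monomial (c + m) * var k)))"
  proof (rule sum.cong[OF refl])
    fix m assume "m \<in> keys g"
    then have "m \<in> mons 2 x" using g by (auto simp: forms_def supported_def)
    then have "lookup (?c + m) r = Suc (lookup c r)"
      using lookup_tail_zero[of m x r] r by (simp add: lookup_add)
    moreover have "?c + m - single r 1 = c + m"
      by (rule poly_mapping_eqI) (simp add: lookup_add lookup_minus)
    ultimately show "scale (lookup g m)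
        (of_nat (lookup (?c + m) r) * (monomial (?c + m - single r 1) * var k))
      = scale (lookup g m) (of_nat (Suc (lookup c r)) * (monomial (c + m) * var k))"
      by (simp only:)
  qed
  also have "\<dots> = of_nat (Suc (lookup c r)) * (monomial c * (var k *
      (\<Sum>m\<in>keys g. scale (lookup g m) (monomial m))))"
    unfolding sum_distrib_left
    by (intro sum.cong refl) (simp only: monomial_add mult_scale ac_simps)
  also have "\<dots> = scale (of_nat (Suc (lookup c r))) (monomial c * (var k * g))"
    by (simp only: sum_scale_monomials[symmetric]) (simp only: scale_conv_mult single_of_nat)
  finally show ?thesis .
qed

text \<open>Deforming the coordinates by \<open>x\<^sub>r \<mapsto> x\<^sub>r + s x\<^sub>k\<close> keeps all ranks constant, so the derivation
  \<open>x\<^sub>k \<partial>/\<partial>x\<^sub>r\<close> preserves the space up to terms below the slice. In characteristic 0 it turns a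
  member of the slice with exponent \<open>c\<^sub>r + 1\<close> into a multiple of the product with \<open>x\<^sub>k\<close> in the next slice.\<close>

lemma slice_mult_var:
  fixes U :: "(nat, 'k::field_char_0) mpoly set"
  assumes U: "vs.subspace U" "U \<subseteq> forms n d" and A: "A \<in> GL n" "max_rank n U A"
    and k: "k \<in> {1..2}" and r: "r \<in> {3..n}"
    and g: "g \<in> slice (c + single r 1) x (coord_change n A ` U)"
  shows "var k * g \<in> slice c (Suc x) (coord_change n A ` U)"
proof -
  let ?Y = "coord_change n A ` U" and ?c = "c + single r 1"
  let ?E = "\<lambda>s :: 'k. addrow_mat n s (k - 1) (r - 1)"
  have kr: "k \<in> {1..n}" "r \<in> {1..n}" "k \<noteq> r" "k < 3" using k r by auto
  have A_c: "A \<in> carrier_mat n n" using A(1) by (simp add: GL_def)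
  obtain q where q: "g \<in> forms 2 x" "monomial ?c * g + q \<in> ?Y" "\<forall>m\<in>keys q. below ?c m"
    using g unfolding slice_def by blast
  let ?p = "monomial ?c * g + q"
  obtain u0 where u0: "u0 \<in> U" "coord_change n A u0 = ?p" using q(2) by auto
  let ?low = "{m. below ?c m \<or> (\<forall>i\<ge>3. lookup m i = lookup ?c i)}"
  let ?T = "- ?low"
  have low_below: "below c m" if "m \<in> ?low" for m
  proof (cases "below ?c m")
    case True
    then obtain i where i: "3 \<le> i" "lookup ?c i < lookup m i"
      "\<forall>j>i. lookup m j = lookup ?c j"
      unfolding below_def by blast
    show ?thesis
    proof (cases "i < r")
      case True
      then show ?thesis using i r unfolding below_def
        by (intro exI[of _ r]) (auto simp: lookup_add lookup_single when_def)
    next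
      case False
      then show ?thesis using i unfolding below_def
        by (intro exI[of _ i]) (auto simp: lookup_add lookup_single when_def split: if_splits)
    qed
  next
    case False
    then have "\<forall>i\<ge>3. lookup m i = lookup ?c i" using that by blast
    then show ?thesis using r unfolding below_def
      by (intro exI[of _ r]) (auto simp: lookup_add lookup_single when_def)
  qed
  have p_low: "keys ?p \<subseteq> ?low"
  proof
    fix m assume "m \<in> keys ?p"
    then consider "m \<in> keys q" | "m \<in> keys (monomial ?c * g)"
      using Poly_Mapping.keys_add[of "monomial ?c * g" q] by blast
    then show "m \<in> ?low"
    proof cases
      case 2
      then obtain m' where m': "m' \<in> keys g" "m = ?c + m'" by (auto simp: keys_monomial_mult)
      then have "m' \<in> mons 2 x" using q(1) by (auto simp: forms_def supported_def)
      then show ?thesis using m'(2) by (simp add: lookup_add lookup_tail_zero)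
    qed (use q(3) in blast)
  qed
  define L where "L s u = proj ?T (coord_change n (?E s) (coord_change n A u))" for s u
  have E0: "?E 0 = 1\<^sub>m n" by (rule eq_matI) auto
  have L0: "L 0 u = proj ?T (coord_change n A u)" if "u \<in> U" for u
  proof -
    have "coord_change n A u \<in> polys_in {1..n}"
      using that U(2) coord_change_in_forms forms_subset_polys_in by blast
    then show ?thesis unfolding L_def E0 by (simp add: coord_change_one)
  qed
  have "proj ?T (polarize k r (coord_change n A u0)) \<in> L 0 ` U"
  proof (rule constant_rank_derivative[where DL = "\<lambda>u. proj ?T (polarize k r (coord_change n A u))", OF U(1) fin_span_subset_forms[OF U(2)]])
    show "linear_map (L s)" for s
      using Vector_Spaces.linear_compose[OF linear_coord_change[of n A]
          Vector_Spaces.linear_compose[OF linear_coord_change[of n "?E s"] linear_proj[of ?T]]]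
      by (simp add: L_def[abs_def] comp_def)
    show "\<exists>R. coeff_family line_poly_funs R \<and> (\<forall>s. L s u = L 0 u
        + scale s (proj ?T (polarize k r (coord_change n A u))) + scale (s * s) (R s))" if u: "u \<in> U" for u
    proof -
      have "coord_change n A u \<in> polys_in {1..n}"
        using u U(2) coord_change_in_forms forms_subset_polys_in by blast
      then obtain R where R: "coeff_family line_poly_funs R"
        "\<And>s. coord_change n (?E s) (coord_change n A u) = coord_change n A u
          + scale s (polarize k r (coord_change n A u)) + scale (s * s) (R s)"
        using shear_first_order[OF _ kr(1-3)] by blast
      have "L s u = L 0 u + scale s (proj ?T (polarize k r (coord_change n A u)))
          + scale (s * s) (proj ?T (R s))" for s
        unfolding L0[OF u] unfolding L_def R(2)
        by (simp add: vsp.linear_add[OF linear_proj] vsp.linear_scale[OF linear_proj])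
      moreover have "coeff_family line_poly_funs (\<lambda>s. proj ?T (R s))"
        by (rule coeff_family_proj[OF function_algebra_line_poly_funs R(1)])
      ultimately show ?thesis by blast
    qed
    show "vs.dim (L s ` U) \<le> vs.dim (L 0 ` U)" for s
    proof -
      have "det (?E s) = 1" using kr by (intro det_addrow_mat) auto
      then have GL: "?E s * A \<in> GL n" using A(1) A_c mult_carrier_mat[OF addrow_mat_carrier A_c]
        by (simp add: GL_iff_det det_mult[of _ n])
      have Ls: "L s ` U = proj ?T ` coord_change n (?E s * A) ` U"
      proof -
        have "coord_change n (?E s) (coord_change n A u) = coord_change n (?E s * A) u" if "u \<in> U" for u
          using coord_change_compose[OF A_c addrow_mat_carrier, of u] that U(2) forms_subset_polys_in by blast
        then show ?thesis unfolding L_def image_image by (intro image_cong) simp_all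
      qed
      have L0U: "L 0 ` U = proj ?T ` coord_change n A ` U"
        unfolding image_image by (intro image_cong refl L0)
      show ?thesis unfolding Ls L0U
        using A(2)[unfolded max_rank_def, rule_format, OF GL] .
    qed
    show "u0 \<in> U" by (rule u0(1))
    show "L 0 u0 = 0"
      unfolding L0[OF u0(1)] u0(2) using p_low
      by (intro poly_mapping_eqI) (auto simp: lookup_proj in_keys_iff)
  qed
  then obtain u1 where u1: "u1 \<in> U" "proj ?T (polarize k r ?p) = proj ?T (coord_change n A u1)"
    using L0 u0(2) by auto
  let ?y = "coord_change n A u1"
  \<comment> \<open>Up to terms below the slice, the element \<open>y\<close> of the space is the derivative of the top term.\<close>
  define w where "w = ?y - polarize k r (monomial ?c * g)"
  let ?a = "of_nat (Suc (lookup c r)) :: 'k"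
  have a: "?a \<noteq> 0" by (simp del: of_nat_Suc)
  have w_below: "below c m" if m: "m \<in> keys w" for m
  proof (rule ccontr)
    assume nb: "\<not> below c m"
    then have "m \<in> ?T" using low_below by blast
    then have "lookup ?y m = lookup (polarize k r ?p) m"
      using arg_cong[OF u1(2), of "\<lambda>p. lookup p m"] by (simp add: lookup_proj)
    then have "lookup w m = lookup (polarize k r q) m"
      by (simp add: w_def lookup_minus polarize_add lookup_add)
    then have "m \<in> keys (polarize k r q)" using m by (simp add: in_keys_iff)
    then obtain v where v: "v \<in> keys q" "0 < lookup v r"
      "m = v - single r 1 + single k 1"
      using keys_polarize[OF kr(3)] by blast
    obtain i where i: "3 \<le> i" "lookup ?c i < lookup v i"
      "\<forall>j>i. lookup v j = lookup ?c j"
      using q(3) v(1) unfolding below_def by blast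
    have m_eq: "lookup m j = lookup v j - (if j = r then 1 else 0)" if "3 \<le> j" for j
      using that kr(4) by (simp add: v(3) lookup_add lookup_minus lookup_single when_def)
    have "below c m" unfolding below_def
    proof (intro exI conjI allI impI)
      show "3 \<le> i" by (rule i(1))
      show "lookup c i < lookup m i"
        using i(2) by (simp add: m_eq[OF i(1)] lookup_add lookup_single when_def split: if_splits)
      show "lookup m j = lookup c j" if "i < j" for j
        using i(1,3) that m_eq[of j] by (simp add: lookup_add lookup_single when_def split: if_splits)
    qed
    then show False using nb by blast
  qed
  have "?y = scale ?a (monomial c * (var k * g)) + w"
    unfolding w_def using r by (simp add: polarize_monomial_mult[OF q(1)])
  then have "scale (inverse ?a) ?y = monomial c * (var k * g) + scale (inverse ?a) w"
    using a by (simp add: vs.scale_right_distrib)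
  moreover have "scale (inverse ?a) ?y \<in> ?Y"
    using u1(1) by (intro vs.subspace_scale[OF coord_change_image(1)[OF U]]) blast
  moreover have "\<forall>m\<in>keys (scale (inverse ?a) w). below c m"
    by (rule ballI, rule w_below, erule set_mp[OF keys_scale_subset])
  moreover have "var k * g \<in> forms 2 (Suc x)"
    using forms_mult[OF var_in_forms[OF k] q(1)] by (simp add: plus_1_eq_Suc)
  ultimately have "\<exists>q. monomial c * (var k * g) + q \<in> ?Y \<and> (\<forall>m\<in>keys q. below c m)"
    by (intro exI[of _ "scale (inverse ?a) w"]) simp
  then show ?thesis using \<open>var k * g \<in> forms 2 (Suc x)\<close> unfolding slice_def by blast
qed

section \<open>Binary forms and multiplication by linear forms\<close>

definition shift :: "nat \<Rightarrow> (nat, 'k::field_char_0) mpoly set \<Rightarrow> (nat, 'k) mpoly set"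
  where "shift n V = vs.span (\<Union>i\<in>{1..n}. (*) (var i) ` V)"

lemma subspace_shift: "vs.subspace (shift n V)"
  by (simp add: shift_def)

lemma var_mult_in_shift: "i \<in> {1..n} \<Longrightarrow> v \<in> V \<Longrightarrow> var i * v \<in> shift n V"
  unfolding shift_def by (rule vs.span_base) blast

lemma shift_minimal:
  assumes "vs.subspace W" "\<And>i v. i \<in> {1..n} \<Longrightarrow> v \<in> V \<Longrightarrow> var i * v \<in> W"
  shows "shift n V \<subseteq> W"
  unfolding shift_def using assms by (intro vs.span_minimal) auto

lemma shift_mono: "V \<subseteq> W \<Longrightarrow> shift n V \<subseteq> shift n W"
  by (rule shift_minimal[OF subspace_shift]) (use var_mult_in_shift in blast)

lemma shift_subset_forms:
  assumes "V \<subseteq> forms n x"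
  shows "shift n V \<subseteq> forms n (Suc x)"
proof (rule shift_minimal[OF subspace_forms])
  fix i v assume "i \<in> {1..n}" "v \<in> V"
  then have "var i \<in> forms n 1" "v \<in> forms n x" using var_in_forms[of i n] assms by blast+
  then show "var i * v \<in> forms n (Suc x)" using forms_mult[of "var i" n 1 v x] by (simp add: plus_1_eq_Suc)
qed

lemma shift_power_mono: "V \<subseteq> W \<Longrightarrow> (shift n ^^ j) V \<subseteq> (shift n ^^ j) W"
  by (induction j) (simp_all add: shift_mono)

lemma shift_power_subset_forms: "V \<subseteq> forms n x \<Longrightarrow> (shift n ^^ j) V \<subseteq> forms n (x + j)"
  by (induction j) (simp_all add: shift_subset_forms)

lemma subspace_shift_power: "vs.subspace V \<Longrightarrow> vs.subspace ((shift n ^^ j) V)"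
  by (cases j) (simp_all add: subspace_shift)

text \<open>Write \<open>V = x\<^sub>1 W \<oplus> C\<close>. Then \<open>x\<^sub>1 V + x\<^sub>2 V = x\<^sub>1 V + x\<^sub>2 C\<close>, because \<open>x\<^sub>2 x\<^sub>1 W\<close> already lies in
  \<open>x\<^sub>1 V\<close>.\<close>

lemma dim_shift_le:
  fixes V W :: "(nat, 'k::field_char_0) mpoly set"
  assumes V: "vs.subspace V" "V \<subseteq> forms 2 x" and W: "vs.subspace W"
    and WV: "\<And>i w. i \<in> {1..2} \<Longrightarrow> w \<in> W \<Longrightarrow> var i * w \<in> V"
  shows "vs.dim (shift 2 V) + vs.dim W \<le> 2 * vs.dim V"
proof -
  note fin = fin_span_subset_forms[OF V(2)]
  let ?x = "\<lambda>i. (*) (var i) :: (nat, 'k) mpoly \<Rightarrow> _"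
  have W1: "vs.subspace (?x 1 ` W)" "?x 1 ` W \<subseteq> V" "vs.dim (?x 1 ` W) = vs.dim W"
    using vsp.linear_subspace_image[OF linear_mult_left W] WV
      vsp.dim_image_inj[OF linear_mult_left W inj_monomial_mult] by auto
  obtain C where C: "finite C" "C \<subseteq> V" "V \<subseteq> vs.span (?x 1 ` W \<union> C)" "card C + vs.dim (?x 1 ` W) = vs.dim V"
    using vs.subspace_complement[OF fin W1(1,2)] .
  obtain B where B: "finite B" "B \<subseteq> V" "vs.independent B" "V \<subseteq> vs.span B" "card B = vs.dim V"
    using vs.fin_span_basis[OF fin] .
  let ?S = "vs.span (?x 1 ` B \<union> ?x 2 ` C)"
  have x1: "var 1 * v \<in> ?S" if "v \<in> V" for v
  proof -
    have "var 1 * v \<in> ?x 1 ` vs.span B" using that B(4) by blast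
    also have "\<dots> = vs.span (?x 1 ` B)" using vsp.linear_span_image[OF linear_mult_left, of "var 1" B] by simp
    also have "\<dots> \<subseteq> ?S" by (rule vs.span_mono) blast
    finally show ?thesis .
  qed
  have x2: "var 2 * v \<in> ?S" if "v \<in> V" for v
  proof -
    have "var 2 * v \<in> ?x 2 ` vs.span (?x 1 ` W \<union> C)" using that C(3) by blast
    also have "\<dots> = vs.span (?x 2 ` (?x 1 ` W \<union> C))"
      using vsp.linear_span_image[OF linear_mult_left, of "var 2" "?x 1 ` W \<union> C"] by simp
    also have "\<dots> \<subseteq> ?S"
    proof (rule vs.span_minimal[OF _ vs.subspace_span], clarify)
      fix p assume "p \<in> ?x 1 ` W \<union> C"
      then show "var 2 * p \<in> ?S"
      proof
        assume "p \<in> ?x 1 ` W"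
        then obtain w where w: "w \<in> W" "p = var 1 * w" by blast
        then have "var 2 * w \<in> V" by (intro WV) auto
        then have "var 1 * (var 2 * w) \<in> ?S" by (rule x1)
        then show ?thesis using w(2) by (simp add: mult.left_commute)
      next
        assume "p \<in> C"
        then show ?thesis by (intro vs.span_base) blast
      qed
    qed
    finally show ?thesis .
  qed
  have "shift 2 V \<subseteq> ?S"
  proof (rule shift_minimal[OF vs.subspace_span])
    fix i :: nat and v assume "i \<in> {1..2}" "v \<in> V"
    moreover have "i = 1 \<or> i = 2" using \<open>i \<in> {1..2}\<close> by auto
    ultimately show "var i * v \<in> ?S" using x1 x2 by blast
  qed
  then have "vs.dim (shift 2 V) \<le> card (?x 1 ` B \<union> ?x 2 ` C)"
    using B(1) C(1) by (intro vs.dim_le_card) auto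
  also have "\<dots> \<le> card B + card C"
    using card_Un_le[of "?x 1 ` B" "?x 2 ` C"] card_image_le[OF B(1), of "?x 1"] card_image_le[OF C(1), of "?x 2"]
    by linarith
  finally show ?thesis using C(4) B(5) W1(3) by simp
qed

lemma dim_shift_ge:
  fixes V :: "(nat, 'k::field_char_0) mpoly set"
  assumes V: "vs.subspace V" "V \<subseteq> forms 2 x"
  shows "vs.dim V \<le> vs.dim (shift 2 V)"
proof -
  have "vs.dim V = vs.dim ((*) (var 1) ` V)"
    using vsp.dim_image_inj[OF linear_mult_left V(1) inj_monomial_mult] by simp
  also have "\<dots> \<le> vs.dim (shift 2 V)"
  proof (rule vs.dim_mono_finite)
    show "vs.fin_span (shift 2 V)" by (rule fin_span_subset_forms[OF shift_subset_forms[OF V(2)]])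
    show "(*) (var 1) ` V \<subseteq> shift 2 V" by (auto intro: var_mult_in_shift)
  qed
  finally show ?thesis .
qed

text \<open>The leading monomial with least exponent of \<open>x\<^sub>1\<close> yields, after multiplication by \<open>x\<^sub>2\<close>, a leading
  monomial that no multiplication by \<open>x\<^sub>1\<close> produces.\<close>

lemma dim_shift_gt:
  fixes V :: "(nat, 'k::field_char_0) mpoly set"
  assumes V: "vs.subspace V" "V \<subseteq> forms 2 x" and nz: "vs.dim V \<noteq> 0"
  shows "vs.dim V < vs.dim (shift 2 V)"
proof -
  let ?L = "leading V" and ?e = "\<lambda>i :: nat. single i (1 :: nat)"
  have card: "card ?L = vs.dim V" by (rule card_leading[OF V])
  have fin: "finite ?L" using finite_subset[OF leading_subset_mons[OF V(2)] finite_mons] .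
  have "?L \<noteq> {}" using nz card by auto
  then obtain m0 where m0: "m0 \<in> ?L" "\<And>m. m \<in> ?L \<Longrightarrow> lookup m0 1 \<le> lookup m 1"
    using ex_has_least_nat[of "\<lambda>m. m \<in> ?L" _ "\<lambda>m. lookup m 1"] by blast
  have mult: "?e i + m \<in> leading (shift 2 V)" if m: "m \<in> ?L" and i: "i \<in> {1..2}" for i m
  proof -
    obtain p where p: "p \<in> V" "is_leading_monomial p m" using m by (auto simp: leading_def)
    show ?thesis
      using var_mult_in_shift[OF i p(1)] leading_monomial_mult[OF p(2), of "?e i"] unfolding leading_def by blast
  qed
  have "?e 2 + m0 \<notin> (+) (?e 1) ` ?L"
  proof
    assume "?e 2 + m0 \<in> (+) (?e 1) ` ?L"
    then obtain m where m: "m \<in> ?L" "?e 2 + m0 = ?e 1 + m" by blast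
    have "lookup m0 1 = Suc (lookup m 1)"
      using arg_cong[OF m(2), of "\<lambda>p. lookup p 1"] by (simp add: lookup_add lookup_single when_def)
    then show False using m0(2)[OF m(1)] by simp
  qed
  then have "card (insert (?e 2 + m0) ((+) (?e 1) ` ?L)) = Suc (card ?L)"
    using fin by (simp add: card_image)
  moreover have "insert (?e 2 + m0) ((+) (?e 1) ` ?L) \<subseteq> leading (shift 2 V)"
    using mult[OF m0(1), of 2] mult[of _ 1] by auto
  moreover have shift: "shift 2 V \<subseteq> forms 2 (Suc x)" by (rule shift_subset_forms[OF V(2)])
  then have "finite (leading (shift 2 V))" using leading_subset_mons finite_mons by (metis finite_subset)
  ultimately have "Suc (card ?L) \<le> card (leading (shift 2 V))" by (metis card_mono)
  then show ?thesis using card card_leading[OF subspace_shift shift] by simp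
qed

section \<open>Growth of the dimensions\<close>

definition growth :: "(nat, 'k::field_char_0) mpoly set \<Rightarrow> nat \<Rightarrow> nat"
  where "growth G j = vs.dim ((shift 2 ^^ j) G)"

context
  fixes G :: "(nat, 'k::field_char_0) mpoly set" and x :: nat
  assumes G: "vs.subspace G" "G \<subseteq> forms 2 x"
begin

lemma shift_power_forms: "(shift 2 ^^ j) G \<subseteq> forms 2 (x + j)"
  by (rule shift_power_subset_forms[OF G(2)])

lemma growth_mono: "growth G j \<le> growth G (Suc j)"
  unfolding growth_def using dim_shift_ge[OF subspace_shift_power[OF G(1)] shift_power_forms] by simp

lemma growth_double: "growth G (Suc j) \<le> 2 * growth G j"
proof -
  have "vs.dim (shift 2 ((shift 2 ^^ j) G)) + vs.dim {0 :: (nat, 'k) mpoly} \<le> 2 * vs.dim ((shift 2 ^^ j) G)"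
    by (rule dim_shift_le[OF subspace_shift_power[OF G(1)] shift_power_forms])
      (simp_all add: vs.subspace_single_0 vs.subspace_0 subspace_shift_power[OF G(1)])
  then show ?thesis by (simp add: growth_def)
qed

text \<open>The multiples of one shift lie in the next, so \<open>dim_shift_le\<close> applies to two consecutive shifts.\<close>

lemma growth_concave: "growth G (Suc (Suc j)) + growth G j \<le> 2 * growth G (Suc j)"
proof -
  have "vs.dim (shift 2 ((shift 2 ^^ Suc j) G)) + vs.dim ((shift 2 ^^ j) G) \<le> 2 * vs.dim ((shift 2 ^^ Suc j) G)"
    by (rule dim_shift_le[OF subspace_shift_power[OF G(1)] shift_power_forms subspace_shift_power[OF G(1)]])
      (simp add: var_mult_in_shift)
  then show ?thesis by (simp add: growth_def)
qed

lemma growth_bound: "growth G j \<le> 2 ^ j * vs.dim G"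
proof (induction j)
  case (Suc j)
  then show ?case using growth_double[of j] by simp
qed (simp add: growth_def)

definition increment :: "nat \<Rightarrow> nat"
  where "increment j = growth G (Suc j) - growth G j"

lemma growth_Suc: "growth G (Suc j) = growth G j + increment j"
  using growth_mono[of j] by (simp add: increment_def)

lemma increment_antimono: "i \<le> j \<Longrightarrow> increment j \<le> increment i"
proof (induction j rule: dec_induct)
  case (step j)
  have "increment (Suc j) \<le> increment j"
    using growth_concave[of j] growth_Suc[of j] growth_Suc[of "Suc j"] by simp
  then show ?case using step by simp
qed simp

text \<open>Joined to the previous shift, a larger space would have more dimensions than \<open>dim_shift_le\<close> allows.\<close>

lemma colon_of_constant_increment:
  assumes inc: "increment (Suc j) = increment j"
    and W: "vs.subspace W" "W \<subseteq> forms 2 (x + j)"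
    and WV: "\<And>i w. i \<in> {1..2} \<Longrightarrow> w \<in> W \<Longrightarrow> var i * w \<in> (shift 2 ^^ Suc j) G"
  shows "W \<subseteq> (shift 2 ^^ j) G"
proof -
  let ?V = "(shift 2 ^^ j) G" and ?V' = "(shift 2 ^^ Suc j) G"
  let ?W = "vs.span (W \<union> ?V)"
  have V': "vs.subspace ?V'" by (rule subspace_shift_power[OF G(1)])
  have W'V: "var i * w \<in> ?V'" if i: "i \<in> {1..2}" and w: "w \<in> ?W" for i w
  proof -
    have "var i * w \<in> (*) (var i) ` ?W" using w by blast
    also have "\<dots> = vs.span ((*) (var i) ` (W \<union> ?V))"
      using vsp.linear_span_image[OF linear_mult_left, of "var i" "W \<union> ?V"] by simp
    also have "\<dots> \<subseteq> ?V'"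
    proof (rule vs.span_minimal[OF image_subsetI V'])
      fix p assume "p \<in> W \<union> ?V"
      then show "var i * p \<in> ?V'" using WV[OF i, of p] var_mult_in_shift[OF i, of p ?V] by auto
    qed
    finally show ?thesis .
  qed
  have "vs.dim (shift 2 ?V') + vs.dim ?W \<le> 2 * vs.dim ?V'"
    by (rule dim_shift_le[OF V' shift_power_forms vs.subspace_span W'V])
  then have "growth G (Suc (Suc j)) + vs.dim ?W \<le> 2 * growth G (Suc j)"
    by (simp add: growth_def)
  then have "vs.dim ?W \<le> vs.dim ?V"
    using growth_Suc[of j] growth_Suc[of "Suc j"] inc by (simp add: growth_def)
  moreover have "?V \<subseteq> ?W" by (auto intro: vs.span_base)
  moreover have "?W \<subseteq> forms 2 (x + j)"
    using W(2) shift_power_forms[of j] by (intro vs.span_minimal[OF _ subspace_forms]) auto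
  ultimately have "?V = ?W"
    using vs.subspace_eq_of_dim_le[OF fin_span_subset_forms subspace_shift_power[OF G(1)]] by blast
  then show ?thesis by (auto intro: vs.span_base)
qed

end

section \<open>Counting tails\<close>

definition tails :: "nat \<Rightarrow> nat \<Rightarrow> (nat \<Rightarrow>\<^sub>0 nat) set"
  where "tails n y = {c. keys c \<subseteq> {3..n} \<and> mon_deg c \<le> y}"

lemma finite_tails: "finite (tails n y)"
proof (rule finite_subset)
  show "tails n y \<subseteq> (\<Union>e\<le>y. mons n e)"
  proof
    fix c assume "c \<in> tails n y"
    then have "keys c \<subseteq> {1..n}" "mon_deg c \<le> y" by (auto simp: tails_def)
    then show "c \<in> (\<Union>e\<le>y. mons n e)" by (auto simp: mons_def)
  qed
qed (simp add: finite_mons)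

lemma tails_mono: "y \<le> z \<Longrightarrow> tails n y \<subseteq> tails n z"
  by (auto simp: tails_def)

lemma zero_in_tails: "0 \<in> tails n y"
  by (simp add: tails_def)

text \<open>Dividing all exponents by 4 is at most \<open>4\<^sup>n\<close>-to-one.\<close>

lemma card_tails_scaling: "card (tails n (4 * y)) \<le> 4 ^ n * card (tails n y)"
proof -
  let ?q = "Poly_Mapping.map (\<lambda>a :: nat. a div 4)"
  let ?r = "\<lambda>c. restrict (\<lambda>i. lookup c i mod 4) {1..n}"
  have q: "lookup (?q c) i = lookup c i div 4" for c :: "nat \<Rightarrow>\<^sub>0 nat" and i
    by (simp add: map.rep_eq when_def)
  have "inj_on (\<lambda>c. (?q c, ?r c)) (tails n (4 * y))"
  proof (rule inj_onI, rule poly_mapping_eqI)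
    fix c c' i assume c: "c \<in> tails n (4 * y)" "c' \<in> tails n (4 * y)" and eq: "(?q c, ?r c) = (?q c', ?r c')"
    show "lookup c i = lookup c' i"
    proof (cases "i \<in> {1..n}")
      case True
      have eqs: "?q c = ?q c'" "?r c = ?r c'" using eq by (simp_all only: prod.inject)
      have "lookup (?q c) i = lookup (?q c') i" by (simp only: eqs(1))
      then have "lookup c i div 4 = lookup c' i div 4" by (simp only: q)
      moreover have "lookup c i mod 4 = lookup c' i mod 4"
        using fun_cong[OF eqs(2), of i] True by simp
      ultimately show ?thesis by (metis div_mult_mod_eq)
    next
      case False
      then have "i \<notin> keys c" "i \<notin> keys c'"
        using c unfolding tails_def by fastforce+
      then show ?thesis by (simp add: in_keys_iff)
    qed
  qed
  moreover have "(\<lambda>c. (?q c, ?r c)) ` tails n (4 * y) \<subseteq> tails n y \<times> ({1..n} \<rightarrow>\<^sub>E {0..<4})"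
  proof clarify
    fix c assume c: "c \<in> tails n (4 * y)"
    have keys: "keys (?q c) \<subseteq> keys c" by (auto simp: in_keys_iff q)
    have "4 * mon_deg (?q c) = (\<Sum>i\<in>keys c. 4 * (lookup c i div 4))"
      by (simp add: mon_deg_superset[OF finite_keys keys] q sum_distrib_left)
    also have "\<dots> \<le> mon_deg c" unfolding mon_deg_def by (intro sum_mono) simp
    finally have "mon_deg (?q c) \<le> y" using c by (simp add: tails_def)
    then have "?q c \<in> tails n y" using keys c by (auto simp: tails_def)
    moreover have "?r c \<in> {1..n} \<rightarrow>\<^sub>E {0..<4}" by (auto simp: PiE_iff)
    ultimately show "?q c \<in> tails n y \<and> ?r c \<in> {1..n} \<rightarrow>\<^sub>E {0..<4}" by blast
  qed
  moreover have "finite (tails n y \<times> ({1..n} \<rightarrow>\<^sub>E {0..<4 :: nat}))"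
    by (intro finite_cartesian_product finite_tails finite_PiE) auto
  ultimately have "card (tails n (4 * y)) \<le> card (tails n y \<times> ({1..n} \<rightarrow>\<^sub>E {0..<4 :: nat}))"
    by (rule card_inj_on_le)
  also have "\<dots> = 4 ^ n * card (tails n y)" by (simp add: card_cartesian_product card_PiE)
  finally show ?thesis .
qed

lemma card_mons_2: "card (mons 2 x) = Suc x"
proof -
  have "mons 2 x = (\<lambda>j. single 1 (x - j) + single 2 j) ` {..x}"
  proof
    show "(\<lambda>j. single 1 (x - j) + single 2 j) ` {..x} \<subseteq> mons 2 x"
    proof clarify
      fix j assume "j \<le> x"
      then show "single 1 (x - j) + single 2 j \<in> mons 2 x"
        using mons_add[OF single_in_mons[of 1 2 "x - j"] single_in_mons[of 2 2 j]] by simp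
    qed
    show "mons 2 x \<subseteq> (\<lambda>j. single 1 (x - j) + single 2 j) ` {..x}"
    proof
      fix m assume m: "m \<in> mons 2 x"
      have "{1..2 :: nat} = {1, 2}" by auto
      then have deg: "lookup m 1 + lookup m 2 = x"
        using m mon_deg_superset[of "{1..2}" m] by (simp add: mons_def)
      have "m = single 1 (x - lookup m 2) + single 2 (lookup m 2)"
      proof (rule poly_mapping_eqI)
        fix i
        have "i \<notin> keys m" if "i \<noteq> 1" "i \<noteq> 2"
          using m that \<open>{1..2} = {1, 2}\<close> unfolding mons_def by blast
        then show "lookup m i = lookup
            (single 1 (x - lookup m 2) + single 2 (lookup m 2)) i"
          using deg by (auto simp: lookup_add lookup_single when_def in_keys_iff)
      qed
      then show "m \<in> (\<lambda>j. single 1 (x - j) + single 2 j) ` {..x}"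
        using deg by (intro image_eqI) auto
    qed
  qed
  moreover have "inj_on (\<lambda>j. single 1 (x - j) + single (2 :: nat) j) {..x}"
  proof (rule inj_onI)
    fix i j assume "single 1 (x - i) + single (2 :: nat) i
      = single 1 (x - j) + single 2 j"
    from arg_cong[OF this, of "\<lambda>p. lookup p 2"] show "i = j"
      by (simp add: lookup_add lookup_single when_def)
  qed
  ultimately show ?thesis by (simp add: card_image)
qed

text \<open>Every monomial splits uniquely into a monomial in the first two variables and its tail.\<close>

lemma card_mons_sum:
  fixes P :: "(nat \<Rightarrow>\<^sub>0 nat) \<Rightarrow> bool"
  assumes n: "n \<ge> 2"
  shows "card {m \<in> mons n d. P m} = (\<Sum>c\<in>tails n d. card {m \<in> mons 2 (d - mon_deg c). P (c + m)})"
proof -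
  let ?S = "SIGMA c : tails n d. {m \<in> mons 2 (d - mon_deg c). P (c + m)}"
  have c0: "lookup c i = 0" if "c \<in> tails n d" "i < 3" for c i
  proof -
    have "i \<notin> keys c" using that unfolding tails_def by fastforce
    then show ?thesis by (simp add: in_keys_iff)
  qed
  have "bij_betw (\<lambda>(c, m). c + m) ?S {m \<in> mons n d. P m}"
    unfolding bij_betw_def
  proof
    show "inj_on (\<lambda>(c, m). c + m) ?S"
    proof (rule inj_onI)
      fix s s' assume s: "s \<in> ?S" "s' \<in> ?S" "(case s of (c, m) \<Rightarrow> c + m) = (case s' of (c, m) \<Rightarrow> c + m)"
      obtain c m c' m' where cm: "s = (c, m)" "s' = (c', m')" by (cases s, cases s')
      have c: "c \<in> tails n d" "c' \<in> tails n d"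
        and m: "m \<in> mons 2 (d - mon_deg c)" "m' \<in> mons 2 (d - mon_deg c')" and eq: "c + m = c' + m'"
        using s by (simp_all add: cm)
      have "c = c'"
      proof (rule poly_mapping_eqI)
        fix i
        show "lookup c i = lookup c' i"
          using arg_cong[OF eq, of "\<lambda>p. lookup p i"] c0[OF c(1), of i] c0[OF c(2), of i]
            lookup_tail_zero[OF m(1), of i] lookup_tail_zero[OF m(2), of i]
          by (cases "i < 3") (simp_all add: lookup_add)
      qed
      then show "s = s'" using eq cm by simp
    qed
    show "(\<lambda>(c, m). c + m) ` ?S = {m \<in> mons n d. P m}"
    proof
      show "(\<lambda>(c, m). c + m) ` ?S \<subseteq> {m \<in> mons n d. P m}"
      proof
        fix k assume "k \<in> (\<lambda>(c, m). c + m) ` ?S"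
        then obtain c m where c: "c \<in> tails n d" and m: "m \<in> mons 2 (d - mon_deg c)" "P (c + m)"
          and k: "k = c + m" by auto
        have "keys c \<subseteq> {1..n}" "mon_deg c \<le> d" using c by (auto simp: tails_def)
        moreover have "keys m \<subseteq> {1..n}" "mon_deg m = d - mon_deg c"
          using m(1) n by (auto simp: mons_def)
        ultimately show "k \<in> {m \<in> mons n d. P m}" using m(2) k by (simp add: mons_def keys_add_nat)
      qed
      show "{m \<in> mons n d. P m} \<subseteq> (\<lambda>(c, m). c + m) ` ?S"
      proof
        fix k assume "k \<in> {m \<in> mons n d. P m}"
        then have k: "k \<in> mons n d" "P k" by simp_all
        define m :: "nat \<Rightarrow>\<^sub>0 nat" where "m = single 1 (lookup k 1) + single 2 (lookup k 2)"
        define c where "c = k - m"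
        have kcm: "k = c + m"
          by (rule poly_mapping_eqI)
            (simp add: c_def m_def lookup_add lookup_minus lookup_single when_def)
        have m_mons: "m \<in> mons 2 (mon_deg m)" by (auto simp: mons_def m_def keys_add_nat)
        have "i \<in> {3..n}" if "i \<in> keys c" for i
        proof -
          have "lookup k i - lookup m i \<noteq> 0"
            using that by (simp add: c_def in_keys_iff lookup_minus)
          then have "i \<in> keys k" "i \<noteq> 1" "i \<noteq> 2"
            by (auto simp: m_def lookup_add lookup_single when_def in_keys_iff)
          moreover have "i \<in> {1..n}" using k(1) \<open>i \<in> keys k\<close> unfolding mons_def by blast
          ultimately show ?thesis by auto
        qed
        moreover have deg: "mon_deg c + mon_deg m = d" using k(1) kcm by (simp add: mons_def)
        ultimately have "c \<in> tails n d" unfolding tails_def by auto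
        moreover have "m \<in> mons 2 (d - mon_deg c)" using m_mons deg by (metis add_diff_cancel_left')
        ultimately have "(c, m) \<in> ?S" using k(2) kcm by simp
        then show "k \<in> (\<lambda>(c, m). c + m) ` ?S" using kcm by (intro image_eqI[of _ _ "(c, m)"]) simp_all
      qed
    qed
  qed
  then have "card {m \<in> mons n d. P m} = card ?S" by (rule bij_betw_same_card[symmetric])
  also have "\<dots> = (\<Sum>c\<in>tails n d. card {m \<in> mons 2 (d - mon_deg c). P (c + m)})"
    by (intro card_SigmaI finite_tails ballI finite_subset[OF _ finite_mons[of 2]]) auto
  finally show ?thesis .
qed

lemma card_mons: "n \<ge> 2 \<Longrightarrow> card (mons n d) = (\<Sum>c\<in>tails n d. Suc (d - mon_deg c))"
  using card_mons_sum[of n d "\<lambda>_. True"] by (simp add: card_mons_2)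

lemma card_mons_mono:
  assumes "n \<ge> 1" "d \<le> d'"
  shows "card (mons n d) \<le> card (mons n d')"
proof (rule card_inj_on_le[OF _ _ finite_mons])
  show "inj_on ((+) (single 1 (d' - d))) (mons n d)" by simp
  show "(+) (single 1 (d' - d)) ` mons n d \<subseteq> mons n d'"
  proof clarify
    fix m assume m: "m \<in> mons n d"
    have "single 1 (d' - d) \<in> mons n (d' - d)" using assms by (intro single_in_mons) simp
    from mons_add[OF this m] show "single 1 (d' - d) + m \<in> mons n d'" using assms by simp
  qed
qed

text \<open>With \<open>L = 2 y\<close>, every tail of degree at most \<open>y\<close> extends to more than \<open>y\<close> monomials of degree \<open>L\<close>,
  whereas passing from tails of degree at most \<open>y\<close> to those of degree at most \<open>L + u \<le> 4 y\<close> multiplies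
  their number by at most \<open>4\<^sup>n\<close>, which does not depend on \<open>y\<close>.\<close>

lemma tails_fewer_than_mons:
  assumes n: "n \<ge> 2" and L: "L = 2 * (4 ^ n * (b + 1))" and u: "u \<le> b"
  shows "u * card (tails n (L + u)) < card (mons n L)"
proof -
  define y where "y = (4 :: nat) ^ n * (b + 1)"
  have "b \<le> y" unfolding y_def using mult_le_mono[of 1 "4 ^ n" b "b + 1"] by simp
  then have "tails n (L + u) \<subseteq> tails n (4 * y)" using L u by (intro tails_mono) (simp add: y_def[symmetric])
  then have "card (tails n (L + u)) \<le> 4 ^ n * card (tails n y)"
    using card_mono[OF finite_tails] card_tails_scaling[of n y] order_trans by blast
  then have "u * card (tails n (L + u)) \<le> b * (4 ^ n * card (tails n y))" using u by (intro mult_le_mono)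
  also have "\<dots> < Suc y * card (tails n y)"
  proof -
    have "card (tails n y) > 0" using zero_in_tails[of n y] finite_tails[of n y] by (auto simp: card_gt_0_iff)
    moreover have "b * 4 ^ n < Suc y" by (simp add: y_def algebra_simps)
    ultimately have "(b * 4 ^ n) * card (tails n y) < Suc y * card (tails n y)" by (rule mult_strict_right_mono[rotated])
    then show ?thesis by (simp add: mult.assoc)
  qed
  also have "\<dots> = (\<Sum>c\<in>tails n y. Suc y)" by simp
  also have "\<dots> \<le> (\<Sum>c\<in>tails n y. Suc (L - mon_deg c))"
    by (intro sum_mono) (auto simp: tails_def L y_def[symmetric])
  also have "\<dots> \<le> (\<Sum>c\<in>tails n L. Suc (L - mon_deg c))"
    by (intro sum_mono2 finite_tails tails_mono) (auto simp: L y_def)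
  also have "\<dots> = card (mons n L)" by (simp add: card_mons[OF n])
  finally show ?thesis .
qed

text \<open>Count leading monomials according to their tails.\<close>

lemma dim_eq_sum_slices:
  fixes Y :: "(nat, 'k::field_char_0) mpoly set"
  assumes n: "n \<ge> 2" and Y: "vs.subspace Y" "Y \<subseteq> forms n d"
  shows "vs.dim Y = (\<Sum>c\<in>tails n d. vs.dim (slice c (d - mon_deg c) Y))"
proof -
  have "vs.dim Y = card {m \<in> mons n d. m \<in> leading Y}"
  proof -
    have "{m \<in> mons n d. m \<in> leading Y} = leading Y" using leading_subset_mons[OF Y(2)] by blast
    then show ?thesis using card_leading[OF Y] by simp
  qed
  also have "\<dots> = (\<Sum>c\<in>tails n d. card {m \<in> mons 2 (d - mon_deg c). c + m \<in> leading Y})"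
    by (rule card_mons_sum[OF n])
  also have "\<dots> = (\<Sum>c\<in>tails n d. vs.dim (slice c (d - mon_deg c) Y))"
  proof (rule sum.cong[OF refl])
    fix c assume c: "c \<in> tails n d"
    let ?x = "d - mon_deg c"
    have "{m \<in> mons 2 ?x. c + m \<in> leading Y} = leading (slice c ?x Y)"
      using leading_slice[OF Y(2), of c ?x] c leading_subset_mons[OF slice_subset, of c ?x Y]
      by (auto simp: tails_def)
    then show "card {m \<in> mons 2 ?x. c + m \<in> leading Y} = vs.dim (slice c ?x Y)"
      by (simp add: card_leading[OF subspace_slice[OF Y(1)] slice_subset])
  qed
  finally show ?thesis .
qed

section \<open>Restriction to a general line\<close>

definition restrict2 :: "(nat, 'k::field_char_0) mpoly \<Rightarrow> (nat, 'k) mpoly"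
  where "restrict2 = proj {m. keys m \<subseteq> {1..2}}"

lemma linear_restrict2: "linear_map restrict2"
  unfolding restrict2_def by (rule linear_proj)

lemma restrict2_in_forms: "p \<in> forms n d \<Longrightarrow> restrict2 p \<in> forms 2 d"
  unfolding forms_def restrict2_def
  by (intro supportedI) (auto simp: lookup_proj supported_def mons_def in_keys_iff)

lemma restrict2_var_mult: "restrict2 (var i * p) = (if i \<in> {1..2} then var i * restrict2 p else 0)"
proof (rule poly_mapping_eqI)
  fix k
  show "lookup (restrict2 (var i * p)) k
      = lookup (if i \<in> {1..2} then var i * restrict2 p else 0) k"
  proof (cases "\<exists>k'. k = single i 1 + k'")
    case True
    then obtain k' where k: "k = single i 1 + k'" ..
    have "keys k \<subseteq> {1..2} \<longleftrightarrow> i \<in> {1..2} \<and> keys k' \<subseteq> {1..2}"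
      by (simp add: k keys_add_nat)
    then show ?thesis by (simp add: k restrict2_def lookup_proj)
  next
    case False
    then show ?thesis by (simp add: restrict2_def lookup_proj lookup_monomial_mult_other)
  qed
qed

lemma restrict2_below_zero:
  assumes "\<forall>m\<in>keys q. below 0 m"
  shows "restrict2 q = 0"
proof (rule poly_mapping_eqI)
  fix m
  have "\<not> below 0 m" if "keys m \<subseteq> {1..2}"
  proof
    assume "below 0 m"
    then obtain i where i: "3 \<le> i" "0 < lookup m i" by (auto simp: below_def)
    then have "i \<in> keys m" by (simp add: in_keys_iff)
    then have "i \<in> {1..2}" using that by blast
    then show False using i(1) by simp
  qed
  then have "lookup q m = 0" if "keys m \<subseteq> {1..2}"
    using assms that by (metis in_keys_iff)
  then show "lookup (restrict2 q) m = lookup 0 m"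
    by (simp add: restrict2_def lookup_proj)
qed

lemma restrict2_id: "g \<in> forms 2 x \<Longrightarrow> restrict2 g = g"
  by (intro poly_mapping_eqI) (auto simp: restrict2_def lookup_proj forms_def supported_def mons_def in_keys_iff)

lemma slice_zero_subset: "slice 0 x Y \<subseteq> restrict2 ` Y"
proof
  fix g assume "g \<in> slice 0 x Y"
  then obtain q where q: "g \<in> forms 2 x" "monomial 0 * g + q \<in> Y" "\<forall>m\<in>keys q. below 0 m"
    unfolding slice_def by blast
  have "restrict2 (g + q) = g"
    using restrict2_id[OF q(1)] restrict2_below_zero[OF q(3)] by (simp add: vsp.linear_add[OF linear_restrict2])
  then show "g \<in> restrict2 ` Y" using q(2) by (auto simp: monomial_zero intro!: image_eqI[of _ _ "g + q"])
qed

lemma scale_mult: "scale a p * q = scale a (p * q)" for p q :: "('i, 'k::field_char_0) mpoly"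
  by (simp add: scale_conv_mult mult.assoc)

text \<open>Under restriction to the line every variable becomes a linear form in \<open>x\<^sub>1\<close> and \<open>x\<^sub>2\<close>.\<close>

lemma restrict2_shift:
  fixes V :: "(nat, 'k::field_char_0) mpoly set"
  shows "restrict2 ` coord_change n A ` shift n V \<subseteq> shift 2 (restrict2 ` coord_change n A ` V)"
proof -
  let ?f = "\<lambda>p. restrict2 (coord_change n A p)"
  have lin: "linear_map ?f"
    using Vector_Spaces.linear_compose[OF linear_coord_change[of n A] linear_restrict2] by (simp add: comp_def)
  have "?f (var i * v) \<in> shift 2 (?f ` V)" if v: "v \<in> V" for i v
  proof -
    have "?f (var i * v) = (\<Sum>k\<in>{1..n}. scale (A $$ (k - 1, i - 1)) (restrict2 (var k * coord_change n A v)))"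
      unfolding coord_change_mult coord_change_var lin_form_def
      by (simp add: sum_distrib_right scale_mult
          vsp.linear_sum[OF linear_restrict2] vsp.linear_scale[OF linear_restrict2])
    also have "\<dots> \<in> shift 2 (?f ` V)"
    proof (intro vs.subspace_sum[OF subspace_shift] vs.subspace_scale[OF subspace_shift])
      fix k
      have "var k * ?f v \<in> shift 2 (?f ` V)" if "k \<in> {1..2}"
        using v by (intro var_mult_in_shift[OF that]) blast
      then show "restrict2 (var k * coord_change n A v) \<in> shift 2 (?f ` V)"
        unfolding restrict2_var_mult by (simp add: vs.subspace_0[OF subspace_shift])
    qed
    finally show ?thesis .
  qed
  then have "vs.span (?f ` (\<Union>i\<in>{1..n}. (*) (var i) ` V)) \<subseteq> shift 2 (?f ` V)"
    by (intro vs.span_minimal[OF _ subspace_shift]) blast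
  then have "?f ` shift n V \<subseteq> shift 2 (?f ` V)"
    unfolding shift_def[of n V] using vsp.linear_span_image[OF lin] by metis
  then show ?thesis by (simp add: image_image)
qed

lemma restrict2_shift_power:
  "restrict2 ` coord_change n A ` (shift n ^^ M) V \<subseteq> (shift 2 ^^ M) (restrict2 ` coord_change n A ` V)"
proof (induction M)
  case (Suc M)
  have "restrict2 ` coord_change n A ` (shift n ^^ Suc M) V
      \<subseteq> shift 2 (restrict2 ` coord_change n A ` (shift n ^^ M) V)"
    using restrict2_shift by simp
  also have "\<dots> \<subseteq> shift 2 ((shift 2 ^^ M) (restrict2 ` coord_change n A ` V))"
    by (rule shift_mono[OF Suc])
  finally show ?case by simp
qed simp

lemma tail_step:
  assumes "keys c \<subseteq> {3..n}" "mon_deg c = Suc j"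
  obtains c' r where "r \<in> {3..n}" "c = c' + single r 1"
    "keys c' \<subseteq> {3..n}" "mon_deg c' = j"
proof -
  have "c \<noteq> 0" using assms(2) by auto
  then obtain r where r: "r \<in> keys c" by (meson all_not_in_conv keys_eq_empty)
  define c' where "c' = c - single r 1"
  have c: "c = c' + single r 1"
    using r by (intro poly_mapping_eqI)
      (auto simp: c'_def lookup_add lookup_minus lookup_single when_def in_keys_iff)
  have "keys c' \<subseteq> keys c" by (auto simp: c'_def in_keys_iff lookup_minus)
  moreover have "mon_deg c' = j" using assms(2) arg_cong[OF c, of mon_deg] by simp
  ultimately show ?thesis using that[OF _ c] r assms(1) by blast
qed

text \<open>Removing a variable from the tail moves from one slice to a slice that contains its multiples by
  \<open>x\<^sub>1\<close> and \<open>x\<^sub>2\<close>. Starting from the slice at 0, which lies in the restriction to the line, constant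
  increments allow dividing by the two variables \<open>L\<close> times. After that the dimension still drops with every step,
  as multiplication by the two variables enlarges a nonzero space.\<close>

lemma dim_slices_bound:
  fixes G0 :: "(nat, 'k::field_char_0) mpoly set"
  assumes G0: "vs.subspace G0" "G0 \<subseteq> forms n d" and A: "A \<in> GL n"
    and max: "max_rank n ((shift n ^^ (M + L)) G0) A"
    and G: "G = restrict2 ` coord_change n A ` G0"
    and inc: "\<And>j. M \<le> j \<Longrightarrow> j \<le> M + L \<Longrightarrow> increment G j = \<rho>"
    and c: "keys c \<subseteq> {3..n}" "mon_deg c \<le> d + (M + L)"
  defines "Y \<equiv> coord_change n A ` (shift n ^^ (M + L)) G0"
  shows "vs.dim (slice c (d + (M + L) - mon_deg c) Y) \<le> growth G M + \<rho> * (L - mon_deg c)"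
    "mon_deg c > L + growth G M \<Longrightarrow> vs.dim (slice c (d + (M + L) - mon_deg c) Y) = 0"
proof -
  let ?V = "\<lambda>c. slice c (d + (M + L) - mon_deg c) Y"
  have U: "vs.subspace ((shift n ^^ (M + L)) G0)" "(shift n ^^ (M + L)) G0 \<subseteq> forms n (d + (M + L))"
    by (rule subspace_shift_power[OF G0(1)], rule shift_power_subset_forms[OF G0(2)])
  have Ysub: "vs.subspace Y" unfolding Y_def by (rule coord_change_image(1)[OF U])
  have Gsub: "vs.subspace G" unfolding G
    by (intro vsp.linear_subspace_image[OF linear_restrict2] coord_change_image(1)[OF G0])
  have Gforms: "G \<subseteq> forms 2 d"
    unfolding G using coord_change_image(2)[OF G0] restrict2_in_forms by blast
  note GG = Gsub Gforms
  have V_sub: "vs.subspace (?V c)" for c by (rule subspace_slice[OF Ysub])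
  have step: "var k * g \<in> slice c' (d + (M + L) - mon_deg c') Y"
    if "k \<in> {1..2}" "r \<in> {3..n}" "mon_deg c' < d + (M + L)" "g \<in> ?V (c' + single r 1)" for k r c' g
  proof -
    have "Suc (d + (M + L) - mon_deg (c' + single r 1)) = d + (M + L) - mon_deg c'"
      using that(3) by simp
    then show ?thesis
      using slice_mult_var[OF U A max that(1,2), of g c'] that(4) unfolding Y_def by metis
  qed
  \<comment> \<open>Tails of degree at most \<open>L\<close>: divide the restricted space by the two variables.\<close>
  have contained: "?V c \<subseteq> (shift 2 ^^ (M + (L - mon_deg c))) G"
    if "keys c \<subseteq> {3..n}" "mon_deg c = j" "j \<le> L" for c j
    using that
  proof (induction j arbitrary: c)
    case 0
    then have "c = 0" by (auto simp: mon_deg_def in_keys_iff intro!: poly_mapping_eqI)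
    then show ?case
      using slice_zero_subset[of _ Y] restrict2_shift_power[of n A "M + L" G0] unfolding G Y_def by simp blast
  next
    case (Suc j)
    obtain c' r where c': "r \<in> {3..n}" "c = c' + single r 1"
      "keys c' \<subseteq> {3..n}" "mon_deg c' = j"
      using tail_step[OF Suc.prems(1,2)] .
    define i where "i = M + (L - Suc j)"
    have i: "M + (L - j) = Suc i" "M \<le> i" "Suc i \<le> M + L" using Suc.prems(3) by (auto simp: i_def)
    have IH: "?V c' \<subseteq> (shift 2 ^^ Suc i) G" using Suc.IH[OF c'(3,4)] Suc.prems(3) c'(4) i(1) by simp
    have "?V c \<subseteq> (shift 2 ^^ i) G"
    proof (rule colon_of_constant_increment[OF GG])
      show "increment G (Suc i) = increment G i" using inc[of i] inc[of "Suc i"] i by simp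
      show "vs.subspace (?V c)" by (rule V_sub)
      have "d + (M + L) - mon_deg c = d + i" using Suc.prems(2,3) by (simp add: i_def)
      then show "?V c \<subseteq> forms 2 (d + i)" using slice_subset by metis
      show "var k * w \<in> (shift 2 ^^ Suc i) G" if "k \<in> {1..2}" "w \<in> ?V c" for k w
        using step[OF that(1) c'(1) _ that(2)[unfolded c'(2)]] IH c'(4) Suc.prems(3) by auto
    qed
    then show ?case using Suc.prems(2) by (simp add: i_def)
  qed
  have growth_linear: "growth G (M + i) = growth G M + \<rho> * i" if "i \<le> L" for i
    using that
  proof (induction i)
    case (Suc i)
    then show ?case using growth_Suc[OF GG, of "M + i"] inc[of "M + i"] by simp
  qed simp
  have small: "vs.dim (?V c) \<le> growth G M + \<rho> * (L - mon_deg c)"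
    if "keys c \<subseteq> {3..n}" "mon_deg c \<le> L" for c
  proof -
    have "vs.dim (?V c) \<le> growth G (M + (L - mon_deg c))"
      unfolding growth_def using contained[OF that(1) refl that(2)]
      by (intro vs.dim_mono_finite fin_span_subset_forms[OF shift_power_subset_forms[OF Gforms]])
    then show ?thesis using growth_linear[of "L - mon_deg c"] by simp
  qed
  \<comment> \<open>Tails of larger degree: the dimension drops by at least one per step until it is zero.\<close>
  have large: "vs.dim (?V c) = 0 \<or> vs.dim (?V c) + j \<le> growth G M"
    if "keys c \<subseteq> {3..n}" "mon_deg c = L + j" "L + j \<le> d + (M + L)" for c j
    using that
  proof (induction j arbitrary: c)
    case 0
    then show ?case using small[of c] by simp
  next
    case (Suc j)
    obtain c' r where c': "r \<in> {3..n}" "c = c' + single r 1"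
      "keys c' \<subseteq> {3..n}" "mon_deg c' = L + j"
      using tail_step[OF Suc.prems(1)] Suc.prems(2) by (metis add_Suc_right)
    have "shift 2 (?V c) \<subseteq> ?V c'"
      using step[OF _ c'(1), of _ c'] Suc.prems(3) c'(2,4) by (intro shift_minimal[OF V_sub]) auto
    then have "vs.dim (shift 2 (?V c)) \<le> vs.dim (?V c')"
      by (intro vs.dim_mono_finite fin_span_subset_forms[OF slice_subset])
    then show ?case
      using dim_shift_gt[OF V_sub slice_subset, of c] Suc.IH[OF c'(3,4)] Suc.prems(3) by fastforce
  qed
  show "vs.dim (?V c) \<le> growth G M + \<rho> * (L - mon_deg c)"
  proof (cases "mon_deg c \<le> L")
    case False
    then have j: "mon_deg c = L + (mon_deg c - L)" by simp
    then show ?thesis using large[OF c(1) j] c(2) by auto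
  qed (rule small[OF c(1)])
  show "vs.dim (?V c) = 0" if "mon_deg c > L + growth G M"
  proof -
    have j: "mon_deg c = L + (mon_deg c - L)" using that by simp
    then show ?thesis using large[OF c(1) j] c(2) that by arith
  qed
qed

text \<open>The sum of the dimensions of the slices is at most \<open>\<rho>\<close> times the number of monomials of degree
  \<open>L\<close>, with \<open>\<rho> < \<gamma>\<close>, plus an error proportional to the number of tails, which has lower order.\<close>

lemma no_long_constant_increment:
  fixes G0 :: "(nat, 'k::field_char_0) mpoly set"
  assumes n: "n \<ge> 3"
    and G0: "vs.subspace G0" "G0 \<subseteq> forms n d" and A: "A \<in> GL n"
    and max: "max_rank n ((shift n ^^ (M + L)) G0) A"
    and free: "\<gamma> * card (mons n (M + L)) \<le> vs.dim ((shift n ^^ (M + L)) G0)"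
    and G: "G = restrict2 ` coord_change n A ` G0"
    and inc: "increment G M = increment G (M + L)" "increment G M < \<gamma>"
    and L: "L = 2 * (4 ^ n * (b + 1))" and b: "growth G M \<le> b"
  shows False
proof -
  define \<rho> where "\<rho> = increment G M"
  let ?d = "d + (M + L)" and ?u = "growth G M"
  let ?Y = "coord_change n A ` (shift n ^^ (M + L)) G0"
  have U: "vs.subspace ((shift n ^^ (M + L)) G0)" "(shift n ^^ (M + L)) G0 \<subseteq> forms n ?d"
    by (rule subspace_shift_power[OF G0(1)], rule shift_power_subset_forms[OF G0(2)])
  have Gsub: "vs.subspace G" unfolding G
    by (intro vsp.linear_subspace_image[OF linear_restrict2] coord_change_image(1)[OF G0])
  have Gforms: "G \<subseteq> forms 2 d"
    unfolding G using coord_change_image(2)[OF G0] restrict2_in_forms by blast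
  have const: "increment G j = \<rho>" if "M \<le> j" "j \<le> M + L" for j
    using increment_antimono[OF Gsub Gforms that(1)] increment_antimono[OF Gsub Gforms that(2)] inc(1)
    by (simp add: \<rho>_def)
  have slices_le: "vs.dim (slice c (?d - mon_deg c) ?Y) \<le> ?u + \<rho> * (L - mon_deg c)"
    if "keys c \<subseteq> {3..n}" "mon_deg c \<le> ?d" for c
    by (rule dim_slices_bound(1)[OF G0 A max G _ that]) (rule const)
  have slices_zero: "vs.dim (slice c (?d - mon_deg c) ?Y) = 0"
    if "keys c \<subseteq> {3..n}" "mon_deg c \<le> ?d" "mon_deg c > L + ?u" for c
    by (rule dim_slices_bound(2)[OF G0 A max G _ that]) (rule const)
  let ?T = "tails n (L + ?u) \<inter> tails n ?d"
  have "(Suc \<rho>) * card (mons n L) \<le> \<gamma> * card (mons n (M + L))"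
    using inc(2) n by (intro mult_le_mono card_mons_mono) (auto simp: \<rho>_def)
  also have "\<dots> \<le> vs.dim ?Y" using free by (simp add: dim_coord_change[OF A U])
  also have "\<dots> = (\<Sum>c\<in>tails n ?d. vs.dim (slice c (?d - mon_deg c) ?Y))"
    using n by (intro dim_eq_sum_slices coord_change_image[OF U]) simp
  also have "\<dots> = (\<Sum>c\<in>?T. vs.dim (slice c (?d - mon_deg c) ?Y))"
  proof (rule sum.mono_neutral_right[OF finite_tails])
    show "\<forall>c\<in>tails n ?d - ?T. vs.dim (slice c (?d - mon_deg c) ?Y) = 0"
    proof
      fix c assume "c \<in> tails n ?d - ?T"
      then have "keys c \<subseteq> {3..n}" "mon_deg c \<le> ?d" "mon_deg c > L + ?u"
        by (auto simp: tails_def)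
      then show "vs.dim (slice c (?d - mon_deg c) ?Y) = 0" by (rule slices_zero)
    qed
  qed blast
  also have "\<dots> \<le> (\<Sum>c\<in>?T. ?u + \<rho> * (L - mon_deg c))"
    by (intro sum_mono slices_le) (auto simp: tails_def)
  also have "\<dots> \<le> (\<Sum>c\<in>tails n (L + ?u). ?u + \<rho> * (L - mon_deg c))"
    by (intro sum_mono2 finite_tails) auto
  also have "\<dots> = ?u * card (tails n (L + ?u)) + \<rho> * (\<Sum>c\<in>tails n (L + ?u). L - mon_deg c)"
    by (simp add: sum.distrib sum_distrib_left)
  also have "(\<Sum>c\<in>tails n (L + ?u). L - mon_deg c) = (\<Sum>c\<in>tails n L. L - mon_deg c)"
    by (intro sum.mono_neutral_right finite_tails tails_mono) (auto simp: tails_def)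
  also have "?u * card (tails n (L + ?u)) + \<rho> * (\<Sum>c\<in>tails n L. L - mon_deg c)
      \<le> ?u * card (tails n (L + ?u)) + \<rho> * card (mons n L)"
    using n by (intro add_left_mono mult_left_mono) (auto simp: card_mons intro!: sum_mono)
  finally have "card (mons n L) \<le> ?u * card (tails n (L + ?u))" by simp
  moreover have "?u * card (tails n (L + ?u)) < card (mons n L)"
    using n by (intro tails_fewer_than_mons[OF _ L b]) simp
  ultimately show False by simp
qed

text \<open>The gap after a milestone \<open>m\<close> is long enough for \<open>tails_fewer_than_mons\<close>, given that a space of
  dimension at most \<open>\<gamma>\<close> has grown to at most \<open>2\<^sup>m \<gamma>\<close> dimensions by then.\<close>

fun milestone :: "nat \<Rightarrow> nat \<Rightarrow> nat \<Rightarrow> nat \<Rightarrow> nat" where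
  "milestone n \<gamma> J 0 = J"
| "milestone n \<gamma> J (Suc i) = milestone n \<gamma> J i + 2 * (4 ^ n * (2 ^ milestone n \<gamma> J i * \<gamma> + 1))"

lemma milestone_mono: "i \<le> j \<Longrightarrow> milestone n \<gamma> J i \<le> milestone n \<gamma> J j"
  by (induction j rule: dec_induct) auto

text \<open>Increments cannot grow, so if the bound fails, they are below \<open>\<gamma>\<close> from the first milestone on. With
  fewer than \<open>\<gamma>\<close> possible drops in the \<open>\<gamma>\<close> intervals between milestones, they are constant on one of these.\<close>

lemma growth_of_restriction:
  fixes G0 :: "(nat, 'k::field_char_0) mpoly set"
  assumes n: "n \<ge> 3"
    and G0: "vs.subspace G0" "G0 \<subseteq> forms n d" "vs.dim G0 \<le> \<gamma>" and A: "A \<in> GL n"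
    and max: "\<And>M. M \<le> milestone n \<gamma> J \<gamma> \<Longrightarrow> max_rank n ((shift n ^^ M) G0) A"
    and free: "\<And>M. M \<le> milestone n \<gamma> J \<gamma> \<Longrightarrow> \<gamma> * card (mons n M) \<le> vs.dim ((shift n ^^ M) G0)"
    and G: "G = restrict2 ` coord_change n A ` G0"
  shows "\<gamma> * J \<le> growth G J"
proof (rule ccontr)
  assume less: "\<not> \<gamma> * J \<le> growth G J"
  let ?m = "milestone n \<gamma> J"
  have Gsub: "vs.subspace G" unfolding G
    by (intro vsp.linear_subspace_image[OF linear_restrict2] coord_change_image(1)[OF G0(1,2)])
  have Gforms: "G \<subseteq> forms 2 d"
    unfolding G using coord_change_image(2)[OF G0(1,2)] restrict2_in_forms by blast
  note GG = Gsub Gforms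
  have "\<exists>j<J. increment G j < \<gamma>"
  proof (rule ccontr)
    assume neg: "\<not> ?thesis"
    have "\<gamma> * j \<le> growth G j" if "j \<le> J" for j
      using that
    proof (induction j)
      case (Suc j)
      have "\<gamma> \<le> increment G j" using neg Suc.prems by (meson Suc_le_lessD not_less)
      then show ?case using Suc growth_Suc[OF GG, of j] by simp
    qed simp
    then show False using less by blast
  qed
  then obtain j where "j < J" "increment G j < \<gamma>" by blast
  then have start: "increment G (?m 0) < \<gamma>"
    using increment_antimono[OF GG, of j J] by simp
  have dim_G: "vs.dim G \<le> \<gamma>"
  proof -
    have "linear_map (\<lambda>p. restrict2 (coord_change n A p))"
      using Vector_Spaces.linear_compose[OF linear_coord_change[of n A] linear_restrict2] by (simp add: comp_def)
    then have "vs.dim G \<le> vs.dim G0"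
      unfolding G image_image using vsp.dim_image_le_finite fin_span_subset_forms[OF G0(2)] by blast
    then show ?thesis using G0(3) by simp
  qed
  have drop: "increment G (?m (Suc i)) < increment G (?m i)" if i: "i < \<gamma>" for i
  proof (rule ccontr)
    assume "\<not> ?thesis"
    moreover have le: "?m i \<le> ?m (Suc i)" by (rule milestone_mono) simp
    ultimately have eq: "increment G (?m i) = increment G (?m (Suc i))"
      using increment_antimono[OF GG le] by simp
    define L where "L = 2 * (4 ^ n * (2 ^ ?m i * \<gamma> + 1))"
    have m: "?m (Suc i) = ?m i + L" by (simp add: L_def)
    have bound: "?m i + L \<le> ?m \<gamma>" unfolding m[symmetric] using i by (intro milestone_mono) simp
    have "increment G (?m i) < \<gamma>"
      using increment_antimono[OF GG milestone_mono[of 0 i n \<gamma> J]] start by simp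
    moreover have "growth G (?m i) \<le> 2 ^ ?m i * \<gamma>"
      using growth_bound[OF GG, of "?m i"] dim_G by (meson mult_le_mono2 order_trans)
    ultimately show False
      using no_long_constant_increment[OF n G0(1,2) A max[OF bound] free[OF bound] G _ _ L_def] eq m by simp
  qed
  have "increment G (?m i) + i < \<gamma>" if "i \<le> \<gamma>" for i
    using that
  proof (induction i)
    case (Suc i)
    then show ?case using drop[of i] by simp
  qed (use start in simp)
  then show False by (metis le_add2 not_less order_refl)
qed

section \<open>Generators bound the degree parts\<close>

definition generator_multiples :: "nat \<Rightarrow> (nat, 'k::field_char_0) mpoly set \<Rightarrow> nat \<Rightarrow> (nat, 'k) mpoly set"
  where "generator_multiples n G d = {monomial w * g |w g e f. g \<in> G \<and> g \<in> forms n e \<and> w \<in> mons n f \<and> f + e = d}"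

lemma generator_multiplesI:
  "g \<in> G \<Longrightarrow> g \<in> forms n e \<Longrightarrow> w \<in> mons n f \<Longrightarrow> f + e = d \<Longrightarrow> monomial w * g \<in> generator_multiples n G d"
  unfolding generator_multiples_def by blast

text \<open>The polynomials all of whose homogeneous components lie in the respective spans form an ideal that
  contains the generators.\<close>

lemma degree_part_subset_span:
  fixes G :: "(nat, 'k::field_char_0) mpoly set"
  assumes G: "\<forall>g\<in>G. \<exists>d. is_form n d g" and I: "genideal (poly_ring n) G = I"
  shows "degree_part n I d \<subseteq> vs.span (generator_multiples n G d)"
proof -
  let ?S = "\<lambda>d. vs.span (generator_multiples n G d)"
  let ?X = "{p \<in> polys_in {1..n}. \<forall>d. proj (mons n d) p \<in> ?S d}"
  have mult: "monomial w * p \<in> ?S (f + d)" if w: "w \<in> mons n f" and p: "p \<in> ?S d" for w f p d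
  proof -
    have "monomial w * p \<in> (*) (monomial w) ` ?S d" using p by blast
    also have "\<dots> = vs.span ((*) (monomial w) ` generator_multiples n G d)"
      using vsp.linear_span_image[OF linear_mult_left, of "monomial w" "generator_multiples n G d"] by simp
    also have "\<dots> \<subseteq> ?S (f + d)"
    proof (rule vs.span_mono, rule image_subsetI)
      fix q assume "q \<in> generator_multiples n G d"
      then obtain v g e h where q: "q = monomial v * g" "g \<in> G" "g \<in> forms n e" "v \<in> mons n h" "h + e = d"
        unfolding generator_multiples_def by blast
      have "monomial w * q = monomial (w + v) * g" by (simp add: q(1) monomial_add mult.assoc)
      moreover have "w + v \<in> mons n (f + h)" by (rule mons_add[OF w q(4)])
      ultimately show "monomial w * q \<in> generator_multiples n G (f + d)"
        using generator_multiplesI[OF q(2,3), of "w + v" "f + h" "f + d"] q(5) by simp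
    qed
    finally show ?thesis .
  qed
  have "ideal ?X (poly_ring n)"
  proof (rule poly_idealI)
    show "0 \<in> ?X" by (simp add: polys_in_def vs.span_zero)
    show "p + q \<in> ?X" if "p \<in> ?X" "q \<in> ?X" for p q
      using that by (simp add: polys_in_add vsp.linear_add[OF linear_proj] vs.span_add)
    show "q * p \<in> ?X" if p: "p \<in> ?X" and q: "q \<in> polys_in {1..n}" for p q
    proof -
      have "proj (mons n d) (q * p) \<in> ?S d" for d
      proof -
        have keys: "keys m \<subseteq> {1..n}" if "m \<in> keys q" for m
          using that q unfolding polys_in_def by blast
        have "proj (mons n d) (q * p) = (\<Sum>m\<in>keys q. scale (lookup q m)
            (if mon_deg m \<le> d then monomial m * proj (mons n (d - mon_deg m)) p else 0))"
          unfolding mult_expand_left[of q p] vsp.linear_sum[OF linear_proj] vsp.linear_scale[OF linear_proj]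
          by (intro sum.cong refl arg_cong[of _ _ "scale _"] proj_monomial_mult keys)
        also have "\<dots> \<in> ?S d"
        proof (intro vs.span_sum vs.span_scale)
          fix m assume "m \<in> keys q"
          then have "m \<in> mons n (mon_deg m)" using keys by (simp add: mons_def)
          moreover have "proj (mons n (d - mon_deg m)) p \<in> ?S (d - mon_deg m)" using p by blast
          ultimately have "monomial m * proj (mons n (d - mon_deg m)) p \<in> ?S (mon_deg m + (d - mon_deg m))"
            by (rule mult)
          then show "(if mon_deg m \<le> d then monomial m * proj (mons n (d - mon_deg m)) p else 0) \<in> ?S d"
            by (cases "mon_deg m \<le> d") (simp_all add: vs.span_zero)
        qed
        finally show ?thesis .
      qed
      then show ?thesis using p polys_in_mult[OF q, of p] by simp
    qed
  qed blast
  moreover have "G \<subseteq> ?X"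
  proof
    fix g assume g: "g \<in> G"
    then obtain e where e: "g \<in> forms n e" using G is_form_iff by blast
    have "proj (mons n d) g = (if d = e then g else 0)" for d
      using e by (intro poly_mapping_eqI) (auto simp: lookup_proj forms_def mons_def supported_def in_keys_iff)
    moreover have "g \<in> generator_multiples n G e"
    proof -
      have "0 \<in> mons n 0" by (simp add: mons_def)
      from generator_multiplesI[OF g e this] show ?thesis by (simp add: monomial_zero)
    qed
    ultimately have "proj (mons n d) g \<in> ?S d" for d by (simp add: vs.span_zero vs.span_base)
    then show "g \<in> ?X" using e forms_subset_polys_in[of n e] by blast
  qed
  ultimately have "I \<subseteq> ?X" unfolding I[symmetric] by (rule genideal_poly_minimal)
  show ?thesis
  proof
    fix p assume "p \<in> degree_part n I d"
    then have p: "p \<in> I" "p \<in> forms n d" by (simp_all add: degree_part_def)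
    have "proj (mons n d) p \<in> ?S d" using \<open>I \<subseteq> ?X\<close> p(1) by blast
    moreover have "proj (mons n d) p = p"
      using p(2) by (intro poly_mapping_eqI) (simp add: lookup_proj forms_def supportedD)
    ultimately show "p \<in> ?S d" by simp
  qed
qed

text \<open>By definition of \<open>\<alpha>(I)\<close> no generator has smaller degree, so only those of degrees \<open>\<alpha>(I), \<dots>, \<alpha>(I) + k\<close>
  contribute.\<close>

lemma dim_degree_part_le:
  fixes I :: "(nat, 'k::field_char_0) mpoly set"
  assumes G: "minimal_generators n I G"
    and b: "\<And>j. j \<le> k \<Longrightarrow> card {g\<in>G. is_form n (alpha n I + j) g} = b j"
  shows "vs.dim (degree_part n I (alpha n I + k)) \<le> (\<Sum>j\<le>k. card (mons n (k - j)) * b j)"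
proof -
  let ?\<alpha> = "alpha n I" and ?F = "\<lambda>j. {g\<in>G. is_form n (alpha n I + j) g}"
  have G': "finite G" "\<forall>g\<in>G. \<exists>d. is_form n d g" "genideal (poly_ring n) G = I"
    using G by (simp_all add: minimal_generators_def)
  let ?M = "\<Union>j\<le>k. (\<lambda>(w, g). monomial w * g) ` (mons n (k - j) \<times> ?F j)"
  have "generator_multiples n G (?\<alpha> + k) \<subseteq> insert 0 ?M"
  proof
    fix p assume "p \<in> generator_multiples n G (?\<alpha> + k)"
    then obtain w g e f where p: "p = monomial w * g" "g \<in> G" "g \<in> forms n e" "w \<in> mons n f" "f + e = ?\<alpha> + k"
      unfolding generator_multiples_def by blast
    show "p \<in> insert 0 ?M"
    proof (cases "g = 0")
      case False
      then have form: "is_form n e g" using p(3) by (simp add: is_form_iff)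
      then have "?\<alpha> \<le> e" unfolding alpha_def using G p(2) by (intro Least_le) blast
      then have "e = ?\<alpha> + (e - ?\<alpha>)" "e - ?\<alpha> \<le> k" "f = k - (e - ?\<alpha>)" using p(5) by auto
      then have "(w, g) \<in> mons n (k - (e - ?\<alpha>)) \<times> ?F (e - ?\<alpha>)" using p(2,4) form by simp
      then have "p \<in> (\<lambda>(w, g). monomial w * g) ` (mons n (k - (e - ?\<alpha>)) \<times> ?F (e - ?\<alpha>))"
        using p(1) by (intro image_eqI[of _ _ "(w, g)"]) simp_all
      then show ?thesis using \<open>e - ?\<alpha> \<le> k\<close> by blast
    qed (simp add: p(1))
  qed
  then have "degree_part n I (?\<alpha> + k) \<subseteq> vs.span (insert 0 ?M)"
    using degree_part_subset_span[OF G'(2,3)] vs.span_mono by (meson subset_trans)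
  then have "degree_part n I (?\<alpha> + k) \<subseteq> vs.span ?M" by simp
  moreover have fin: "finite (mons n (k - j) \<times> ?F j)" for j using G'(1) finite_mons by auto
  ultimately have "vs.dim (degree_part n I (?\<alpha> + k)) \<le> card ?M" by (intro vs.dim_le_card) auto
  also have "\<dots> \<le> (\<Sum>j\<le>k. card ((\<lambda>(w, g). monomial w * g) ` (mons n (k - j) \<times> ?F j)))"
    by (intro card_UN_le) simp
  also have "\<dots> \<le> (\<Sum>j\<le>k. card (mons n (k - j) \<times> ?F j))"
    by (intro sum_mono card_image_le fin)
  also have "\<dots> = (\<Sum>j\<le>k. card (mons n (k - j)) * b j)"
    by (intro sum.cong) (simp_all add: card_cartesian_product b)
  finally show ?thesis .
qed

section \<open>Regular sequences have no relations of small degree\<close>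

text \<open>By regularity the last coefficient lies in the ideal of the preceding forms. This ideal has no
  elements with terms of degree less than \<open>\<alpha>\<close>, so the coefficient vanishes and induction applies.\<close>

lemma regular_sequence_no_relation:
  fixes f p :: "nat \<Rightarrow> (nat, 'k::field_char_0) mpoly"
  assumes reg: "regular_sequence (poly_ring n) l f"
    and f: "\<And>i. i \<in> {1..l} \<Longrightarrow> \<forall>m\<in>keys (f i). \<alpha> \<le> mon_deg m"
    and p: "\<And>i. p i \<in> polys_in {1..n}" "\<And>i m. m \<in> keys (p i) \<Longrightarrow> mon_deg m < \<alpha>"
    and rel: "\<gamma> \<le> l" "(\<Sum>i\<in>{1..\<gamma>}. p i * f i) = 0"
  shows "\<forall>i\<in>{1..\<gamma>}. p i = 0"
  using rel
proof (induction \<gamma>)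
  case (Suc \<gamma>)
  let ?J = "genideal (poly_ring n) (f ` {1..<Suc \<gamma>})"
  have f_in: "f i \<in> polys_in {1..n}" if "i \<in> {1..l}" for i
    using reg that unfolding regular_sequence_def by simp
  have gens: "f ` {1..<Suc \<gamma>} \<subseteq> polys_in {1..n}" using f_in Suc.prems(1) by auto
  note J = genideal_poly[OF gens]
  have "p (Suc \<gamma>) * f (Suc \<gamma>) = - (\<Sum>i\<in>{1..\<gamma>}. p i * f i)"
    using Suc.prems(2) by (simp add: eq_neg_iff_add_eq_0 add.commute)
  also have "\<dots> = (\<Sum>i\<in>{1..\<gamma>}. (- p i) * f i)" by (simp add: sum_negf)
  also have "\<dots> \<in> ?J"
  proof (rule poly_ideal_sum[OF J(1)])
    fix i assume "i \<in> {1..\<gamma>}"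
    then have "f i \<in> ?J" using J(2) by auto
    moreover have "- p i \<in> polys_in {1..n}" using p(1)[of i] by (simp add: polys_in_def in_keys_iff)
    ultimately show "(- p i) * f i \<in> ?J" by (rule poly_idealD(4)[OF J(1)])
  qed
  finally have "f (Suc \<gamma>) * p (Suc \<gamma>) \<in> ?J" by (simp add: mult.commute)
  then have pJ: "p (Suc \<gamma>) \<in> ?J"
    using reg p(1)[of "Suc \<gamma>"] Suc.prems(1) unfolding regular_sequence_def by simp
  let ?X = "{q \<in> polys_in {1..n}. \<forall>m\<in>keys q. \<alpha> \<le> mon_deg m} :: (nat, 'k) mpoly set"
  have "ideal ?X (poly_ring n)"
  proof (rule poly_idealI)
    show "q + q' \<in> ?X" if "q \<in> ?X" "q' \<in> ?X" for q q'
      using that polys_in_add[of q "{1..n}" q'] Poly_Mapping.keys_add[of q q'] by blast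
    show "q' * q \<in> ?X" if q: "q \<in> ?X" "q' \<in> polys_in {1..n}" for q q'
    proof -
      have "\<alpha> \<le> mon_deg m" if m: "m \<in> keys (q' * q)" for m
      proof -
        obtain u w where "w \<in> keys q" "m = u + w" using m keys_mult[of q' q] by blast
        then show ?thesis using q(1) by (auto intro: trans_le_add2)
      qed
      then show ?thesis using polys_in_mult[OF q(2), of q] q(1) by blast
    qed
  qed (auto simp: polys_in_def)
  moreover have "f ` {1..<Suc \<gamma>} \<subseteq> ?X"
  proof (rule image_subsetI)
    fix i assume "i \<in> {1..<Suc \<gamma>}"
    then have "i \<in> {1..l}" using Suc.prems(1) by simp
    then show "f i \<in> ?X" using f f_in by blast
  qed
  ultimately have "?J \<subseteq> ?X" by (rule genideal_poly_minimal)
  then have "\<alpha> \<le> mon_deg m" if "m \<in> keys (p (Suc \<gamma>))" for m using pJ that by blast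
  then have "keys (p (Suc \<gamma>)) = {}" using p(2)[of _ "Suc \<gamma>"] by (meson all_not_in_conv not_less)
  then have zero: "p (Suc \<gamma>) = 0" by simp
  then have "(\<Sum>i\<in>{1..\<gamma>}. p i * f i) = 0" using Suc.prems(2) by simp
  then have "\<forall>i\<in>{1..\<gamma>}. p i = 0" using Suc.IH Suc.prems(1) by simp
  then show ?case using zero by (auto simp: le_Suc_eq)
qed simp

lemma monomial_mult_in_shift_power:
  fixes V :: "(nat, 'k::field_char_0) mpoly set"
  assumes "v \<in> V" "w \<in> mons n M"
  shows "monomial w * v \<in> (shift n ^^ M) V"
  using assms(2)
proof (induction M arbitrary: w)
  case 0
  then have "w = 0" by (auto simp: mons_def mon_deg_def in_keys_iff intro!: poly_mapping_eqI)
  then show ?case using assms(1) by (simp add: monomial_zero)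
next
  case (Suc M)
  then have "w \<noteq> 0" by (auto simp: mons_def)
  then obtain i where i: "i \<in> keys w" by (meson all_not_in_conv keys_eq_empty)
  define w' where "w' = w - single i 1"
  have w: "w = single i 1 + w'"
    using i by (intro poly_mapping_eqI)
      (auto simp: w'_def lookup_add lookup_minus lookup_single when_def in_keys_iff)
  have "keys w' \<subseteq> keys w" by (auto simp: w'_def in_keys_iff lookup_minus)
  moreover have "mon_deg w' = M" using Suc.prems arg_cong[OF w, of mon_deg] by (simp add: mons_def)
  ultimately have w': "w' \<in> mons n M" and i': "i \<in> {1..n}" using Suc.prems i unfolding mons_def by auto
  have "var i * (monomial w' * v) \<in> shift n ((shift n ^^ M) V)"
    by (rule var_mult_in_shift[OF i' Suc.IH[OF w']])
  moreover have "(monomial w :: (nat, 'k) mpoly) = var i * monomial w'" by (subst w) (rule monomial_add)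
  ultimately show ?case by (simp add: mult.assoc)
qed

text \<open>A relation between the raised forms is a relation between the original forms, with the powers of
  \<open>x\<^sub>1\<close> moved into the coefficients; their degrees are still less than \<open>\<alpha>\<close>.\<close>

lemma regular_sequence_free:
  fixes f :: "nat \<Rightarrow> (nat, 'k::field_char_0) mpoly"
  assumes n: "n \<ge> 1" and reg: "regular_sequence (poly_ring n) l f" and \<gamma>: "\<gamma> \<le> l"
    and f: "\<And>i. i \<in> {1..l} \<Longrightarrow> f i \<in> forms n (\<alpha> + a i)"
    and small: "\<And>i. i \<in> {1..\<gamma>} \<Longrightarrow> s i + M < \<alpha>"
  defines "g \<equiv> \<lambda>i. monomial (single 1 (s i)) * f i"
    and "G0 \<equiv> vs.span ((\<lambda>i. monomial (single 1 (s i)) * f i) ` {1..\<gamma>})"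
  assumes G0: "G0 \<subseteq> forms n d"
  shows "\<gamma> * card (mons n M) \<le> vs.dim ((shift n ^^ M) G0)"
proof -
  let ?X = "{1..\<gamma>} \<times> mons n M" and ?h = "\<lambda>(i, w). monomial w * g i"
  have finX: "finite ?X" using finite_mons by auto
  have zero: "\<forall>x\<in>?X. c x = 0" if c: "(\<Sum>x\<in>?X. scale (c x) (?h x)) = 0" for c
  proof -
    define q where "q i = (\<Sum>w\<in>mons n M. scale (c (i, w)) (monomial w))" for i
    define p where "p i = (if i \<in> {1..\<gamma>} then monomial (single 1 (s i)) * q i else 0)" for i
    have q: "q i \<in> forms n M" for i unfolding q_def
      by (intro vs.subspace_sum[OF subspace_forms] vs.subspace_scale[OF subspace_forms] monomial_in_forms)
    have p_forms: "p i \<in> forms n (s i + M)" for i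
    proof -
      have "(monomial (single 1 (s i)) :: (nat, 'k) mpoly) \<in> forms n (s i)"
        using n by (intro monomial_in_forms single_in_mons) simp
      then show ?thesis
        using forms_mult[OF _ q] by (simp add: p_def vs.subspace_0[OF subspace_forms])
    qed
    have "0 = (\<Sum>i\<in>{1..\<gamma>}. \<Sum>w\<in>mons n M. scale (c (i, w)) (monomial w * g i))"
      using c by (simp add: sum.cartesian_product case_prod_unfold)
    also have "\<dots> = (\<Sum>i\<in>{1..\<gamma>}. p i * f i)"
    proof (rule sum.cong[OF refl])
      fix i assume "i \<in> {1..\<gamma>}"
      then have "p i * f i = q i * g i" by (simp add: p_def g_def ac_simps)
      then show "(\<Sum>w\<in>mons n M. scale (c (i, w)) (monomial w * g i)) = p i * f i"
        by (simp add: q_def sum_distrib_right scale_mult)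
    qed
    finally have rel: "(\<Sum>i\<in>{1..\<gamma>}. p i * f i) = 0" by simp
    have "\<forall>i\<in>{1..\<gamma>}. p i = 0"
    proof (rule regular_sequence_no_relation[OF reg _ _ _ \<gamma> rel])
      show "\<forall>m\<in>keys (f i). \<alpha> \<le> mon_deg m" if "i \<in> {1..l}" for i
        using f[OF that] by (auto simp: forms_def supported_def mons_def)
      show "p i \<in> polys_in {1..n}" for i using p_forms forms_subset_polys_in by blast
      show "mon_deg m < \<alpha>" if m: "m \<in> keys (p i)" for i m
      proof -
        have "i \<in> {1..\<gamma>}" using m by (auto simp: p_def split: if_splits)
        moreover have "mon_deg m = s i + M" using m p_forms[of i] by (auto simp: forms_def supported_def mons_def)
        ultimately show ?thesis using small by simp
      qed
    qed
    then have q0: "q i = 0" if "i \<in> {1..\<gamma>}" for i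
      using that monomial_mult_inject[of "single 1 (s i)" "q i" 0] by (auto simp: p_def)
    show ?thesis
    proof (rule ballI, clarify)
      fix i w assume i: "i \<in> {1..\<gamma>}" and w: "w \<in> mons n M"
      have "lookup (q i) w = (\<Sum>v\<in>mons n M. if v = w then c (i, v) else 0)"
        unfolding q_def lookup_sum by (intro sum.cong) (auto simp: monomial_def lookup_single when_def)
      then show "c (i, w) = 0" using q0[OF i] w finite_mons by simp
    qed
  qed
  note ind = independent_family[OF finX zero]
  have sub: "?h ` ?X \<subseteq> (shift n ^^ M) G0"
  proof (rule image_subsetI, clarify)
    fix i w assume i: "i \<in> {1..\<gamma>}" and w: "w \<in> mons n M"
    have "g i \<in> G0" unfolding g_def G0_def using i by (intro vs.span_base) blast
    then show "monomial w * g i \<in> (shift n ^^ M) G0" by (rule monomial_mult_in_shift_power[OF _ w])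
  qed
  have "card (?h ` ?X) \<le> vs.dim ((shift n ^^ M) G0)"
    by (rule vs.independent_card_le_dim[OF fin_span_subset_forms[OF shift_power_subset_forms[OF G0]] sub ind(2)])
  moreover have "card (?h ` ?X) = \<gamma> * card (mons n M)"
    by (simp add: card_image[OF ind(1)] card_cartesian_product)
  ultimately show ?thesis by simp
qed

section \<open>Uncovered monomials\<close>

definition tail :: "nat \<Rightarrow> (nat \<Rightarrow> nat) \<Rightarrow> (nat \<Rightarrow>\<^sub>0 nat)"
  where "tail r e = (\<Sum>i\<in>{3..r}. single i (e i))"

lemma lookup_tail: "lookup (tail r e) i = (if i \<in> {3..r} then e i else 0)"
proof -
  have "lookup (tail r e) i = (\<Sum>j\<in>{3..r}. if j = i then e j else 0)"
    unfolding tail_def lookup_sum by (intro sum.cong) (auto simp: lookup_single when_def)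
  then show ?thesis by simp
qed

lemma keys_tail: "r \<le> n \<Longrightarrow> keys (tail r e) \<subseteq> {3..n}"
  by (auto simp: in_keys_iff lookup_tail split: if_splits)

lemma mon_deg_tail: "mon_deg (tail r e) = (\<Sum>i\<in>{3..r}. e i)"
proof -
  have "mon_deg (tail r e) = (\<Sum>i\<in>{3..r}. lookup (tail r e) i)"
    using keys_tail[of r r e] by (intro mon_deg_superset) auto
  then show ?thesis by (simp add: lookup_tail)
qed

lemma tail_increment: "3 \<le> r \<Longrightarrow> tail r (e(r := e r + 1)) = tail r e + single r 1"
  by (intro poly_mapping_eqI) (auto simp: lookup_tail lookup_add lookup_single when_def)

definition binary :: "nat \<Rightarrow> nat \<Rightarrow> (nat \<Rightarrow>\<^sub>0 nat)"
  where "binary x j = single 1 (x - j) + single 2 j"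

lemma mon_eq_tail_binary: "mon r e (x - j) j = tail r e + binary x j"
  by (simp add: mon_def tail_def binary_def ac_simps)

lemma binary_in_mons: "j \<le> x \<Longrightarrow> binary x j \<in> mons 2 x"
  unfolding binary_def using mons_add[OF single_in_mons[of 1 2 "x - j"] single_in_mons[of 2 2 j]] by simp

lemma inj_binary: "binary x i = binary x j \<Longrightarrow> i = j"
proof -
  assume "binary x i = binary x j"
  from arg_cong[OF this, of "\<lambda>p. lookup p 2"] show "i = j"
    by (simp add: binary_def lookup_add lookup_single when_def)
qed

lemma mons_2_eq: "mons 2 x = binary x ` {..x}"
proof (rule card_subset_eq[symmetric, OF finite_mons])
  show "binary x ` {..x} \<subseteq> mons 2 x" using binary_in_mons by auto
  have "inj_on (binary x) {..x}" using inj_binary by (intro inj_onI)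
  then show "card (binary x ` {..x}) = card (mons 2 x)" by (simp add: card_image card_mons_2)
qed

lemma card_binary_leading:
  fixes V :: "(nat, 'k::field_char_0) mpoly set"
  assumes "vs.subspace V" "V \<subseteq> forms 2 x"
  shows "card {j. j \<le> x \<and> binary x j \<in> leading V} = vs.dim V"
proof -
  have "leading V = binary x ` {j. j \<le> x \<and> binary x j \<in> leading V}"
    using leading_subset_mons[OF assms(2)] unfolding mons_2_eq by auto
  moreover have "inj_on (binary x) {j. j \<le> x \<and> binary x j \<in> leading V}" using inj_binary by (intro inj_onI)
  ultimately have "card {j. j \<le> x \<and> binary x j \<in> leading V} = card (leading V)" by (metis card_image)
  then show ?thesis using card_leading[OF assms] by simp
qed

text \<open>A monomial of the first slice is uncovered unless its partner belongs to the second slice; the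
  monomial with \<open>j = 0\<close> has no partner and is not counted, hence the successor.\<close>

lemma ubl_ge_slices:
  fixes I :: "(nat, 'k::field_char_0) mpoly set"
  assumes I: "homogeneous_ideal n I" and A: "A \<in> GL n" "initial_ideal n (coord_change n A ` I) = gin n I"
    and r: "r \<in> {3..n}" and d: "mon_deg (tail r e) + Suc x = d"
  defines "Y \<equiv> coord_change n A ` degree_part n I d"
  shows "vs.dim (slice (tail r e) (Suc x) Y)
    \<le> Suc (ubl n I r e d) + vs.dim (slice (tail r e + single r 1) x Y)"
proof -
  have id: "ideal I (poly_ring n)" using I by (simp add: homogeneous_ideal_def)
  note Y = coord_change_image[OF subspace_degree_part[OF id] degree_part_subset, of A d, folded Y_def]
  let ?c = "tail r e" and ?c' = "tail r e + single r 1"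
  let ?E = "\<Sum>i\<in>{3..r}. e i"
  have c: "keys ?c \<subseteq> {3..n}" "keys ?c' \<subseteq> {3..n}"
    using keys_tail[of r n e] r by (auto simp: keys_add_nat)
  have E: "mon_deg ?c = ?E" by (rule mon_deg_tail)
  have gin: "monomial m \<in> gin n I \<longleftrightarrow> m \<in> leading Y" if "mon_deg m = d" for m
    using monomial_in_initial_ideal[OF I A(1), of m] A(2) that by (simp add: Y_def)
  let ?V = "slice ?c (Suc x) Y" and ?W = "slice ?c' x Y"
  have V: "binary (Suc x) j \<in> leading ?V \<longleftrightarrow> monomial (mon r e (d - j - ?E) j) \<in> gin n I" if j: "j \<le> Suc x" for j
  proof -
    have "d - j - ?E = Suc x - j" using d E j by simp
    then have "mon r e (d - j - ?E) j = ?c + binary (Suc x) j"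
      using mon_eq_tail_binary[of r e "Suc x" j] by simp
    moreover have "mon_deg (?c + binary (Suc x) j) = d" using binary_in_mons[OF j] d by (simp add: mons_def)
    ultimately show ?thesis using leading_slice[OF Y(2) c(1) d binary_in_mons[OF j]] gin by simp
  qed
  have W: "binary x (j - 1) \<in> leading ?W \<longleftrightarrow> monomial (mon r (e(r := e r + 1)) (d - j - ?E) (j - 1)) \<in> gin n I"
    if j: "1 \<le> j" "j \<le> Suc x" for j
  proof -
    have j': "j - 1 \<le> x" using j by simp
    have d': "mon_deg ?c' + x = d" using d by simp
    have "d - j - ?E = x - (j - 1)" using d E j by simp
    then have "mon r (e(r := e r + 1)) (d - j - ?E) (j - 1) = ?c' + binary x (j - 1)"
      using mon_eq_tail_binary[of r "e(r := e r + 1)" x "j - 1"] tail_increment[of r e] r by simp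
    moreover have "mon_deg (?c' + binary x (j - 1)) = d" using binary_in_mons[OF j'] d' by (simp add: mons_def)
    ultimately show ?thesis using leading_slice[OF Y(2) c(2) d' binary_in_mons[OF j']] gin by simp
  qed
  let ?J = "{j. j \<in> {1..d - ?E} \<and> uncovered n I r e d j}"
  let ?JV = "{j. j \<le> Suc x \<and> binary (Suc x) j \<in> leading ?V}" and ?JW = "{j. j \<le> x \<and> binary x j \<in> leading ?W}"
  have x: "d - ?E = Suc x" using d E by simp
  have "?JV \<subseteq> insert 0 (?J \<union> Suc ` ?JW)"
  proof
    fix j assume j: "j \<in> ?JV"
    show "j \<in> insert 0 (?J \<union> Suc ` ?JW)"
    proof (cases "j = 0 \<or> binary x (j - 1) \<in> leading ?W")
      case True
      then show ?thesis using j by (cases j) auto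
    next
      case False
      then have "uncovered n I r e d j" using j V[of j] W[of j] unfolding uncovered_def by simp
      then show ?thesis using j False x by simp
    qed
  qed
  moreover have "finite ?J" "finite ?JW" by (simp_all)
  ultimately have "card ?JV \<le> card (insert 0 (?J \<union> Suc ` ?JW))" by (intro card_mono) auto
  also have "\<dots> \<le> Suc (card (?J \<union> Suc ` ?JW))" by (rule card_insert_le_m1) simp_all
  also have "\<dots> \<le> Suc (card ?J + card (Suc ` ?JW))" using card_Un_le by simp
  also have "card (Suc ` ?JW) = card ?JW" by (simp add: card_image)
  also have "card ?J = ubl n I r e d"
  proof -
    have "{mon r e (d - j - ?E) j |j. j \<in> {1..d - ?E} \<and> uncovered n I r e d j}
        = (\<lambda>j. mon r e (d - j - ?E) j) ` ?J" by blast
    moreover have "inj_on (\<lambda>j. mon r e (d - j - ?E) j) ?J"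
    proof (rule inj_onI)
      fix i j assume "mon r e (d - i - ?E) i = mon r e (d - j - ?E) j"
      from arg_cong[OF this, of "\<lambda>p. lookup p 2"] show "i = j"
        using lookup_tail[of r e 2] by (simp add: mon_def tail_def[symmetric] lookup_add lookup_single when_def)
    qed
    ultimately show ?thesis unfolding ubl_def by (simp add: card_image)
  qed
  finally show ?thesis
    using card_binary_leading[OF subspace_slice[OF Y(1)] slice_subset] by simp
qed

text \<open>A monomial outside the line involves a variable after the second; the last such variable shows that
  its product with \<open>x\<^sup>c\<close> is below the slice.\<close>

lemma restrict2_in_slice:
  fixes Y :: "(nat, 'k::field_char_0) mpoly set"
  assumes y: "y \<in> forms n x" "monomial c * y \<in> Y"
  shows "restrict2 y \<in> slice c x Y"
proof -
  define q where "q = y - restrict2 y"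
  have "below c m" if m: "m \<in> keys (monomial c * q)" for m
  proof -
    obtain m' where m': "m' \<in> keys q" "m = c + m'" using m by (auto simp: keys_monomial_mult)
    have "m' \<in> keys y" "\<not> keys m' \<subseteq> {1..2}"
      using m'(1) by (auto simp: q_def restrict2_def in_keys_iff lookup_minus lookup_proj split: if_splits)
    moreover have "keys m' \<subseteq> {1..n}"
      using calculation(1) y(1) by (auto simp: forms_def supported_def mons_def)
    ultimately obtain i where i: "i \<in> keys m'" "3 \<le> i" by fastforce
    let ?i = "Max (keys m')"
    have max: "?i \<in> keys m'" "i \<le> ?i" using i(1) by (auto intro: Max_in)
    have "j \<notin> keys m'" if "j > ?i" for j
    proof
      assume "j \<in> keys m'"
      then have "j \<le> ?i" by (intro Max_ge) auto
      then show False using that by simp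
    qed
    then show ?thesis
      using max i(2) unfolding below_def m'(2)
      by (intro exI[of _ ?i]) (auto simp: lookup_add in_keys_iff)
  qed
  moreover have "monomial c * restrict2 y + monomial c * q \<in> Y"
    using y(2) by (simp add: q_def algebra_simps)
  ultimately show ?thesis using restrict2_in_forms[OF y(1)] unfolding slice_def by blast
qed

text \<open>If \<open>V\<close> exceeded \<open>W\<close> by less than \<open>\<gamma>\<close>, the increments of \<open>V\<close> would stay below \<open>\<gamma>\<close>, so that after \<open>J\<close>
  steps \<open>V\<close>, starting from less than \<open>J\<close> dimensions, would have fewer dimensions than the space \<open>G\<close>
  inside it.\<close>

lemma slices_gap:
  fixes V W G :: "(nat, 'k::field_char_0) mpoly set"
  assumes V: "vs.subspace V" "V \<subseteq> forms 2 (Suc x)" and W: "vs.subspace W"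
    and WV: "\<And>i w. i \<in> {1..2} \<Longrightarrow> w \<in> W \<Longrightarrow> var i * w \<in> V"
    and GV: "G \<subseteq> V" and growth: "\<gamma> * J \<le> growth G J" and J: "vs.dim V < J"
  shows "vs.dim W + \<gamma> \<le> vs.dim V"
proof (rule ccontr)
  assume less: "\<not> ?thesis"
  have "growth V 0 = vs.dim V" "growth V (Suc 0) = vs.dim (shift 2 V)" by (simp_all add: growth_def)
  then have "vs.dim V + increment V 0 + vs.dim W \<le> 2 * vs.dim V"
    using dim_shift_le[OF V W WV] growth_Suc[OF V, of 0] by simp
  then have inc: "increment V 0 < \<gamma>" using less by simp
  have bound: "growth V j + j \<le> vs.dim V + \<gamma> * j" for j
  proof (induction j)
    case (Suc j)
    have "increment V j < \<gamma>" using increment_antimono[OF V, of 0 j] inc by simp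
    then show ?case using Suc growth_Suc[OF V, of j] by simp
  qed (simp add: growth_def)
  have "growth G J \<le> growth V J"
    unfolding growth_def using shift_power_mono[OF GV]
    by (intro vs.dim_mono_finite fin_span_subset_forms[OF shift_power_subset_forms[OF V(2)]])
  then show False using bound[of J] growth J by simp
qed

theorem theorem1p2:
  fixes n l t :: nat and a b :: "nat \<Rightarrow> nat"
  assumes "n \<ge> 3" and "l \<ge> 1"
  shows "\<exists>D::nat. \<forall>I :: (nat, 'k::field_char_0) mpoly set.
    homogeneous_ideal n I \<and> of_type n l t a b I \<and> alpha n I + a 1 \<ge> 2 \<and> alpha n I \<ge> D \<longrightarrow>
    (\<forall>k\<in>{0..t}. \<forall>r\<in>{3..n}. \<forall>e :: nat \<Rightarrow> nat. (\<Sum>i\<in>{3..r}. e i) \<le> k \<longrightarrow>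
      int (ubl n I r e (alpha n I + k)) \<ge>
        int (gamma n l a I (alpha n I + k - (\<Sum>i\<in>{3..r}. e i))) - 1)"
proof -
  \<comment> \<open>This bounds the dimensions of the degree parts that occur.\<close>
  define C where "C = (\<Sum>k\<le>t. \<Sum>j\<le>k. card (mons n (k - j)) * b j)"
  define J where "J = C + 1"
  \<comment> \<open>For each possible \<open>\<gamma>\<close>, no relations may occur up to the last milestone, also after raising the forms by up to \<open>t\<close>.\<close>
  define D where "D = Suc t + (\<Sum>\<gamma>\<le>l. milestone n \<gamma> J \<gamma>)"
  have main: "int (ubl n I r e (alpha n I + k)) \<ge>
      int (gamma n l a I (alpha n I + k - (\<Sum>i\<in>{3..r}. e i))) - 1"
    if I: "homogeneous_ideal n I" and type: "of_type n l t a b I" and large: "alpha n I \<ge> D"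
      and k: "k \<in> {0..t}" and r: "r \<in> {3..n}" and e: "(\<Sum>i\<in>{3..r}. e i) \<le> k"
    for I :: "(nat, 'k) mpoly set" and k r and e :: "nat \<Rightarrow> nat"
  proof (cases "gamma n l a I (alpha n I + k - (\<Sum>i\<in>{3..r}. e i)) = 0")
    case False
    define \<alpha> where "\<alpha> = alpha n I"
    define d where "d = \<alpha> + k"
    \<comment> \<open>The two slices consist of binary forms of degrees \<open>Suc x\<close> and \<open>x\<close>.\<close>
    define x where "x = d - (\<Sum>i\<in>{3..r}. e i) - 1"
    define \<gamma> where "\<gamma> = gamma n l a I (Suc x)"
    have pos: "0 < \<alpha>" using large by (simp add: \<alpha>_def D_def)
    have x: "d - (\<Sum>i\<in>{3..r}. e i) = Suc x" "mon_deg (tail r e) + Suc x = d"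
      using pos e by (auto simp: x_def d_def mon_deg_tail)
    have id: "ideal I (poly_ring n)" using I by (simp add: homogeneous_ideal_def)
    obtain f where f: "regular_sequence (poly_ring n) l f"
      "\<And>i. i \<in> {1..l} \<Longrightarrow> f i \<in> I \<and> is_form n (\<alpha> + a i) (f i)"
      "\<And>i. i \<in> {1..<l} \<Longrightarrow> a i \<le> a (i + 1)"
      using type unfolding of_type_def \<alpha>_def by auto
    obtain G where G: "minimal_generators n I G" "\<And>j. j \<le> t \<Longrightarrow> card {g\<in>G. is_form n (\<alpha> + j) g} = b j"
      using type unfolding of_type_def \<alpha>_def by auto
    have \<gamma>0: "\<gamma> \<noteq> 0" using False x(1) by (simp add: \<gamma>_def d_def \<alpha>_def)
    have \<gamma>_mem: "\<gamma> \<in> {i\<in>{1..l}. \<alpha> + a i \<le> Suc x}"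
    proof -
      have nonneg: "\<not> Suc x < \<alpha> + a 1" using \<gamma>0 by (auto simp: \<gamma>_def gamma_def \<alpha>_def)
      then have "\<gamma> = Max {i\<in>{1..l}. \<alpha> + a i \<le> Suc x}" by (simp add: \<gamma>_def gamma_def \<alpha>_def)
      moreover have "1 \<in> {i\<in>{1..l}. \<alpha> + a i \<le> Suc x}" using nonneg assms(2) by simp
      moreover have "finite {i\<in>{1..l}. \<alpha> + a i \<le> Suc x}" by simp
      ultimately show ?thesis by (metis Max_in empty_iff)
    qed
    have a_mono: "a i \<le> a j" if "1 \<le> i" "i \<le> j" "j \<le> l" for i j
      using that(2,3)
    proof (induction j rule: dec_induct)
      case (step j)
      then show ?case using f(3)[of j] that(1) by (simp add: Suc_eq_plus1[symmetric] del: Suc_eq_plus1_left)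
    qed simp
    have deg_le: "\<alpha> + a i \<le> Suc x" if "i \<in> {1..\<gamma>}" for i
      using \<gamma>_mem a_mono[of i \<gamma>] that by simp
    \<comment> \<open>The forms are raised to the degree of the first slice.\<close>
    define s where "s i = Suc x - (\<alpha> + a i)" for i
    define G0 where "G0 = vs.span ((\<lambda>i. monomial (single 1 (s i)) * f i) ` {1..\<gamma>})"
    have gens: "(\<lambda>i. monomial (single 1 (s i)) * f i) ` {1..\<gamma>} \<subseteq> degree_part n I (Suc x)"
    proof (rule image_subsetI)
      fix i assume i: "i \<in> {1..\<gamma>}"
      have il: "i \<in> {1..l}" using i \<gamma>_mem by simp
      have "f i \<in> degree_part n I (\<alpha> + a i)" using f(2)[OF il] by (simp add: degree_part_def is_form_iff)
      moreover have "(monomial (single 1 (s i)) :: (nat, 'k) mpoly) \<in> forms n (s i)"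
        using assms(1) by (intro monomial_in_forms single_in_mons) simp
      ultimately have "monomial (single 1 (s i)) * f i \<in> degree_part n I (s i + (\<alpha> + a i))"
        by (rule degree_part_mult[OF id])
      then show "monomial (single 1 (s i)) * f i \<in> degree_part n I (Suc x)"
        using deg_le[OF i] by (simp add: s_def)
    qed
    have G0: "vs.subspace G0" "G0 \<subseteq> degree_part n I (Suc x)" "vs.dim G0 \<le> \<gamma>"
    proof -
      show "vs.subspace G0" by (simp add: G0_def)
      show "G0 \<subseteq> degree_part n I (Suc x)"
        unfolding G0_def by (rule vs.span_minimal[OF gens subspace_degree_part[OF id]])
      have "vs.dim G0 \<le> card ((\<lambda>i. monomial (single 1 (s i)) * f i) ` {1..\<gamma>})"
        unfolding G0_def by (intro vs.dim_le_card) auto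
      also have "\<dots> \<le> card {1..\<gamma>}" by (intro card_image_le) simp
      finally show "vs.dim G0 \<le> \<gamma>" by simp
    qed
    have G0_forms: "G0 \<subseteq> forms n (Suc x)" using G0(2) degree_part_subset by blast
    let ?m = "milestone n \<gamma> J \<gamma>"
    have "?m \<le> (\<Sum>\<gamma>\<le>l. milestone n \<gamma> J \<gamma>)"
      using \<gamma>_mem by (intro member_le_sum[of \<gamma> "{..l}" "\<lambda>\<gamma>. milestone n \<gamma> J \<gamma>"]) auto
    then have m: "?m + t < \<alpha>" using large by (simp add: D_def \<alpha>_def)
    have free: "\<gamma> * card (mons n M) \<le> vs.dim ((shift n ^^ M) G0)" if M: "M \<le> ?m" for M
      unfolding G0_def
    proof (rule regular_sequence_free[OF _ f(1)])
      show "f i \<in> forms n (\<alpha> + a i)" if "i \<in> {1..l}" for i using f(2)[OF that] by (simp add: is_form_iff)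
      show "s i + M < \<alpha>" if "i \<in> {1..\<gamma>}" for i
      proof -
        have "s i \<le> t" using k x(1) by (simp add: s_def d_def)
        then show ?thesis using m M by simp
      qed
      show "vs.span ((\<lambda>i. monomial (single 1 (s i)) * f i) ` {1..\<gamma>}) \<subseteq> forms n (Suc x)"
        using G0_forms by (simp add: G0_def)
    qed (use \<gamma>_mem assms(1) in auto)
    have gen: "generically n (\<lambda>A. (initial_ideal n (coord_change n A ` I) = gin n I \<and>
        max_rank n (degree_part n I d) A) \<and> (\<forall>M\<in>{..?m}. max_rank n ((shift n ^^ M) G0) A))"
    proof (intro generically_conj generically_ball)
      show "generically n (\<lambda>A. initial_ideal n (coord_change n A ` I) = gin n I)" by (rule generically_gin[OF I])
      show "generically n (max_rank n (degree_part n I d))"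
        by (rule generically_max_rank[OF subspace_degree_part[OF id] degree_part_subset])
      show "generically n (max_rank n ((shift n ^^ M) G0))" for M
        by (rule generically_max_rank[OF subspace_shift_power[OF G0(1)] shift_power_subset_forms[OF G0_forms]])
    qed simp
    obtain A where A: "A \<in> GL n" "initial_ideal n (coord_change n A ` I) = gin n I"
      "max_rank n (degree_part n I d) A" "\<And>M. M \<le> ?m \<Longrightarrow> max_rank n ((shift n ^^ M) G0) A"
      using generically_ex[OF gen] by auto
    define H where "H = restrict2 ` coord_change n A ` G0"
    have growth: "\<gamma> * J \<le> growth H J"
      by (rule growth_of_restriction[OF assms(1) G0(1) G0_forms G0(3) A(1) A(4) free H_def])
    define Y where "Y = coord_change n A ` degree_part n I d"
    note Y = coord_change_image[OF subspace_degree_part[OF id] degree_part_subset, of A d, folded Y_def]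
    let ?c = "tail r e"
    let ?V = "slice ?c (Suc x) Y" and ?W = "slice (?c + single r 1) x Y"
    have c_tail: "?c \<in> tails n d" using keys_tail[of r n e] r x(2) by (auto simp: tails_def)
    \<comment> \<open>Multiply the transformed forms by \<open>x\<^sup>c\<close>, which is again the transform of a form.\<close>
    have HV: "H \<subseteq> ?V"
    proof
      fix h assume "h \<in> H"
      then obtain v where v: "v \<in> G0" "h = restrict2 (coord_change n A v)" by (auto simp: H_def)
      obtain B where B: "B \<in> GL n" "A * B = 1\<^sub>m n" "B * A = 1\<^sub>m n" using GL_inverse[OF A(1)] .
      have c_mons: "?c \<in> mons n (mon_deg ?c)" using c_tail by (auto simp: tails_def mons_def)
      let ?q = "coord_change n B (monomial ?c)"
      have "(monomial ?c :: (nat, 'k) mpoly) \<in> polys_in {1..n}"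
        using monomial_in_forms[OF c_mons] forms_subset_polys_in by blast
      then have "coord_change n A ?q = monomial ?c"
        using coord_change_inverse[of B n A] A(1) B by (simp add: GL_def)
      moreover have "?q * v \<in> degree_part n I (mon_deg ?c + Suc x)"
        using G0(2) v(1) by (intro degree_part_mult[OF id] coord_change_in_forms monomial_in_forms[OF c_mons]) blast
      then have "coord_change n A (?q * v) \<in> Y" unfolding Y_def x(2) by blast
      ultimately have "monomial ?c * coord_change n A v \<in> Y" by (simp add: coord_change_mult)
      moreover have "coord_change n A v \<in> forms n (Suc x)"
        using v(1) G0_forms by (intro coord_change_in_forms) blast
      ultimately show "h \<in> ?V" unfolding v(2) by (intro restrict2_in_slice)
    qed
    have "vs.dim ?V \<le> C"
    proof -
      have "vs.dim ?V = vs.dim (slice ?c (d - mon_deg ?c) Y)" using x(2) by (metis add_diff_cancel_left')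
      also have "\<dots> \<le> (\<Sum>c\<in>tails n d. vs.dim (slice c (d - mon_deg c) Y))"
        using c_tail by (intro member_le_sum[of ?c "tails n d" "\<lambda>c. vs.dim (slice c (d - mon_deg c) Y)"] finite_tails) auto
      also have "\<dots> = vs.dim Y" using assms(1) by (intro dim_eq_sum_slices[symmetric] Y) simp
      also have "\<dots> = vs.dim (degree_part n I d)"
        unfolding Y_def by (rule dim_coord_change[OF A(1) subspace_degree_part[OF id] degree_part_subset])
      also have "\<dots> \<le> (\<Sum>j\<le>k. card (mons n (k - j)) * b j)"
        unfolding d_def \<alpha>_def using G(2) k by (intro dim_degree_part_le[OF G(1)]) (simp add: \<alpha>_def)
      also have "\<dots> \<le> C"
        unfolding C_def using k by (intro member_le_sum[of k "{..t}" "\<lambda>k. \<Sum>j\<le>k. card (mons n (k - j)) * b j"]) auto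
      finally show ?thesis .
    qed
    then have "vs.dim ?W + \<gamma> \<le> vs.dim ?V"
    proof (intro slices_gap[OF subspace_slice[OF Y(1)] slice_subset subspace_slice[OF Y(1)] _ HV growth])
      show "var i * w \<in> ?V" if "i \<in> {1..2}" "w \<in> ?W" for i w
        using slice_mult_var[OF subspace_degree_part[OF id] degree_part_subset A(1,3) that(1) r] that(2)
        unfolding Y_def by blast
    qed (simp add: J_def)
    moreover have "vs.dim ?V \<le> Suc (ubl n I r e d) + vs.dim ?W"
      unfolding Y_def by (rule ubl_ge_slices[OF I A(1,2) r x(2)])
    ultimately have "\<gamma> \<le> Suc (ubl n I r e d)" by simp
    then show ?thesis using x(1) by (simp add: \<gamma>_def d_def \<alpha>_def)
  qed simp
  show ?thesis
    by (rule exI[of _ D], intro allI impI ballI, elim conjE, rule main)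
qed

end
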